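(* Let $N,m\ge 1$ be integers, let $T>0$, and let $W_{1,t},\dots,W_{m,t}$, $t\in[0,T]$, be independent standard one-dimensional Brownian motions on a probability space $(\Omega,\mathcal{F},\mathbb{P})$. For $i=1,\dots,N$ and $j=1,\dots,m$ let $\mu_i\in\mathbb{R}$, $\sigma_{ij}\in\mathbb{R}$ and $V_{i,0}>0$ be constants, with $\sum_{j=1}^m\sigma_{ij}^2>0$ for every $i$. Then the solution of the system of stochastic differential equations $$dV_{i,t}=V_{i,t}\Big(\mu_i\,dt+\sum_{j=1}^m\sigma_{ij}\,dW_{j,t}\Big),\qquad i=1,\dots,N,\ t\in[0,T],$$ with initial values $V_{1,0},\dots,V_{N,0}$, is the set of values $\{V_{1,t},\dots,V_{N,t}\}$ given by $$V_{i,t}=V_{i,0}\exp\Big\{\Big(\mu_i-\tfrac12\sum_{j=1}^m\sigma_{ij}^2\Big)t+\sum_{j=1}^m\sigma_{ij}W_{j,t}\Big\},\qquad i=1,\dots,N.$$ Moreover, for every $i=1,\dots,N$ and every $t\in(0,T]$, $V_{i,t}$ is log-normally distributed with mean $$E[V_{i,t}]=V_{i,0}\exp\{\mu_i t\}$$ and variance $$\mathrm{Var}[V_{i,t}]=V_{i,0}^2\exp\{2\mu_i t\}\Big(\exp\Big\{\sum_{j=1}^m\sigma_{ij}^2\,t\Big\}-1\Big).$$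
   Context: Stochastic differential equations are understood in the Itô sense. A solution is a family of continuous processes, adapted to the filtration of $(W_{1,t},\dots,W_{m,t})$, satisfying the corresponding integral equations almost surely; "the solution" is unique up to indistinguishability. A standard Brownian motion starts at $0$, has independent stationary increments and continuous sample paths almost surely, and its value at time $t>0$ is Gaussian with mean $0$ and variance $t$. A positive random variable is log-normally distributed if its natural logarithm is Gaussian with positive variance. *)

theory Defs
  imports "HOL-Probability.Probability"
begin

text \<open>
  Processes are functions \<open>X :: real \<Rightarrow> 'w \<Rightarrow> real\<close> (time, then outcome); only times in \<open>{0..T}\<close>
  matter. Paths are required to be continuous almost surely, and no completeness of the probability
  space and no completion of the filtration is assumed.
\<close>

definition continuous_process :: "'w measure \<Rightarrow> real \<Rightarrow> (real \<Rightarrow> 'w \<Rightarrow> real) \<Rightarrow> bool" where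
  "continuous_process M T X \<longleftrightarrow> (AE \<omega> in M. continuous_on {0..T} (\<lambda>t. X t \<omega>))"

definition standard_brownian_motion :: "'w measure \<Rightarrow> real \<Rightarrow> (real \<Rightarrow> 'w \<Rightarrow> real) \<Rightarrow> bool" where
  "standard_brownian_motion M T W \<longleftrightarrow>
     (\<forall>t\<in>{0..T}. W t \<in> borel_measurable M) \<and>
     (AE \<omega> in M. W 0 \<omega> = 0) \<and>
     (\<forall>n \<tau>. mono_on {..n} \<tau> \<and> \<tau> ` {..n} \<subseteq> {0..T} \<longrightarrow>
        prob_space.indep_vars M (\<lambda>_. borel) (\<lambda>k \<omega>. W (\<tau> (Suc k)) \<omega> - W (\<tau> k) \<omega>) {..<n::nat}) \<and>
     (\<forall>s h. 0 \<le> s \<and> 0 \<le> h \<and> s + h \<le> T \<longrightarrow>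
        distr M borel (\<lambda>\<omega>. W (s + h) \<omega> - W s \<omega>) = distr M borel (\<lambda>\<omega>. W h \<omega> - W 0 \<omega>)) \<and>
     continuous_process M T W \<and>
     (\<forall>t\<in>{0<..T}. distributed M lborel (W t) (normal_density 0 (sqrt t)))"

text \<open>Independence of the processes \<open>W 1, \<dots>, W m\<close>, each regarded as one random element of
  \<open>\<real>\<close>-valued functions on \<open>{0..T}\<close>.\<close>

definition independent_processes ::
    "'w measure \<Rightarrow> real \<Rightarrow> nat \<Rightarrow> (nat \<Rightarrow> real \<Rightarrow> 'w \<Rightarrow> real) \<Rightarrow> bool" where
  "independent_processes M T m W \<longleftrightarrow>
     prob_space.indep_vars M (\<lambda>_. PiM {0..T} (\<lambda>_. borel)) (\<lambda>j \<omega>. \<lambda>t\<in>{0..T}. W j t \<omega>) {1..m}"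

definition natural_filtration ::
    "'w measure \<Rightarrow> nat \<Rightarrow> (nat \<Rightarrow> real \<Rightarrow> 'w \<Rightarrow> real) \<Rightarrow> real \<Rightarrow> 'w measure" where
  "natural_filtration M m W t =
     sigma (space M) (\<Union>j\<in>{1..m}. \<Union>s\<in>{0..t}. {W j s -` B \<inter> space M | B. B \<in> sets borel})"

definition adapted_process :: "(real \<Rightarrow> 'w measure) \<Rightarrow> real \<Rightarrow> (real \<Rightarrow> 'w \<Rightarrow> real) \<Rightarrow> bool" where
  "adapted_process F T X \<longleftrightarrow> (\<forall>t\<in>{0..T}. X t \<in> borel_measurable (F t))"

definition tendsto_in_prob :: "'w measure \<Rightarrow> (nat \<Rightarrow> 'w \<Rightarrow> real) \<Rightarrow> ('w \<Rightarrow> real) \<Rightarrow> bool" where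
  "tendsto_in_prob M Y Z \<longleftrightarrow>
     (\<forall>n. Y n \<in> borel_measurable M) \<and> Z \<in> borel_measurable M \<and>
     (\<forall>\<epsilon>>0. (\<lambda>n. measure M {\<omega> \<in> space M. \<epsilon> < \<bar>Y n \<omega> - Z \<omega>\<bar>}) \<longlonglongrightarrow> 0)"

text \<open>
  The Ito integral \<open>X\<^sub>t = \<Sum>\<^sub>j \<integral>\<^sub>0\<^sup>t H\<^sub>j dW\<^sub>j\<close> of an \<open>m\<close>-dimensional integrand against an \<open>m\<close>-dimensional
  Brownian motion, built in the usual way from elementary processes
  \<open>\<Sum>\<^bsub>k<n\<^esub> \<Phi>\<^sub>k 1\<^bsub>(s\<^sub>k, s\<^sub>k\<^sub>+\<^sub>1]\<^esub>\<close> with \<open>0 = s\<^sub>0 < \<dots> < s\<^sub>n = T\<close> and \<open>\<Phi>\<^sub>k\<close> measurable at time \<open>s\<^sub>k\<close>. Component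
  \<open>j\<close> of the integrand is paired with \<open>W j\<close>.
\<close>

definition elementary_process ::
    "(real \<Rightarrow> 'w measure) \<Rightarrow> real \<Rightarrow> nat \<Rightarrow> nat \<Rightarrow> (nat \<Rightarrow> real) \<Rightarrow> (nat \<Rightarrow> nat \<Rightarrow> 'w \<Rightarrow> real) \<Rightarrow> bool"
  where
  "elementary_process F T m n s \<Phi> \<longleftrightarrow>
     s 0 = 0 \<and> s n = T \<and> (\<forall>k<n. s k < s (Suc k)) \<and>
     (\<forall>k<n. \<forall>j\<in>{1..m}. \<Phi> k j \<in> borel_measurable (F (s k)))"

definition elementary_value ::
    "nat \<Rightarrow> (nat \<Rightarrow> real) \<Rightarrow> (nat \<Rightarrow> nat \<Rightarrow> 'w \<Rightarrow> real) \<Rightarrow> nat \<Rightarrow> real \<Rightarrow> 'w \<Rightarrow> real" where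
  "elementary_value n s \<Phi> j t \<omega> = (\<Sum>k<n. \<Phi> k j \<omega> * indicator {s k<..s (Suc k)} t)"

definition elementary_integral ::
    "nat \<Rightarrow> (nat \<Rightarrow> real \<Rightarrow> 'w \<Rightarrow> real) \<Rightarrow> nat \<Rightarrow> (nat \<Rightarrow> real) \<Rightarrow> (nat \<Rightarrow> nat \<Rightarrow> 'w \<Rightarrow> real)
      \<Rightarrow> real \<Rightarrow> 'w \<Rightarrow> real" where
  "elementary_integral m W n s \<Phi> t \<omega> =
     (\<Sum>j=1..m. \<Sum>k<n. \<Phi> k j \<omega> * (W j (min t (s (Suc k))) \<omega> - W j (min t (s k)) \<omega>))"

text \<open>
  \<open>X\<close> is (a version of) the Ito integral of \<open>H\<close> if it is continuous and arises as the limit in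
  probability of elementary integrals whose integrands \<open>H\<^sup>r\<close> satisfy
  \<open>\<integral>\<^sub>0\<^sup>T \<bar>H\<^sup>r\<^sub>s - H\<^sub>s\<bar>\<^sup>2 ds \<longlongrightarrow> 0\<close> in probability. The limit does not depend on the approximating sequence,
  so \<open>X\<close> is determined up to indistinguishability. Convergence is stated on the completed space because,
  with paths regular only almost surely, the time integral need only be measurable there.
\<close>

definition ito_integral ::
    "'w measure \<Rightarrow> (real \<Rightarrow> 'w measure) \<Rightarrow> real \<Rightarrow> nat \<Rightarrow> (nat \<Rightarrow> real \<Rightarrow> 'w \<Rightarrow> real)
      \<Rightarrow> (nat \<Rightarrow> real \<Rightarrow> 'w \<Rightarrow> real) \<Rightarrow> (real \<Rightarrow> 'w \<Rightarrow> real) \<Rightarrow> bool" where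
  "ito_integral M F T m W H X \<longleftrightarrow>
     (\<forall>j\<in>{1..m}. adapted_process F T (H j) \<and>
        (AE \<omega> in M. set_borel_measurable lborel {0..T} (\<lambda>s. H j s \<omega>) \<and>
                    set_integrable lborel {0..T} (\<lambda>s. (H j s \<omega>)\<^sup>2))) \<and>
     continuous_process M T X \<and>
     (\<exists>n s \<Phi>.
        (\<forall>r. elementary_process F T m (n r) (s r) (\<Phi> r)) \<and>
        tendsto_in_prob (completion M)
          (\<lambda>r \<omega>. LBINT u:{0..T}. (\<Sum>j=1..m. (elementary_value (n r) (s r) (\<Phi> r) j u \<omega> - H j u \<omega>)\<^sup>2))
          (\<lambda>_. 0) \<and>
        (\<forall>t\<in>{0..T}. tendsto_in_prob (completion M)
          (\<lambda>r. elementary_integral m W (n r) (s r) (\<Phi> r) t) (X t)))"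

text \<open>
  Solution on \<open>{0..T}\<close> of the autonomous system
  \<open>dV\<^sub>i = b\<^sub>i(V) dt + \<Sum>\<^sub>j a\<^sub>i\<^sub>j(V) dW\<^sub>j\<close>, \<open>i = 1, \<dots>, N\<close>, with initial value \<open>v0\<close>. The state \<open>V\<^sub>t\<close> is the
  vector \<open>\<lambda>k\<in>{1..N}. V k t \<omega>\<close>.
\<close>

definition sde_solution ::
    "'w measure \<Rightarrow> real \<Rightarrow> nat \<Rightarrow> (nat \<Rightarrow> real \<Rightarrow> 'w \<Rightarrow> real) \<Rightarrow> nat
      \<Rightarrow> (nat \<Rightarrow> (nat \<Rightarrow> real) \<Rightarrow> real) \<Rightarrow> (nat \<Rightarrow> nat \<Rightarrow> (nat \<Rightarrow> real) \<Rightarrow> real) \<Rightarrow> (nat \<Rightarrow> real)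
      \<Rightarrow> (nat \<Rightarrow> real \<Rightarrow> 'w \<Rightarrow> real) \<Rightarrow> bool" where
  "sde_solution M T m W N b a v0 V \<longleftrightarrow>
     (\<forall>i\<in>{1..N}.
        continuous_process M T (V i) \<and>
        adapted_process (natural_filtration M m W) T (V i) \<and>
        (AE \<omega> in M. set_integrable lborel {0..T} (\<lambda>s. b i (\<lambda>k\<in>{1..N}. V k s \<omega>))) \<and>
        (\<exists>X. ito_integral M (natural_filtration M m W) T m W
               (\<lambda>j s \<omega>. a i j (\<lambda>k\<in>{1..N}. V k s \<omega>)) X \<and>
             (AE \<omega> in M. \<forall>t\<in>{0..T}.
                V i t \<omega> = v0 i + (LBINT s:{0..t}. b i (\<lambda>k\<in>{1..N}. V k s \<omega>)) + X t \<omega>)))"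

definition indistinguishable ::
    "'w measure \<Rightarrow> real \<Rightarrow> nat \<Rightarrow> (nat \<Rightarrow> real \<Rightarrow> 'w \<Rightarrow> real) \<Rightarrow> (nat \<Rightarrow> real \<Rightarrow> 'w \<Rightarrow> real) \<Rightarrow> bool" where
  "indistinguishable M T N U V \<longleftrightarrow> (AE \<omega> in M. \<forall>i\<in>{1..N}. \<forall>t\<in>{0..T}. U i t \<omega> = V i t \<omega>)"

definition log_normal :: "'w measure \<Rightarrow> ('w \<Rightarrow> real) \<Rightarrow> bool" where
  "log_normal M X \<longleftrightarrow>
     X \<in> borel_measurable M \<and> (\<forall>\<omega>\<in>space M. 0 < X \<omega>) \<and>
     (\<exists>a s. 0 < s \<and> distributed M lborel (\<lambda>\<omega>. ln (X \<omega>)) (normal_density a s))"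

end

theory Submission
  imports Defs
begin

text \<open>
  Existence. Over a partition cell of length \<open>d\<close>, with \<open>L\<close> the increment of \<open>\<Sum>\<^sub>j c\<^sub>j W\<^sub>j\<close>, the increment of
  \<open>V\<close> is \<open>V (L + R + (exp (\<mu> d) - 1))\<close>. The residual \<open>R\<close> is independent of the past and has mean \<open>0\<close> and
  variance \<open>o(d)\<close>, so the residual terms, which are orthogonal, vanish in the limit of small mesh, and
  \<open>V\<^sub>t - V\<^sub>0 - \<integral>\<mu>V\<close> is the limit of the sums \<open>\<Sum> V L\<close>.

  Uniqueness. Let \<open>U\<close> be a solution and \<open>D = U - V\<close>. An approximating sequence of the Ito integral of \<open>U\<close>
  may be refined to have vanishing mesh. Then, on the event \<open>\<bar>D\<bar> \<le> R\<close> up to time \<open>t\<close>, which decreases in \<open>t\<close>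
  and is known at time \<open>t\<close>, the process \<open>D\<close> is a limit in probability of discrete sums, and the isometry for
  elementary processes bounds \<open>\<phi>(t) = E[D\<^sub>t\<^sup>2; \<bar>D\<bar> \<le> R on [0,t]]\<close> by a constant times the left Riemann sums
  of \<open>\<phi>\<close>. Hence \<open>\<phi>(t) \<le> R\<^sup>2 (C t)\<^sup>p / p!\<close> for all \<open>p\<close>, that is \<open>\<phi> = 0\<close>. This discrete form of the Gronwall
  argument needs neither stopping times nor Fubini's theorem.
\<close>

section \<open>Partitions and Riemann sums\<close>

text \<open>Coefficients of an elementary process carry no moments, so the isometry does not apply
  to an approximating sequence as it stands. The coefficients are cut off cell by cell, by the size
  of \<open>D\<close> and by the error accumulated so far; both are known at the left end of the
  cell, and with probability tending to 1 the second cut-off is not felt. Paths are regular only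
  almost surely and the filtration is not completed: events of the filtration are therefore tested
  at countably many times, and a time integral gets a measurable version as a limit of Riemann sums.
  Refinement is free, because an elementary process is unchanged when its cells are split and the
  coefficients repeated; the mesh must vanish because the drift and \<open>V\<close> are sampled at
  the nodes. The variance of the residual is \<open>o(d)\<close> because its first-order terms
  cancel: \<open>S d\<close> from the exponential, \<open>S d\<close> from \<open>L\<^sup>2\<close>
  and \<open>- 2 S d\<close> from the mixed term, with \<open>S\<close> the sum of the squares of
  \<open>c\<close>. The iteration starts from \<open>\<phi> \<le> R\<^sup>2\<close>; the factorial
  arises since a left Riemann sum of \<open>t ^ p\<close> stays below
  \<open>t ^ Suc p / Suc p\<close>.\<close>

definition is_partition :: "real \<Rightarrow> nat \<Rightarrow> (nat \<Rightarrow> real) \<Rightarrow> bool" where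
  "is_partition T n s \<longleftrightarrow> s 0 = 0 \<and> s n = T \<and> (\<forall>k<n. s k < s (Suc k))"

definition fine_partitions :: "real \<Rightarrow> (nat \<Rightarrow> nat) \<Rightarrow> (nat \<Rightarrow> nat \<Rightarrow> real) \<Rightarrow> bool" where
  "fine_partitions T n s \<longleftrightarrow> (\<forall>r. is_partition T (n r) (s r)) \<and>
     (\<forall>\<delta>>0. \<forall>\<^sub>F r in sequentially. \<forall>k<n r. s r (Suc k) - s r k \<le> \<delta>)"

lemma square_le_of_abs_le:
  fixes x y :: real
  assumes "\<bar>x\<bar> \<le> y" shows "x\<^sup>2 \<le> y\<^sup>2"
  using power_mono[OF assms, of 2] by simp

lemma is_partition_mono:
  assumes "is_partition T n s" "j \<le> k" "k \<le> n" shows "s j \<le> s k"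
  using assms(2,3)
proof (induction k rule: dec_induct)
  case (step k)
  moreover have "s k < s (Suc k)" using step assms(1) by (auto simp: is_partition_def)
  ultimately show ?case by simp
qed simp

lemma is_partition_bounds:
  assumes "is_partition T n s" "k \<le> n" shows "0 \<le> s k" "s k \<le> T"
  using is_partition_mono[OF assms(1), of 0 k] is_partition_mono[OF assms(1), of k n] assms
  by (auto simp: is_partition_def)

lemma is_partition_cell:
  assumes "is_partition T n s" "u \<in> {0<..T}"
  obtains k where "k < n" "u \<in> {s k<..s (Suc k)}"
proof -
  \<comment> \<open>The first node at or beyond \<open>u\<close> is the right end of the cell; it is
    not node 0 because \<open>s 0 = 0 < u\<close>.\<close>
  define m where "m = (LEAST m. u \<le> s m)"
  have ex: "u \<le> s n" using assms by (auto simp: is_partition_def)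
  have 1: "u \<le> s m" unfolding m_def by (rule LeastI[where P="\<lambda>m. u \<le> s m", OF ex])
  have 2: "m \<le> n" unfolding m_def by (rule Least_le[where P="\<lambda>m. u \<le> s m", OF ex])
  have "m \<noteq> 0"
  proof
    assume "m = 0"
    then show False using 1 assms by (auto simp: is_partition_def)
  qed
  then obtain k where k: "m = Suc k" by (cases m) auto
  have "\<not> u \<le> s k" using not_less_Least[of k "\<lambda>m. u \<le> s m"] k unfolding m_def by auto
  with 1 2 k that[of k] show thesis by auto
qed

lemma sum_cell:
  assumes "is_partition T n s" "k < n" "u \<in> {s k<..s (Suc k)}"
  shows "(\<Sum>l<n. g l * indicator {s l<..s (Suc l)} u) = (g k :: real)"
proof -
  have "g l * indicator {s l<..s (Suc l)} u = (if l = k then g k else 0)" if "l < n" for l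
  proof (cases "l = k")
    case False
    then consider "l < k" | "k < l" by linarith
    then have "u \<notin> {s l<..s (Suc l)}"
    proof cases
      case 1
      then have "s (Suc l) \<le> s k" using assms by (intro is_partition_mono[of T n]) auto
      then show ?thesis using assms(3) by auto
    next
      case 2
      then have "s (Suc k) \<le> s l" using assms that by (intro is_partition_mono[of T n]) auto
      then show ?thesis using assms(3) by auto
    qed
    then show ?thesis using False by simp
  qed (use assms in auto)
  then have "(\<Sum>l<n. g l * indicator {s l<..s (Suc l)} u) = (\<Sum>l<n. if l = k then g k else 0)"
    by (intro sum.cong) auto
  then show ?thesis using assms(2) by simp
qed

text \<open>Cells are closed on the right, so just to the left of \<open>u\<close> the step function
  stays in the cell of \<open>u\<close> and is constant. Left limits are the regularity that step
  functions share with continuous paths.\<close>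

lemma step_left_continuous:
  fixes g :: "nat \<Rightarrow> real"
  assumes ip: "is_partition T n s" and u: "u \<in> {0<..T}"
  shows "((\<lambda>u. \<Sum>l<n. g l * indicator {s l<..s (Suc l)} u) \<longlongrightarrow> (\<Sum>l<n. g l * indicator {s l<..s (Suc l)} u)) (at_left u)"
proof -
  obtain k where k: "k < n" "u \<in> {s k<..s (Suc k)}" using is_partition_cell[OF ip u] by metis
  have "\<forall>\<^sub>F w in at_left u. w \<in> {s k<..<u}" using k by (intro eventually_at_left_real) auto
  then have "\<forall>\<^sub>F w in at_left u. (\<Sum>l<n. g l * indicator {s l<..s (Suc l)} w) = (\<Sum>l<n. g l * indicator {s l<..s (Suc l)} u)"
  proof eventually_elim
    case (elim w)
    then have w: "w \<in> {s k<..s (Suc k)}" using k by auto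
    show ?case by (rule trans[OF sum_cell[OF ip k(1) w] sum_cell[OF ip k, symmetric]])
  qed
  then show ?thesis by (rule tendsto_eventually)
qed

lemma sum_cell_outside:
  assumes "is_partition T n s" "u \<notin> {0<..T}"
  shows "(\<Sum>l<n. g l * indicator {s l<..s (Suc l)} u) = (0 :: real)"
proof (intro sum.neutral ballI)
  fix l assume "l \<in> {..<n}"
  then have "0 \<le> s l" "s (Suc l) \<le> T" using is_partition_bounds[OF assms(1)] by auto
  then show "g l * indicator {s l<..s (Suc l)} u = 0" using assms(2) by (auto simp: indicator_def)
qed

lemma sum_cell_length:
  assumes "is_partition T n s" "t \<in> {0..T}"
  shows "(\<Sum>k<n. min t (s (Suc k)) - min t (s k)) = t"
  using assms by (subst sum_lessThan_telescope[of "\<lambda>k. min t (s k)"]) (auto simp: is_partition_def)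

lemma set_integral_step:
  assumes "is_partition T n s" "t \<in> {0..T}"
  shows "set_integrable lborel {0..t} (\<lambda>u. \<Sum>k<n. g k * indicator {s k<..s (Suc k)} u :: real)"
    and "(LBINT u:{0..t}. (\<Sum>k<n. g k * indicator {s k<..s (Suc k)} u))
      = (\<Sum>k<n. g k * (min t (s (Suc k)) - min t (s k)))"
proof -
  \<comment> \<open>Cutting the integral at \<open>t\<close> amounts to truncating both ends of each
    cell at \<open>t\<close>; a cell beyond \<open>t\<close> becomes the empty interval.\<close>
  have eq: "indicator {0..t} u *\<^sub>R (\<Sum>k<n. g k * indicator {s k<..s (Suc k)} u)
     = (\<Sum>k<n. g k * indicator {min t (s k)<..min t (s (Suc k))} u)" for u :: real
    unfolding scaleR_conv_of_real sum_distrib_left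
  proof (intro sum.cong refl)
    fix k assume k: "k \<in> {..<n}"
    then have "0 \<le> s k" "s k \<le> s (Suc k)"
      using is_partition_bounds[OF assms(1), of k] assms(1) by (auto simp: is_partition_def less_imp_le)
    then show "of_real (indicator {0..t} u) * (g k * indicator {s k<..s (Suc k)} u)
       = g k * indicator {min t (s k)<..min t (s (Suc k))} u"
      by (auto simp: indicator_def)
  qed
  have le: "min t (s k) \<le> min t (s (Suc k))" if "k < n" for k
    using is_partition_mono[OF assms(1), of k "Suc k"] that by auto
  show "set_integrable lborel {0..t} (\<lambda>u. \<Sum>k<n. g k * indicator {s k<..s (Suc k)} u :: real)"
    unfolding set_integrable_def eq
    by (intro Bochner_Integration.integrable_sum integrable_mult_right integrable_real_indicator)
      (auto simp: emeasure_lborel_Ioc[OF le])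
  show "(LBINT u:{0..t}. (\<Sum>k<n. g k * indicator {s k<..s (Suc k)} u))
      = (\<Sum>k<n. g k * (min t (s (Suc k)) - min t (s k)))"
    unfolding set_lebesgue_integral_def eq
    by (subst Bochner_Integration.integral_sum)
      (auto intro!: integrable_mult_right integrable_real_indicator sum.cong simp: emeasure_lborel_Ioc[OF le] measure_lborel_Ioc[OF le])
qed

text \<open>The value at \<open>u\<close> is \<open>g\<close> sampled at the left end of the cell of
  \<open>u\<close>. This node is strictly below \<open>u\<close> and tends to \<open>u\<close> with
  the mesh, so a left limit of \<open>g\<close> is enough.\<close>

lemma fine_step_tendsto:
  fixes g :: "real \<Rightarrow> real"
  assumes fp: "fine_partitions T n s" and u: "u \<in> {0<..T}" and lim: "(g \<longlongrightarrow> g u) (at_left u)"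
  shows "(\<lambda>r. \<Sum>k<n r. g (s r k) * indicator {s r k<..s r (Suc k)} u) \<longlonglongrightarrow> g u"
proof -
  have "\<forall>r. \<exists>k<n r. u \<in> {s r k<..s r (Suc k)}"
    using fp u is_partition_cell unfolding fine_partitions_def by metis
  then obtain k where k: "\<And>r. k r < n r" "\<And>r. u \<in> {s r (k r)<..s r (Suc (k r))}" by metis
  have "(\<lambda>r. s r (k r)) \<longlonglongrightarrow> u"
  proof (rule LIMSEQ_I)
    fix e :: real assume "0 < e"
    then have "\<forall>\<^sub>F r in sequentially. \<forall>k<n r. s r (Suc k) - s r k \<le> e / 2"
      using fp unfolding fine_partitions_def by (meson half_gt_zero)
    then obtain N where N: "\<And>r. N \<le> r \<Longrightarrow> \<forall>k<n r. s r (Suc k) - s r k \<le> e / 2"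
      unfolding eventually_sequentially by auto
    show "\<exists>N. \<forall>r\<ge>N. norm (s r (k r) - u) < e"
    proof (intro exI[of _ N] allI impI)
      fix r assume "N \<le> r"
      then have "s r (Suc (k r)) - s r (k r) \<le> e / 2" using N k by auto
      then show "norm (s r (k r) - u) < e" using k(2)[of r] \<open>0 < e\<close> by auto
    qed
  qed
  then have "filterlim (\<lambda>r. s r (k r)) (at_left u) sequentially"
    using k(2) by (intro filterlim_at_withinI always_eventually allI) (auto simp: less_le)
  then have "(\<lambda>r. g (s r (k r))) \<longlonglongrightarrow> g u" by (rule filterlim_compose[OF lim])
  moreover have "(\<Sum>l<n r. g (s r l) * indicator {s r l<..s r (Suc l)} u) = g (s r (k r))" for r
    using fp k by (intro sum_cell[of T]) (auto simp: fine_partitions_def)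
  ultimately show ?thesis by simp
qed

lemma fine_step_bounded:
  fixes g :: "real \<Rightarrow> real"
  assumes ip: "is_partition T n s" and K: "\<And>u. u \<in> {0..T} \<Longrightarrow> \<bar>g u\<bar> \<le> K" "0 \<le> K"
  shows "\<bar>\<Sum>k<n. g (s k) * indicator {s k<..s (Suc k)} u\<bar> \<le> K"
proof (cases "u \<in> {0<..T}")
  case True
  then obtain k where k: "k < n" "u \<in> {s k<..s (Suc k)}" using is_partition_cell[OF ip] by metis
  show ?thesis unfolding sum_cell[OF ip k]
    using is_partition_bounds[OF ip, of k] k by (intro K) auto
qed (use sum_cell_outside[OF ip] K in simp)

text \<open>Dominated convergence on \<open>{0<..t}\<close>. Measurability of \<open>g\<close> there
  is inherited from the step functions that converge to it.\<close>

lemma riemann_sum_tendsto: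
  fixes g :: "real \<Rightarrow> real"
  assumes fp: "fine_partitions T n s" and t: "t \<in> {0..T}"
    and lim: "\<And>u. u \<in> {0<..T} \<Longrightarrow> (g \<longlongrightarrow> g u) (at_left u)"
    and K: "\<And>u. u \<in> {0..T} \<Longrightarrow> \<bar>g u\<bar> \<le> K"
  shows "(\<lambda>r. \<Sum>k<n r. g (s r k) * (min t (s r (Suc k)) - min t (s r k))) \<longlonglongrightarrow> (LBINT u:{0..t}. g u)"
proof -
  let ?st = "\<lambda>r u. \<Sum>k<n r. g (s r k) * indicator {s r k<..s r (Suc k)} u"
  have ip: "is_partition T (n r) (s r)" for r using fp by (auto simp: fine_partitions_def)
  have K0: "0 \<le> K" using K[of 0] t by auto
  have lim': "(\<lambda>r. indicator {0<..t} u * ?st r u) \<longlonglongrightarrow> indicator {0<..t} u * g u" for u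
    using fine_step_tendsto[OF fp _ lim, of u] t by (cases "u \<in> {0<..t}") auto
  have meas: "(\<lambda>u. indicator {0<..t} u * g u) \<in> borel_measurable lborel"
    by (rule borel_measurable_LIMSEQ_real[OF lim'])
      (simp del: sum_mult_indicator, measurable)
  have stm: "(\<lambda>u. indicator {0<..t} u * ?st r u) \<in> borel_measurable lborel" for r
    by (simp del: sum_mult_indicator, measurable)
  have "(\<lambda>r. LINT u|lborel. indicator {0<..t} u * ?st r u) \<longlonglongrightarrow> (LINT u|lborel. indicator {0<..t} u * g u)"
  proof (rule integral_dominated_convergence[where w="\<lambda>u. K * indicator {0..T} u"])
    show "integrable lborel (\<lambda>u. K * indicator {0..T} u)"
      by (intro integrable_mult_right integrable_real_indicator) (auto simp: emeasure_lborel_Icc_eq)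
    show "AE u in lborel. norm (indicator {0<..t} u * ?st r u) \<le> K * indicator {0..T} u" for r
      using fine_step_bounded[OF ip K K0] t K0 by (intro AE_I2) (auto simp: indicator_def)
  next
    show "(\<lambda>u. indicator {0<..t} u * ?st r u) \<in> borel_measurable lborel" for r
      by (rule stm)
  qed (use lim' meas in auto)
  \<comment> \<open>No cell contains \<open>0\<close>, so convergence is known only on
    \<open>{0<..t}\<close>; passing to \<open>{0..t}\<close> changes the integrand at a single
    point.\<close>
  moreover have eq: "(LINT u|lborel. indicator {0<..t} u * f u) = (LBINT u:{0..t}. f u)" if f: "(\<lambda>u. indicator {0<..t} u * f u) \<in> borel_measurable lborel" for f :: "real \<Rightarrow> real"
    unfolding set_lebesgue_integral_def
  proof (rule integral_cong_AE)
    show ae: "AE x in lborel. indicator {0<..t} x * f x = indicat_real {0..t} x *\<^sub>R f x"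
      using AE_lborel_singleton[of "0::real"] by eventually_elim (auto simp: indicator_def)
    have "(\<lambda>x. indicat_real {0..t} x *\<^sub>R f x) = (\<lambda>x. indicator {0<..t} x * f x + indicator {0} x * f 0)"
      using t by (auto simp: indicator_def fun_eq_iff)
    then show "(\<lambda>x. indicat_real {0..t} x *\<^sub>R f x) \<in> borel_measurable lborel" using f by simp
  qed fact
  have st: "(LINT u|lborel. indicator {0<..t} u * ?st r u)
      = (\<Sum>k<n r. g (s r k) * (min t (s r (Suc k)) - min t (s r k)))" for r
    by (subst eq[OF stm], rule set_integral_step(2)[OF ip t])
  show ?thesis using calculation unfolding st eq[OF meas] .
qed

lemma left_limit_of_continuous_on:
  fixes h :: "real \<Rightarrow> real"
  assumes "continuous_on {0..T} h" "u \<in> {0<..T}" shows "(h \<longlongrightarrow> h u) (at_left u)"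
proof -
  have "(h \<longlongrightarrow> h u) (at u within {0..T})" using assms by (auto simp: continuous_on_def)
  then have "(h \<longlongrightarrow> h u) (at u within {0..u})" by (rule tendsto_within_subset) (use assms in auto)
  then show ?thesis using assms at_within_Icc_at_left[of 0 u] by auto
qed

lemma continuous_on_bound:
  fixes h :: "real \<Rightarrow> real"
  assumes "continuous_on {0..T} h"
  obtains K where "0 \<le> K" "\<And>u. u \<in> {0..T} \<Longrightarrow> \<bar>h u\<bar> \<le> K"
proof -
  have "bounded (h ` {0..T})" by (intro compact_imp_bounded compact_continuous_image assms) simp
  then obtain K where "\<forall>x\<in>h ` {0..T}. norm x \<le> K" unfolding bounded_iff by metis
  then have "\<bar>h u\<bar> \<le> \<bar>K\<bar>" if "u \<in> {0..T}" for u using that by (force intro: order_trans[OF _ abs_ge_self])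
  then show thesis by (intro that[of "\<bar>K\<bar>"]) auto
qed

lemma riemann_sum_continuous:
  fixes h :: "real \<Rightarrow> real"
  assumes "fine_partitions T n s" "t \<in> {0..T}" and h: "continuous_on {0..T} h"
  shows "(\<lambda>r. \<Sum>k<n r. h (s r k) * (min t (s r (Suc k)) - min t (s r k))) \<longlonglongrightarrow> (LBINT u:{0..t}. h u)"
proof -
  obtain K where "\<And>u. u \<in> {0..T} \<Longrightarrow> \<bar>h u\<bar> \<le> K" using continuous_on_bound[OF h] by metis
  then show ?thesis using assms by (intro riemann_sum_tendsto left_limit_of_continuous_on[OF h])
qed

lemma fine_partitions_uniform:
  assumes "0 < T"
  shows "fine_partitions T Suc (\<lambda>r k. T * real k / real (Suc r))"
  unfolding fine_partitions_def
proof (intro conjI allI impI)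
  fix r show "is_partition T (Suc r) (\<lambda>k. T * real k / real (Suc r))"
    using assms by (auto simp: is_partition_def divide_strict_right_mono simp del: of_nat_Suc intro!: divide_strict_right_mono)
next
  fix \<delta> :: real assume "0 < \<delta>"
  have "(\<lambda>r. T / real (Suc r)) \<longlonglongrightarrow> 0" by (rule LIMSEQ_Suc[OF lim_const_over_n])
  then have "\<forall>\<^sub>F r in sequentially. T / real (Suc r) < \<delta>" using \<open>0 < \<delta>\<close> by (rule order_tendstoD)
  then show "\<forall>\<^sub>F r in sequentially. \<forall>k<Suc r. T * real (Suc k) / real (Suc r) - T * real k / real (Suc r) \<le> \<delta>"
    by eventually_elim (auto simp: diff_divide_distrib[symmetric] right_diff_distrib[symmetric])
qed

text \<open>Bounded pointwise convergence away from \<open>u = 0\<close>, a point that no cell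
  contains. The bound \<open>(2 * K)\<^sup>2\<close> counts \<open>K\<close> once for the path and
  once for its samples.\<close>

lemma step_approximation_L2:
  fixes h :: "real \<Rightarrow> real"
  assumes fp: "fine_partitions T n s" and h: "continuous_on {0..T} h"
  shows "(\<lambda>r. LBINT u:{0..T}. ((\<Sum>k<n r. h (s r k) * indicator {s r k<..s r (Suc k)} u) - h u)\<^sup>2) \<longlonglongrightarrow> 0"
    and "set_integrable lborel {0..T} (\<lambda>u. ((\<Sum>k<n r. h (s r k) * indicator {s r k<..s r (Suc k)} u) - h u)\<^sup>2)"
proof -
  let ?st = "\<lambda>r u. \<Sum>k<n r. h (s r k) * indicator {s r k<..s r (Suc k)} u"
  have ip: "is_partition T (n r) (s r)" for r using fp by (auto simp: fine_partitions_def)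
  obtain K where K: "0 \<le> K" "\<And>u. u \<in> {0..T} \<Longrightarrow> \<bar>h u\<bar> \<le> K" using continuous_on_bound[OF h] by metis
  have hm: "(\<lambda>u. indicator {0..T} u *\<^sub>R h u) \<in> borel_measurable lborel"
    using borel_measurable_continuous_on_indicator[OF _ h] by auto
  \<comment> \<open>\<open>h\<close> is known to be measurable only after restriction to
    \<open>{0..T}\<close>; the outer indicator allows a second one inside the square.\<close>
  have eq: "indicator {0..T} u *\<^sub>R (?st r u - h u)\<^sup>2 = indicator {0..T} u * (?st r u - indicator {0..T} u *\<^sub>R h u)\<^sup>2" for r u
    by (auto simp: indicator_def)
  have meas: "(\<lambda>u. indicator {0..T} u *\<^sub>R (?st r u - h u)\<^sup>2) \<in> borel_measurable lborel" for r
    unfolding eq using hm by measurable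
  have bnd: "AE u in lborel. norm (indicator {0..T} u *\<^sub>R (?st r u - h u)\<^sup>2) \<le> (2 * K)\<^sup>2 * indicator {0..T} u" for r
  proof (intro AE_I2)
    fix u show "norm (indicator {0..T} u *\<^sub>R (?st r u - h u)\<^sup>2) \<le> (2 * K)\<^sup>2 * indicator {0..T} u"
    proof (cases "u \<in> {0..T}")
      case True
      have "\<bar>?st r u\<bar> \<le> K" using fine_step_bounded[OF ip, of h K r u] K by blast
      then have "\<bar>?st r u - h u\<bar> \<le> 2 * K" using K(2)[OF True] by linarith
      then have "(?st r u - h u)\<^sup>2 \<le> (2 * K)\<^sup>2" by (rule square_le_of_abs_le)
      then show ?thesis using True by simp
    qed simp
  qed
  have int: "integrable lborel (\<lambda>u. (2 * K)\<^sup>2 * indicator {0..T} u)"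
    by (intro integrable_mult_right integrable_real_indicator) (auto simp: emeasure_lborel_Icc_eq)
  have lim: "AE u in lborel. (\<lambda>r. indicator {0..T} u *\<^sub>R (?st r u - h u)\<^sup>2) \<longlonglongrightarrow> 0"
    using AE_lborel_singleton[of "0::real"]
  proof eventually_elim
    fix u :: real assume "u \<noteq> 0"
    show "(\<lambda>r. indicator {0..T} u *\<^sub>R (?st r u - h u)\<^sup>2) \<longlonglongrightarrow> 0"
    proof (cases "u \<in> {0..T}")
      case True
      then have "(\<lambda>r. ?st r u) \<longlonglongrightarrow> h u" using \<open>u \<noteq> 0\<close>
        by (intro fine_step_tendsto[OF fp] left_limit_of_continuous_on[OF h]) auto
      then have "(\<lambda>r. (?st r u - h u)\<^sup>2) \<longlonglongrightarrow> (h u - h u)\<^sup>2" by (intro tendsto_intros)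
      then show ?thesis using True by simp
    qed simp
  qed
  show "(\<lambda>r. LBINT u:{0..T}. (?st r u - h u)\<^sup>2) \<longlonglongrightarrow> 0"
    using integral_dominated_convergence[OF _ meas int lim bnd] unfolding set_lebesgue_integral_def by simp
  show "set_integrable lborel {0..T} (\<lambda>u. (?st r u - h u)\<^sup>2)"
    unfolding set_integrable_def by (rule Bochner_Integration.integrable_bound[OF int meas]) (use bnd in auto)
qed

section \<open>Elementary processes and convergence in probability\<close>

text \<open>Splits each cell into \<open>q\<close> equal pieces; piece \<open>l\<close> lies in the
  old cell \<open>l div q\<close>. A coefficient repeated as \<open>\<Phi> (l div q)\<close> then
  describes the same elementary process on a finer partition.\<close>

definition refine :: "nat \<Rightarrow> (nat \<Rightarrow> real) \<Rightarrow> nat \<Rightarrow> real" where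
  "refine q s l = s (l div q) + real (l mod q) / real q * (s (Suc (l div q)) - s (l div q))"

lemma refine_mult: "0 < q \<Longrightarrow> refine q s (k * q) = s k"
  by (simp add: refine_def)

lemma refine_Suc:
  assumes "0 < q"
  shows "refine q s (Suc l) - refine q s l = (s (Suc (l div q)) - s (l div q)) / real q"
proof (cases "Suc l mod q = 0")
  case True
  \<comment> \<open>Here \<open>l\<close> is the last piece of its cell, so \<open>Suc l\<close> is
    the left end of the next one and the interpolation restarts at \<open>0\<close>.\<close>
  then have "Suc (l mod q) = q" using assms by (metis mod_Suc nat.simps(3))
  moreover have "Suc l div q = Suc (l div q)" using True by (simp add: div_Suc)
  ultimately have "real (l mod q) = real q - 1" "Suc l div q = Suc (l div q)" by linarith+
  then have "refine q s (Suc l) - refine q s l = (s (Suc (l div q)) - s (l div q)) * (1 - real (l mod q) / real q)"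
    using True by (simp add: refine_def algebra_simps)
  also have "1 - real (l mod q) / real q = 1 / real q"
    using assms \<open>real (l mod q) = real q - 1\<close> by (simp add: field_simps)
  finally show ?thesis by simp
next
  case False
  then have "Suc l mod q = Suc (l mod q)" "Suc l div q = l div q" by (auto simp: mod_Suc div_Suc split: if_splits)
  then show ?thesis using assms by (simp add: refine_def field_simps)
qed

lemma is_partition_refine:
  assumes "is_partition T n s" "0 < q"
  shows "is_partition T (n * q) (refine q s)"
  unfolding is_partition_def
proof (intro conjI allI impI)
  show "refine q s 0 = 0" "refine q s (n * q) = T"
    using refine_mult[OF assms(2), of s 0] refine_mult[OF assms(2), of s n] assms by (auto simp: is_partition_def)
  fix l assume "l < n * q"
  then have "l div q < n" using assms(2) by (simp add: less_mult_imp_div_less)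
  then have "0 < (s (Suc (l div q)) - s (l div q)) / real q" using assms by (auto simp: is_partition_def)
  then show "refine q s l < refine q s (Suc l)" using refine_Suc[OF assms(2), of s l] by linarith
qed

text \<open>A cell is never longer than \<open>T\<close>, so its pieces have length at most
  \<open>T / Suc r\<close>, whatever the original partitions are.\<close>

lemma fine_partitions_refine:
  assumes "\<And>r. is_partition T (n r) (s r)"
  shows "fine_partitions T (\<lambda>r. n r * Suc r) (\<lambda>r. refine (Suc r) (s r))"
  unfolding fine_partitions_def
proof (intro conjI allI impI)
  show "is_partition T (n r * Suc r) (refine (Suc r) (s r))" for r
    using assms by (rule is_partition_refine) simp
  fix \<delta> :: real assume "0 < \<delta>"
  have "(\<lambda>r. T / real (Suc r)) \<longlonglongrightarrow> 0" by (rule LIMSEQ_Suc[OF lim_const_over_n])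
  then have "\<forall>\<^sub>F r in sequentially. T / real (Suc r) < \<delta>" using \<open>0 < \<delta>\<close> by (rule order_tendstoD)
  then show "\<forall>\<^sub>F r in sequentially. \<forall>k<n r * Suc r. refine (Suc r) (s r) (Suc k) - refine (Suc r) (s r) k \<le> \<delta>"
  proof eventually_elim
    case (elim r)
    show ?case
    proof (intro allI impI)
      fix k assume "k < n r * Suc r"
      then have k: "k div Suc r < n r" by (rule less_mult_imp_div_less)
      then have "s r (Suc (k div Suc r)) \<le> T" "0 \<le> s r (k div Suc r)"
        using is_partition_bounds[OF assms] by auto
      then have "refine (Suc r) (s r) (Suc k) - refine (Suc r) (s r) k \<le> T / real (Suc r)"
        unfolding refine_Suc[OF zero_less_Suc] by (intro divide_right_mono) auto
      then show "refine (Suc r) (s r) (Suc k) - refine (Suc r) (s r) k \<le> \<delta>" using elim by linarith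
    qed
  qed
qed

lemma sum_lessThan_add:
  fixes a b :: nat
  shows "(\<Sum>l<a + b. f l) = (\<Sum>l<a. f l) + (\<Sum>i<b. f (a + i) :: real)"
  by (induction b) simp_all

text \<open>Over the \<open>q\<close> pieces of one old cell the coefficient is constant, so the
  increments of \<open>g\<close> telescope. It serves both for values, with \<open>g\<close> the
  indicator of \<open>{..x}\<close> at a fixed time, and for integrals, with \<open>g\<close> a
  Brownian path stopped at \<open>t\<close>.\<close>

lemma sum_refine:
  fixes \<phi> g :: "_ \<Rightarrow> real"
  assumes "0 < q"
  shows "(\<Sum>l<n * q. \<phi> (l div q) * (g (refine q s (Suc l)) - g (refine q s l)))
     = (\<Sum>k<n. \<phi> k * (g (s (Suc k)) - g (s k)))"
proof (induction n)
  case (Suc n)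
  have "(\<Sum>l<Suc n * q. \<phi> (l div q) * (g (refine q s (Suc l)) - g (refine q s l)))
     = (\<Sum>l<n * q. \<phi> (l div q) * (g (refine q s (Suc l)) - g (refine q s l)))
      + (\<Sum>i<q. \<phi> ((n * q + i) div q) * (g (refine q s (Suc (n * q + i))) - g (refine q s (n * q + i))))"
    using sum_lessThan_add[of _ "n * q" q] by (simp add: add.commute)
  also have "(\<Sum>i<q. \<phi> ((n * q + i) div q) * (g (refine q s (Suc (n * q + i))) - g (refine q s (n * q + i))))
     = (\<Sum>i<q. \<phi> n * (g (refine q s (n * q + Suc i)) - g (refine q s (n * q + i))))"
    by (intro sum.cong) auto
  also have "\<dots> = \<phi> n * (g (refine q s (Suc n * q)) - g (refine q s (n * q)))"
    by (subst sum_distrib_left[symmetric], subst sum_lessThan_telescope[of "\<lambda>i. g (refine q s (n * q + i))"])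
      (simp add: add.commute)
  finally show ?case unfolding refine_mult[OF assms] Suc.IH by simp
qed simp

lemma indicator_Ioc_diff:
  assumes "a \<le> b" shows "indicator {a<..b} (t::real) = indicator {..b} t - (indicator {..a} t :: real)"
  using assms by (auto simp: indicator_def)

lemma elementary_process_partition:
  "elementary_process F T m n s \<Phi> \<Longrightarrow> is_partition T n s"
  by (simp add: elementary_process_def is_partition_def)

lemma elementary_value_refine:
  assumes "is_partition T n s" "0 < q"
  shows "elementary_value (n * q) (refine q s) (\<lambda>l. \<Phi> (l div q)) j t w = elementary_value n s \<Phi> j t w"
proof -
  have 1: "refine q s l \<le> refine q s (Suc l)" if "l < n * q" for l
    using is_partition_mono[OF is_partition_refine[OF assms], of l "Suc l"] that by auto
  have 2: "s l \<le> s (Suc l)" if "l < n" for l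
    using is_partition_mono[OF assms(1), of l "Suc l"] that by auto
  let ?g = "\<lambda>x. indicat_real {..x} t"
  have "elementary_value (n * q) (refine q s) (\<lambda>l. \<Phi> (l div q)) j t w
      = (\<Sum>l<n * q. \<Phi> (l div q) j w * (?g (refine q s (Suc l)) - ?g (refine q s l)))"
    unfolding elementary_value_def by (intro sum.cong refl) (subst indicator_Ioc_diff[OF 1], auto)
  also have "\<dots> = (\<Sum>k<n. \<Phi> k j w * (?g (s (Suc k)) - ?g (s k)))"
    by (rule sum_refine[OF assms(2), of "\<lambda>k. \<Phi> k j w"])
  also have "\<dots> = elementary_value n s \<Phi> j t w"
    unfolding elementary_value_def by (intro sum.cong refl) (subst indicator_Ioc_diff[OF 2], auto)
  finally show ?thesis .
qed

lemma elementary_integral_refine: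
  assumes "0 < q"
  shows "elementary_integral m W (n * q) (refine q s) (\<lambda>l. \<Phi> (l div q)) t w = elementary_integral m W n s \<Phi> t w"
  unfolding elementary_integral_def
  by (intro sum.cong refl sum_refine[OF assms, where g="\<lambda>x. W _ (min t x) w" and \<phi>="\<lambda>k. \<Phi> k _ w"])

text \<open>A coefficient known at the start of the old cell is now attached to a later node, where
  it is still known because the filtration increases.\<close>

lemma elementary_process_refine:
  fixes F :: "real \<Rightarrow> 'w measure"
  assumes ep: "elementary_process F T m n s \<Phi>" and q: "0 < q"
    and mono: "\<And>a b (f :: 'w \<Rightarrow> real). 0 \<le> a \<Longrightarrow> a \<le> b \<Longrightarrow> b \<le> T \<Longrightarrow> f \<in> borel_measurable (F a) \<Longrightarrow> f \<in> borel_measurable (F b)"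
  shows "elementary_process F T m (n * q) (refine q s) (\<lambda>l. \<Phi> (l div q))"
proof -
  note ip = elementary_process_partition[OF ep]
  note ip' = is_partition_refine[OF ip q]
  have "\<Phi> (l div q) j \<in> borel_measurable (F (refine q s l))" if l: "l < n * q" and j: "j \<in> {1..m}" for l j
  proof -
    have ld: "l div q < n" using l by (rule less_mult_imp_div_less)
    have "s (l div q) = refine q s (l div q * q)" using refine_mult[OF q] by simp
    also have "\<dots> \<le> refine q s l" using l by (intro is_partition_mono[OF ip']) auto
    finally have "s (l div q) \<le> refine q s l" .
    moreover have "\<Phi> (l div q) j \<in> borel_measurable (F (s (l div q)))"
      using ep ld j by (auto simp: elementary_process_def)
    ultimately show ?thesis using ld l is_partition_bounds(1)[OF ip, of "l div q"] is_partition_bounds(2)[OF ip', of l]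
      by (intro mono[of "s (l div q)" "refine q s l"]) auto
  qed
  then show ?thesis using ip' by (auto simp: elementary_process_def is_partition_def)
qed

section \<open>Square integrability and orthogonal sums\<close>

lemma integrable_mult_of_squares:
  fixes f g :: "'a \<Rightarrow> real"
  assumes "f \<in> borel_measurable M" "g \<in> borel_measurable M"
    and "integrable M (\<lambda>x. (f x)\<^sup>2)" "integrable M (\<lambda>x. (g x)\<^sup>2)"
  shows "integrable M (\<lambda>x. f x * g x)"
proof (rule Bochner_Integration.integrable_bound)
  show "integrable M (\<lambda>x. (f x)\<^sup>2 + (g x)\<^sup>2)" using assms by simp
  show "AE x in M. norm (f x * g x) \<le> norm ((f x)\<^sup>2 + (g x)\<^sup>2)"
  proof (intro AE_I2)
    fix x
    have "2 * (\<bar>f x\<bar> * \<bar>g x\<bar>) \<le> (f x)\<^sup>2 + (g x)\<^sup>2"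
      using zero_le_power2[of "\<bar>f x\<bar> - \<bar>g x\<bar>"] by (simp add: power2_diff algebra_simps)
    moreover have "0 \<le> \<bar>f x\<bar> * \<bar>g x\<bar>" by simp
    ultimately have "\<bar>f x\<bar> * \<bar>g x\<bar> \<le> (f x)\<^sup>2 + (g x)\<^sup>2" by linarith
    then show "norm (f x * g x) \<le> norm ((f x)\<^sup>2 + (g x)\<^sup>2)" by (simp add: abs_mult)
  qed
qed (use assms in measurable)

lemma integrable_square_add:
  fixes f g :: "'a \<Rightarrow> real"
  assumes "f \<in> borel_measurable M" "g \<in> borel_measurable M"
    and "integrable M (\<lambda>x. (f x)\<^sup>2)" "integrable M (\<lambda>x. (g x)\<^sup>2)"
  shows "integrable M (\<lambda>x. (f x + g x)\<^sup>2)"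
    and "(\<integral>x. (f x + g x)\<^sup>2 \<partial>M) = (\<integral>x. (f x)\<^sup>2 \<partial>M) + (\<integral>x. (g x)\<^sup>2 \<partial>M) + 2 * (\<integral>x. f x * g x \<partial>M)"
  using integrable_mult_of_squares[OF assms] assms by (simp_all add: power2_sum mult.assoc)

text \<open>Pythagoras by induction. The orthogonality hypothesis may assume that the partial sum is
  square integrable, which the induction has just shown; callers need this to factorise the mixed
  integral by independence.\<close>

lemma integral_square_sum_orthogonal:
  fixes Z :: "nat \<Rightarrow> 'a \<Rightarrow> real"
  assumes "\<And>k. k < n \<Longrightarrow> Z k \<in> borel_measurable M" "\<And>k. k < n \<Longrightarrow> integrable M (\<lambda>x. (Z k x)\<^sup>2)"
    and "\<And>l. l < n \<Longrightarrow> integrable M (\<lambda>x. (\<Sum>k<l. Z k x)\<^sup>2) \<Longrightarrow> (\<integral>x. (\<Sum>k<l. Z k x) * Z l x \<partial>M) = 0"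
  shows "integrable M (\<lambda>x. (\<Sum>k<n. Z k x)\<^sup>2) \<and> (\<integral>x. (\<Sum>k<n. Z k x)\<^sup>2 \<partial>M) = (\<Sum>k<n. \<integral>x. (Z k x)\<^sup>2 \<partial>M)"
  using assms
proof (induction n)
  case (Suc n)
  then have IH: "integrable M (\<lambda>x. (\<Sum>k<n. Z k x)\<^sup>2)"
      "(\<integral>x. (\<Sum>k<n. Z k x)\<^sup>2 \<partial>M) = (\<Sum>k<n. \<integral>x. (Z k x)\<^sup>2 \<partial>M)" by simp_all
  have m: "(\<lambda>x. \<Sum>k<n. Z k x) \<in> borel_measurable M" using Suc.prems(1) by (intro borel_measurable_sum) auto
  have "(\<integral>x. (\<Sum>k<n. Z k x) * Z n x \<partial>M) = 0" using Suc.prems(3)[of n] IH(1) by simp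
  then show ?case
    using integrable_square_add[OF m Suc.prems(1)[of n] IH(1) Suc.prems(2)[of n]] IH by simp
qed simp

section \<open>Convergence in probability and the completed space\<close>

lemma tendsto_in_probD:
  assumes "tendsto_in_prob M Y Z"
  shows "Y n \<in> borel_measurable M" "Z \<in> borel_measurable M"
    "0 < \<epsilon> \<Longrightarrow> (\<lambda>n. measure M {w \<in> space M. \<epsilon> < \<bar>Y n w - Z w\<bar>}) \<longlonglongrightarrow> 0"
  using assms by (auto simp: tendsto_in_prob_def)

text \<open>Almost surely the indicators of the deviation events are eventually \<open>0\<close>,
  and they are dominated by the constant \<open>1\<close>.\<close>

lemma (in prob_space) AE_imp_tendsto_in_prob:
  assumes [measurable]: "\<And>n. Y n \<in> borel_measurable M" "Z \<in> borel_measurable M"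
    and ae: "AE w in M. (\<lambda>n. Y n w) \<longlonglongrightarrow> Z w"
  shows "tendsto_in_prob M Y Z"
  unfolding tendsto_in_prob_def
proof (intro conjI allI impI)
  fix \<epsilon> :: real assume \<epsilon>: "0 < \<epsilon>"
  have "(\<lambda>n. \<integral>w. indicat_real {w \<in> space M. \<epsilon> < \<bar>Y n w - Z w\<bar>} w \<partial>M) \<longlonglongrightarrow> (\<integral>w. 0 \<partial>M)"
  proof (rule integral_dominated_convergence[where w="\<lambda>_. 1 :: real"])
    show "AE w in M. (\<lambda>n. indicat_real {w \<in> space M. \<epsilon> < \<bar>Y n w - Z w\<bar>} w) \<longlonglongrightarrow> 0"
      using ae
    proof eventually_elim
      case (elim w)
      then have "(\<lambda>n. \<bar>Y n w - Z w\<bar>) \<longlonglongrightarrow> 0" by (simp add: LIM_zero tendsto_rabs_zero)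
      then have "\<forall>\<^sub>F n in sequentially. \<bar>Y n w - Z w\<bar> < \<epsilon>" using \<epsilon> by (rule order_tendstoD)
      then show ?case by (intro tendsto_eventually) (auto elim!: eventually_mono simp: indicator_def)
    qed
  qed (auto simp: indicator_def)
  then show "(\<lambda>n. prob {w \<in> space M. \<epsilon> < \<bar>Y n w - Z w\<bar>}) \<longlonglongrightarrow> 0" by simp
qed (use assms in auto)

lemma (in prob_space) tendsto_in_prob_add:
  assumes Y: "tendsto_in_prob M Y Z" and Y': "tendsto_in_prob M Y' Z'"
  shows "tendsto_in_prob M (\<lambda>n w. Y n w + Y' n w) (\<lambda>w. Z w + Z' w)"
  unfolding tendsto_in_prob_def
proof (intro conjI allI impI)
  note [measurable] = tendsto_in_probD(1,2)[OF Y] tendsto_in_probD(1,2)[OF Y']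
  fix \<epsilon> :: real assume "0 < \<epsilon>"
  then have \<epsilon>: "0 < \<epsilon> / 2" by simp
  show "(\<lambda>n. prob {w \<in> space M. \<epsilon> < \<bar>Y n w + Y' n w - (Z w + Z' w)\<bar>}) \<longlonglongrightarrow> 0"
  proof (rule tendsto_sandwich[OF always_eventually always_eventually tendsto_const])
    show "(\<lambda>n. prob {w \<in> space M. \<epsilon> / 2 < \<bar>Y n w - Z w\<bar>} + prob {w \<in> space M. \<epsilon> / 2 < \<bar>Y' n w - Z' w\<bar>}) \<longlonglongrightarrow> 0"
      using tendsto_add[OF tendsto_in_probD(3)[OF Y \<epsilon>] tendsto_in_probD(3)[OF Y' \<epsilon>]] by simp
    have "prob {w \<in> space M. \<epsilon> < \<bar>Y n w + Y' n w - (Z w + Z' w)\<bar>}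
      \<le> prob ({w \<in> space M. \<epsilon> / 2 < \<bar>Y n w - Z w\<bar>} \<union> {w \<in> space M. \<epsilon> / 2 < \<bar>Y' n w - Z' w\<bar>})" for n
      by (intro finite_measure_mono) (auto simp: abs_real_def split: if_splits)
    also have "\<dots> n \<le> prob {w \<in> space M. \<epsilon> / 2 < \<bar>Y n w - Z w\<bar>} + prob {w \<in> space M. \<epsilon> / 2 < \<bar>Y' n w - Z' w\<bar>}" for n
      by (intro measure_Un_le) measurable
    finally show "\<forall>n. prob {w \<in> space M. \<epsilon> < \<bar>Y n w + Y' n w - (Z w + Z' w)\<bar>}
      \<le> prob {w \<in> space M. \<epsilon> / 2 < \<bar>Y n w - Z w\<bar>} + prob {w \<in> space M. \<epsilon> / 2 < \<bar>Y' n w - Z' w\<bar>}" by blast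
  qed simp
qed (use tendsto_in_probD(1,2)[OF Y] tendsto_in_probD(1,2)[OF Y'] in measurable)

lemma tendsto_in_prob_uminus:
  "tendsto_in_prob M Y Z \<Longrightarrow> tendsto_in_prob M (\<lambda>n w. - Y n w) (\<lambda>w. - Z w)"
  by (simp add: tendsto_in_prob_def abs_minus_commute)

lemma (in prob_space) tendsto_in_prob_diff:
  assumes Y: "tendsto_in_prob M Y Z" and Y': "tendsto_in_prob M Y' Z'"
  shows "tendsto_in_prob M (\<lambda>n w. Y n w - Y' n w) (\<lambda>w. Z w - Z' w)"
  using tendsto_in_prob_add[OF Y tendsto_in_prob_uminus[OF Y']] by simp

lemma tendsto_in_prob_AE_cong:
  assumes Y: "tendsto_in_prob M Y Z" and "\<And>n. Y' n \<in> borel_measurable M" "Z' \<in> borel_measurable M"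
    and "\<And>n. AE w in M. Y n w = Y' n w" "AE w in M. Z w = Z' w"
  shows "tendsto_in_prob M Y' Z'"
proof -
  note [measurable] = tendsto_in_probD(1,2)[OF Y] assms(2,3)
  have "measure M {w \<in> space M. \<epsilon> < \<bar>Y n w - Z w\<bar>} = measure M {w \<in> space M. \<epsilon> < \<bar>Y' n w - Z' w\<bar>}" for n \<epsilon>
    using assms(4)[of n] assms(5) by (intro measure_eq_AE) (measurable, auto)
  then show ?thesis using Y assms(2,3) by (simp add: tendsto_in_prob_def)
qed

lemma tendsto_in_prob_completion_iff:
  assumes [measurable]: "\<And>n. Y n \<in> borel_measurable M" "Z \<in> borel_measurable M"
  shows "tendsto_in_prob (completion M) Y Z \<longleftrightarrow> tendsto_in_prob M Y Z"
proof -
  have "measure (completion M) {w \<in> space M. \<epsilon> < \<bar>Y n w - Z w\<bar>} = measure M {w \<in> space M. \<epsilon> < \<bar>Y n w - Z w\<bar>}" for n \<epsilon>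
    by (intro measure_completion) measurable
  then show ?thesis using assms by (simp add: tendsto_in_prob_def measurable_completion)
qed

lemma completion_measurable_AE_cong:
  fixes f g :: "'a \<Rightarrow> real"
  assumes f: "f \<in> borel_measurable M" and ae: "AE x in M. f x = g x"
  shows "g \<in> borel_measurable (completion M)"
proof (rule measurableI)
  fix A :: "real set" assume A: "A \<in> sets borel"
  show "g -` A \<inter> space (completion M) \<in> sets (completion M)"
  proof (rule completion.in_sets_AE)
    show "f -` A \<inter> space M \<in> sets (completion M)" using f A by (auto dest: measurable_sets)
    show "AE x in completion M. (x \<in> f -` A \<inter> space M) = (x \<in> g -` A \<inter> space (completion M))"
      using AE_completion[OF ae] by (auto elim!: eventually_mono)
  qed auto
qed simp

text \<open>The pointwise \<open>lim\<close> is measurable and agrees with \<open>g\<close> almost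
  surely, and a real function measurable for the completion has a version measurable for
  \<open>M\<close>. Time integrals are handled in this way.\<close>

lemma completion_measurable_AE_limit:
  fixes f :: "nat \<Rightarrow> 'a \<Rightarrow> real"
  assumes f[measurable]: "\<And>n. f n \<in> borel_measurable M" and ae: "AE x in M. (\<lambda>n. f n x) \<longlonglongrightarrow> g x"
  shows "g \<in> borel_measurable (completion M)"
    and "\<exists>g'\<in>borel_measurable M. AE x in M. g x = g' x"
proof -
  have m: "(\<lambda>x. lim (\<lambda>n. f n x)) \<in> borel_measurable M" by measurable
  have "AE x in M. lim (\<lambda>n. f n x) = g x" using ae by eventually_elim (rule limI)
  with m show "g \<in> borel_measurable (completion M)" by (rule completion_measurable_AE_cong)
  then show "\<exists>g'\<in>borel_measurable M. AE x in M. g x = g' x" by (rule completion_ex_borel_measurable_real)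
qed

lemma (in prob_space) tendsto_in_prob_L2:
  assumes m[measurable]: "\<And>n. Y n \<in> borel_measurable M" and int: "\<And>n. integrable M (\<lambda>w. (Y n w)\<^sup>2)"
    and lim: "(\<lambda>n. expectation (\<lambda>w. (Y n w)\<^sup>2)) \<longlonglongrightarrow> 0"
  shows "tendsto_in_prob M Y (\<lambda>_. 0)"
  unfolding tendsto_in_prob_def
proof (intro conjI allI impI)
  fix \<epsilon> :: real assume \<epsilon>: "0 < \<epsilon>"
  show "(\<lambda>n. prob {w \<in> space M. \<epsilon> < \<bar>Y n w - 0\<bar>}) \<longlonglongrightarrow> 0"
  proof (rule tendsto_sandwich[OF always_eventually always_eventually tendsto_const])
    show "(\<lambda>n. expectation (\<lambda>w. (Y n w)\<^sup>2) / \<epsilon>\<^sup>2) \<longlonglongrightarrow> 0" using tendsto_divide_zero[OF lim] .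
    have "prob {w \<in> space M. \<epsilon> < \<bar>Y n w - 0\<bar>} \<le> prob {w \<in> space M. \<epsilon>\<^sup>2 \<le> (Y n w)\<^sup>2}" for n
      using \<epsilon> by (intro finite_measure_mono) (auto intro: abs_le_square_iff[THEN iffD1])
    also have "\<dots> n \<le> expectation (\<lambda>w. (Y n w)\<^sup>2) / \<epsilon>\<^sup>2" for n
      using \<epsilon> by (intro integral_Markov_inequality_measure[OF int, where A="{}"]) auto
    finally show "\<forall>n. prob {w \<in> space M. \<epsilon> < \<bar>Y n w - 0\<bar>} \<le> expectation (\<lambda>w. (Y n w)\<^sup>2) / \<epsilon>\<^sup>2" by blast
  qed simp
qed (use m in auto)

text \<open>A version of Fatou's lemma. The factor \<open>2\<close>, which saves the passage to an almost surely convergent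
  subsequence, is harmless in the Gronwall argument.\<close>

lemma (in prob_space) second_moment_le_of_tendsto_in_prob:
  assumes Y: "tendsto_in_prob M Y Z" and bnd: "\<And>w. w \<in> space M \<Longrightarrow> \<bar>Z w\<bar> \<le> R"
    and int: "\<And>n. integrable M (\<lambda>w. (Y n w)\<^sup>2)"
    and le: "\<forall>\<^sub>F n in sequentially. expectation (\<lambda>w. (Y n w)\<^sup>2) \<le> c"
  shows "expectation (\<lambda>w. (Z w)\<^sup>2) \<le> 2 * c"
proof -
  note [measurable] = tendsto_in_probD(1,2)[OF Y]
  obtain w0 where "w0 \<in> space M" using not_empty by auto
  then have R: "0 \<le> R" using bnd[of w0] by linarith
  have "expectation (\<lambda>w. (Z w)\<^sup>2) \<le> 2 * c + 2 * \<epsilon>\<^sup>2" if \<epsilon>: "0 < \<epsilon>" for \<epsilon>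
  proof -
    let ?A = "\<lambda>n. {w \<in> space M. \<epsilon> < \<bar>Y n w - Z w\<bar>}"
    have A[measurable]: "?A n \<in> events" for n by measurable
    \<comment> \<open>Off \<open>?A n\<close> the difference of \<open>Y n\<close> and
      \<open>Z\<close> is at most \<open>\<epsilon>\<close>, and the square of a sum costs the
      factor \<open>2\<close>; on \<open>?A n\<close> only the bound \<open>R\<close> is available,
      but the probability of this event vanishes.\<close>
    have ptw: "(Z w)\<^sup>2 \<le> 2 * (Y n w)\<^sup>2 + 2 * \<epsilon>\<^sup>2 + R\<^sup>2 * indicator (?A n) w" if "w \<in> space M" for n w
    proof (cases "w \<in> ?A n")
      case True
      have "(Z w)\<^sup>2 \<le> R\<^sup>2" using bnd[OF that] by (rule square_le_of_abs_le)
      then show ?thesis using True by (simp add: add_nonneg_nonneg add_increasing)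
    next
      case False
      then have "(Y n w - Z w)\<^sup>2 \<le> \<epsilon>\<^sup>2" using that \<epsilon> by (auto simp: abs_le_square_iff[symmetric])
      moreover have "(Z w)\<^sup>2 \<le> 2 * (Y n w)\<^sup>2 + 2 * (Y n w - Z w)\<^sup>2"
        using zero_le_power2[of "2 * Y n w - Z w"] by (simp add: power2_eq_square algebra_simps)
      ultimately show ?thesis using False by simp
    qed
    have "expectation (\<lambda>w. (Z w)\<^sup>2) \<le> expectation (\<lambda>w. 2 * (Y n w)\<^sup>2 + 2 * \<epsilon>\<^sup>2 + R\<^sup>2 * indicator (?A n) w)" for n
    proof (rule integral_mono_AE)
      show "integrable M (\<lambda>w. (Z w)\<^sup>2)"
      proof (rule integrable_const_bound[where B="R\<^sup>2"])
        show "AE w in M. norm ((Z w)\<^sup>2) \<le> R\<^sup>2" using bnd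
          by (intro AE_I2) (simp add: square_le_of_abs_le)
      qed simp
      show "integrable M (\<lambda>w. 2 * (Y n w)\<^sup>2 + 2 * \<epsilon>\<^sup>2 + R\<^sup>2 * indicator (?A n) w)"
        using int by (intro Bochner_Integration.integrable_add integrable_mult_right integrable_real_indicator) (auto simp: emeasure_eq_measure)
    qed (use ptw in auto)
    also have "\<dots> n = 2 * expectation (\<lambda>w. (Y n w)\<^sup>2) + 2 * \<epsilon>\<^sup>2 + R\<^sup>2 * prob (?A n)" for n
      using int by (simp add: prob_space emeasure_eq_measure)
    finally have 1: "expectation (\<lambda>w. (Z w)\<^sup>2) \<le> 2 * expectation (\<lambda>w. (Y n w)\<^sup>2) + 2 * \<epsilon>\<^sup>2 + R\<^sup>2 * prob (?A n)" for n .
    have "(\<lambda>n. 2 * c + 2 * \<epsilon>\<^sup>2 + R\<^sup>2 * prob (?A n)) \<longlonglongrightarrow> 2 * c + 2 * \<epsilon>\<^sup>2 + R\<^sup>2 * 0"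
      by (intro tendsto_intros tendsto_in_probD(3)[OF Y \<epsilon>])
    then have "expectation (\<lambda>w. (Z w)\<^sup>2) \<le> 2 * c + 2 * \<epsilon>\<^sup>2 + R\<^sup>2 * 0"
    proof (rule tendsto_lowerbound)
      show "\<forall>\<^sub>F n in sequentially. expectation (\<lambda>w. (Z w)\<^sup>2) \<le> 2 * c + 2 * \<epsilon>\<^sup>2 + R\<^sup>2 * prob (?A n)"
        using le by eventually_elim (use 1 in \<open>smt (verit)\<close>)
    qed simp
    then show ?thesis by simp
  qed
  note * = this
  show ?thesis
  proof (rule field_le_epsilon)
    fix e :: real assume "0 < e"
    then show "expectation (\<lambda>w. (Z w)\<^sup>2) \<le> 2 * c + e" using *[of "sqrt (e / 2)"] by simp
  qed
qed

section \<open>The natural filtration and independent increments\<close>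

text \<open>The finitely many past times, with \<open>0\<close> and \<open>a\<close>, are sorted and
  followed by \<open>b\<close>. Up to \<open>W 0\<close>, past values are partial sums of all
  increments but the last, and the last one is \<open>W b - W a\<close>, so independence of
  increments applies.\<close>

lemma (in prob_space) brownian_past_indep_increment:
  assumes bm: "standard_brownian_motion M T W" and ab: "0 \<le> a" "a \<le> b" "b \<le> T"
    and S: "finite S" "S \<subseteq> {0..a}" and B: "\<And>s. s \<in> S \<Longrightarrow> B s \<in> sets borel" and C: "C \<in> sets borel"
  shows "prob ({w \<in> space M. \<forall>s\<in>S. W s w \<in> B s} \<inter> {w \<in> space M. W b w - W a w \<in> C})
    = prob {w \<in> space M. \<forall>s\<in>S. W s w \<in> B s} * prob {w \<in> space M. W b w - W a w \<in> C}"
proof -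
  define L where "L = sorted_list_of_set (insert 0 (insert a S))"
  have setL: "set L = insert 0 (insert a S)" using S by (simp add: L_def del: sorted_list_of_set_insert_remove)
  have sorted: "sorted L" by (simp add: L_def)
  define n where "n = length L"
  have n0: "0 < n" using setL by (cases L) (auto simp: n_def)
  \<comment> \<open>The list fills the indices \<open>0\<close> to \<open>n - 1\<close> and ends
    with \<open>a\<close>; index \<open>n\<close> is \<open>b\<close>, so increment number
    \<open>n - 1\<close> runs from \<open>a\<close> to \<open>b\<close>.\<close>
  define \<tau> where "\<tau> k = (if k < n then L ! k else b)" for k
  have L_in: "L ! k \<in> {0..a}" if "k < n" for k
    using nth_mem[of k L] that setL S ab by (auto simp: n_def)
  have \<tau>0: "\<tau> 0 = 0"
  proof -
    obtain i where "i < n" "L ! i = 0" using setL by (metis in_set_conv_nth insertI1 n_def)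
    then have "L ! 0 \<le> 0" using sorted_nth_mono[OF sorted, of 0 i] by (simp add: n_def)
    then show ?thesis using L_in[OF n0] n0 by (auto simp: \<tau>_def)
  qed
  have \<tau>_last: "\<tau> (n - 1) = a"
  proof -
    obtain i where "i < n" "L ! i = a" using setL by (metis in_set_conv_nth insertI1 insertI2 n_def)
    then have "a \<le> L ! (n - 1)" using sorted_nth_mono[OF sorted, of i "n - 1"] by (auto simp: n_def)
    then show ?thesis using L_in[of "n - 1"] n0 by (auto simp: \<tau>_def)
  qed
  have \<tau>_n: "\<tau> n = b" by (simp add: \<tau>_def)
  have mono: "mono_on {..n} \<tau>"
  proof (rule mono_onI)
    fix i k assume "i \<in> {..n}" "k \<in> {..n}" "i \<le> k"
    then show "\<tau> i \<le> \<tau> k"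
      using sorted_nth_mono[OF sorted, of i k] L_in[of i] ab by (auto simp: \<tau>_def n_def)
  qed
  have \<tau>_range: "\<tau> ` {..n} \<subseteq> {0..T}" using L_in ab by (force simp: \<tau>_def)
  define inc where "inc k w = W (\<tau> (Suc k)) w - W (\<tau> k) w" for k w
  have inc: "indep_vars (\<lambda>_. borel) inc {..<n}"
    using bm mono \<tau>_range unfolding standard_brownian_motion_def inc_def[abs_def] by blast
  define idx where "idx s = (SOME i. i < n \<and> L ! i = s)" for s
  have idx: "idx s < n" "\<tau> (idx s) = s" if "s \<in> S" for s
  proof -
    have "\<exists>i. i < n \<and> L ! i = s" using that setL by (metis in_set_conv_nth insertI2 n_def)
    from someI_ex[OF this] show "idx s < n" "\<tau> (idx s) = s" by (auto simp: idx_def \<tau>_def)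
  qed
  have Wm[measurable]: "W t \<in> borel_measurable M" if "t \<in> {0..T}" for t
    using bm that by (auto simp: standard_brownian_motion_def)
  have W0: "AE w in M. W 0 w = 0" using bm by (auto simp: standard_brownian_motion_def)
  have tel: "(\<Sum>k<i. inc k w) = W (\<tau> i) w - W 0 w" for i :: nat and w
    unfolding inc_def by (subst sum_lessThan_telescope[of "\<lambda>k. W (\<tau> k) w"]) (simp add: \<tau>0)
  \<comment> \<open>The past event as a condition on the first \<open>n - 1\<close> increments; it
    constrains \<open>W s - W 0\<close> instead of \<open>W s\<close>.\<close>
  define D where "D = {x \<in> space (PiM {..<n - 1} (\<lambda>_. borel)). \<forall>s\<in>S. (\<Sum>k<idx s. x k) \<in> B s}"
  have idx': "k < n - 1" if "s \<in> S" "k < idx s" for s k using idx[OF that(1)] that by auto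
  have D: "D \<in> sets (PiM {..<n - 1} (\<lambda>_. borel))"
  proof -
    have "{x \<in> space (PiM {..<n - 1} (\<lambda>_. borel)). (\<Sum>k<idx s. x k :: real) \<in> B s} \<in> sets (PiM {..<n - 1} (\<lambda>_. borel))" if "s \<in> S" for s
    proof -
      have "(\<lambda>x. (\<Sum>k<idx s. x k :: real)) \<in> borel_measurable (PiM {..<n - 1} (\<lambda>_. borel))"
        using idx'[OF that] by (intro borel_measurable_sum measurable_component_singleton) auto
      from measurable_sets[OF this B[OF that]] show ?thesis by (simp add: vimage_def Int_def conj_commute)
    qed
    then show ?thesis unfolding D_def using S by (intro sets.sets_Collect_finite_All) auto
  qed
  let ?P = "(\<lambda>w. restrict (\<lambda>k. inc k w) {..<n - 1}) -` D \<inter> space M"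
  let ?Q = "{w \<in> space M. W b w - W a w \<in> C}"
  have P_eq: "?P = {w \<in> space M. \<forall>s\<in>S. W s w - W 0 w \<in> B s}"
  proof -
    have "(\<Sum>k<idx s. restrict (\<lambda>k. inc k w) {..<n - 1} k) = W s w - W 0 w" if "s \<in> S" for s w
      using tel idx[OF that] idx'[OF that] by (simp add: tel)
    then show ?thesis by (auto simp: D_def space_PiM)
  qed
  have "indep_var (PiM {..<n - 1} (\<lambda>_. borel)) (\<lambda>w. restrict (\<lambda>k. inc k w) {..<n - 1})
      (PiM {n - 1} (\<lambda>_. borel)) (\<lambda>w. restrict (\<lambda>k. inc k w) {n - 1})"
    using n0 by (intro indep_var_restrict[OF inc]) auto
  moreover have E: "{x \<in> space (PiM {n - 1} (\<lambda>_. borel)). x (n - 1) \<in> C} \<in> sets (PiM {n - 1} (\<lambda>_. borel))"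
  proof -
    have "(\<lambda>x. x (n - 1) :: real) \<in> borel_measurable (PiM {n - 1} (\<lambda>_. borel))"
      by (intro measurable_component_singleton) auto
    from measurable_sets[OF this C] show ?thesis by (simp add: vimage_def Int_def conj_commute)
  qed
  ultimately have "prob ((\<lambda>w. (restrict (\<lambda>k. inc k w) {..<n - 1}, restrict (\<lambda>k. inc k w) {n - 1})) -` (D \<times> {x \<in> space (PiM {n - 1} (\<lambda>_. borel)). x (n - 1) \<in> C}) \<inter> space M)
     = prob ?P * prob ((\<lambda>w. restrict (\<lambda>k. inc k w) {n - 1}) -` {x \<in> space (PiM {n - 1} (\<lambda>_. borel)). x (n - 1) \<in> C} \<inter> space M)"
    using D by (intro indep_varD)
  moreover have "(\<lambda>w. restrict (\<lambda>k. inc k w) {n - 1}) -` {x \<in> space (PiM {n - 1} (\<lambda>_. borel)). x (n - 1) \<in> C} \<inter> space M = ?Q"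
    using n0 \<tau>_n \<tau>_last by (auto simp: space_PiM inc_def)
  moreover have "(\<lambda>w. (restrict (\<lambda>k. inc k w) {..<n - 1}, restrict (\<lambda>k. inc k w) {n - 1})) -` (D \<times> {x \<in> space (PiM {n - 1} (\<lambda>_. borel)). x (n - 1) \<in> C}) \<inter> space M = ?P \<inter> ?Q"
    using calculation(2) by blast
  ultimately have 1: "prob (?P \<inter> ?Q) = prob ?P * prob ?Q" by simp
  have Sm: "{w \<in> space M. \<forall>s\<in>S. W s w \<in> B s} \<in> events"
  proof (rule sets.sets_Collect_finite_All)
    fix s assume s: "s \<in> S"
    have "W s -` B s \<inter> space M \<in> events"
      using s S B ab by (intro measurable_sets[OF Wm]) auto
    then show "{w \<in> space M. W s w \<in> B s} \<in> events" by (simp add: vimage_def Int_def conj_commute)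
  qed (use S in simp)
  have "W a \<in> borel_measurable M" "W b \<in> borel_measurable M" using ab by (auto intro: Wm)
  then have Qm: "?Q \<in> events" using C by measurable
  have Pm: "?P \<in> events"
    using inc by (intro measurable_sets[OF measurable_restrict D]) (auto simp: indep_vars_def)
  \<comment> \<open>\<open>W 0 = 0\<close> holds only almost surely, so the event for
    \<open>W s - W 0\<close> is exchanged for the one for \<open>W s\<close> up to a null
    set.\<close>
  have ae: "AE w in M. (w \<in> ?P) = (w \<in> {w \<in> space M. \<forall>s\<in>S. W s w \<in> B s})"
    using W0 unfolding P_eq by eventually_elim simp
  have "prob ?P = prob {w \<in> space M. \<forall>s\<in>S. W s w \<in> B s}"
    using Pm Sm ae by (intro measure_eq_AE) auto
  moreover have "prob (?P \<inter> ?Q) = prob ({w \<in> space M. \<forall>s\<in>S. W s w \<in> B s} \<inter> ?Q)"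
    using Pm Sm Qm ae by (intro measure_eq_AE) auto
  ultimately show ?thesis using 1 by simp
qed

locale brownian_family = prob_space M for M :: "'w measure" +
  fixes T :: real and m :: nat and W :: "nat \<Rightarrow> real \<Rightarrow> 'w \<Rightarrow> real"
  assumes T_pos: "0 < T"
    and brownian: "\<And>j. j \<in> {1..m} \<Longrightarrow> standard_brownian_motion M T (W j)"
    and indep_W: "independent_processes M T m W"
begin

abbreviation F :: "real \<Rightarrow> 'w measure" where "F \<equiv> natural_filtration M m W"

lemma W_measurable[measurable (raw)]: "j \<in> {1..m} \<Longrightarrow> t \<in> {0..T} \<Longrightarrow> W j t \<in> borel_measurable M"
  using brownian by (auto simp: standard_brownian_motion_def)

lemma space_F[simp]: "space (F t) = space M"
  by (simp add: natural_filtration_def space_measure_of_conv)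

lemma sets_F: "sets (F t) = sigma_sets (space M) (\<Union>j\<in>{1..m}. \<Union>s\<in>{0..t}. {W j s -` B \<inter> space M | B. B \<in> sets borel})"
  unfolding natural_filtration_def by (rule sets_measure_of) auto

lemma sets_F_mono: "a \<le> b \<Longrightarrow> sets (F a) \<subseteq> sets (F b)"
  unfolding sets_F by (intro sigma_sets_mono') fastforce

lemma sets_F_le: "t \<le> T \<Longrightarrow> sets (F t) \<subseteq> sets M"
  unfolding sets_F by (intro sets.sigma_sets_subset) (auto intro!: measurable_sets[OF W_measurable])

lemma F_measurable_mono: "a \<le> b \<Longrightarrow> f \<in> measurable (F a) N \<Longrightarrow> f \<in> measurable (F b) N"
  using sets_F_mono[of a b] by (auto simp: measurable_def)

lemma F_measurable: "t \<le> T \<Longrightarrow> f \<in> measurable (F t) N \<Longrightarrow> f \<in> measurable M N"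
  using sets_F_le[of t] by (auto simp: measurable_def)

lemma W_adapted: "j \<in> {1..m} \<Longrightarrow> 0 \<le> s \<Longrightarrow> s \<le> t \<Longrightarrow> W j s \<in> borel_measurable (F t)"
  unfolding measurable_def space_F sets_F by (auto intro!: sigma_sets.Basic bexI[of _ j] bexI[of _ s] exI)

text \<open>For a single \<open>j\<close> this is \<open>brownian_past_indep_increment\<close>;
  across \<open>j\<close> it comes from the independence of whole paths. The pasts and the
  increments, \<open>2 * m\<close> families in all, are jointly independent on Int-stable generators
  and are then grouped into past and increment.\<close>

lemma past_and_increments_indep:
  assumes ab: "0 \<le> a" "a \<le> b" "b \<le> T"
  shows "indep_set (sets (F a)) (sigma_sets (space M) (\<Union>j\<in>{1..m}. {{w \<in> space M. W j b w - W j a w \<in> C} | C. C \<in> sets borel}))"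
proof (cases "m = 0")
  case True
  \<comment> \<open>Both sigma-algebras are trivial here. The case is split off because the finite
    criterion used below is applied to a nonempty index set.\<close>
  then show ?thesis unfolding sets_F
    by (auto simp: indep_sets2_eq sigma_sets_empty_eq prob_space)
next
  case False
  let ?past = "\<lambda>j. {{w \<in> space M. \<forall>s\<in>S. W j s w \<in> B s} | S B. finite S \<and> S \<subseteq> {0..a} \<and> (\<forall>s\<in>S. B s \<in> sets borel)}"
  let ?incr = "\<lambda>j. {{w \<in> space M. W j b w - W j a w \<in> C} | C. C \<in> sets borel}"
  define G where "G = (\<lambda>(j, c). if c then ?past j else ?incr j)"
  define X where "X j w = (\<lambda>t\<in>{0..T}. W j t w)" for j w
  let ?PT = "PiM {0..T} (\<lambda>_. borel :: real measure)"
  have X: "indep_vars (\<lambda>_. ?PT) X {1..m}"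
    using indep_W by (simp add: independent_processes_def X_def[abs_def])
  then have Xm: "X j \<in> measurable M ?PT" if "j \<in> {1..m}" for j using that by (auto simp: indep_vars_def)
  \<comment> \<open>A past event and an increment event of the same Brownian motion together form
    one event of its path; this is how the independence of the paths enters.\<close>
  have repr: "\<exists>D\<in>sets ?PT. E1 \<inter> E2 = X j -` D \<inter> space M \<and> prob (E1 \<inter> E2) = prob E1 * prob E2"
    if j: "j \<in> {1..m}" and E1: "E1 \<in> ?past j" and E2: "E2 \<in> ?incr j" for j E1 E2
  proof -
    obtain S B where S: "finite S" "S \<subseteq> {0..a}" "\<And>s. s \<in> S \<Longrightarrow> B s \<in> sets borel" and E1: "E1 = {w \<in> space M. \<forall>s\<in>S. W j s w \<in> B s}"
      using E1 by auto
    obtain C where C: "C \<in> sets borel" and E2: "E2 = {w \<in> space M. W j b w - W j a w \<in> C}" using E2 by auto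
    let ?D = "{x \<in> space ?PT. (\<forall>s\<in>S. x s \<in> B s) \<and> x b - x a \<in> C}"
    have comp: "(\<lambda>x. x s) \<in> borel_measurable ?PT" if "s \<in> {0..T}" for s
      using that by (rule measurable_component_singleton)
    have "?D = {x \<in> space ?PT. (\<forall>s\<in>S. x s \<in> B s)} \<inter> ((\<lambda>x. x b - x a) -` C \<inter> space ?PT)" by auto
    also have "\<dots> \<in> sets ?PT"
    proof (rule sets.Int, rule sets.sets_Collect_finite_All)
      fix s assume s: "s \<in> S"
      have "(\<lambda>x. x s) -` B s \<inter> space ?PT \<in> sets ?PT"
        using s S ab by (intro measurable_sets[OF comp]) auto
      then show "{x \<in> space ?PT. x s \<in> B s} \<in> sets ?PT" by (simp add: vimage_def Int_def conj_commute)
    next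
      show "(\<lambda>x. x b - x a) -` C \<inter> space ?PT \<in> sets ?PT"
        using ab C by (intro measurable_sets[of _ _ borel] borel_measurable_diff comp) auto
    qed (use S in auto)
    finally have D: "?D \<in> sets ?PT" .
    have "E1 \<inter> E2 = X j -` ?D \<inter> space M"
    proof -
      have "X j w \<in> space ?PT" for w by (auto simp: X_def space_PiM)
      moreover have "X j w s = W j s w" if "s \<in> S" for s w using that S ab by (auto simp: X_def)
      moreover have "X j w a = W j a w" "X j w b = W j b w" for w using ab by (auto simp: X_def)
      ultimately show ?thesis by (auto simp: E1 E2)
    qed
    moreover have "prob (E1 \<inter> E2) = prob E1 * prob E2"
      unfolding E1 E2 using brownian_past_indep_increment[OF brownian[OF j] ab S(1,2) S(3) C] by auto
    ultimately show ?thesis using D by blast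
  qed
  have space_past: "space M \<in> ?past j" for j by (auto intro!: exI[of _ "{}"])
  have space_incr: "space M \<in> ?incr j" for j by (auto intro!: exI[of _ UNIV])
  have past_ev: "?past j \<subseteq> events" and incr_ev: "?incr j \<subseteq> events" if j: "j \<in> {1..m}" for j
  proof -
    show "?past j \<subseteq> events"
    proof
      fix E assume "E \<in> ?past j"
      from repr[OF j this space_incr] obtain D where "D \<in> sets ?PT" "E \<inter> space M = X j -` D \<inter> space M" by auto
      moreover have "E \<inter> space M = E" using \<open>E \<in> ?past j\<close> by auto
      ultimately show "E \<in> events" using measurable_sets[OF Xm[OF j]] by simp
    qed
    show "?incr j \<subseteq> events"
    proof
      fix E assume "E \<in> ?incr j"
      from repr[OF j space_past this] obtain D where "D \<in> sets ?PT" "space M \<inter> E = X j -` D \<inter> space M" by auto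
      moreover have "space M \<inter> E = E" using \<open>E \<in> ?incr j\<close> by auto
      ultimately show "E \<in> events" using measurable_sets[OF Xm[OF j]] by simp
    qed
  qed
  have "indep_sets G ({1..m} \<times> UNIV)"
  proof (subst indep_sets_finite)
    show "{1..m} \<times> (UNIV :: bool set) \<noteq> {}" using False by auto
    show "G i \<subseteq> events" if "i \<in> {1..m} \<times> UNIV" for i using that past_ev incr_ev by (cases i) (auto simp: G_def)
    show "space M \<in> G i" if "i \<in> {1..m} \<times> UNIV" for i using space_past space_incr by (cases i) (simp add: G_def)
    show "\<forall>A\<in>Pi ({1..m} \<times> UNIV) G. prob (\<Inter>i\<in>{1..m} \<times> UNIV. A i) = (\<Prod>i\<in>{1..m} \<times> UNIV. prob (A i))"
    proof
      fix A assume A: "A \<in> Pi ({1..m} \<times> UNIV) G"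
      have A1: "A (j, True) \<in> ?past j" and A2: "A (j, False) \<in> ?incr j" if "j \<in> {1..m}" for j
        using Pi_mem[OF A, of "(j, True)"] Pi_mem[OF A, of "(j, False)"] that by (simp_all add: G_def)
      have "\<forall>j\<in>{1..m}. \<exists>D. D \<in> sets ?PT \<and> A (j, True) \<inter> A (j, False) = X j -` D \<inter> space M
          \<and> prob (A (j, True) \<inter> A (j, False)) = prob (A (j, True)) * prob (A (j, False))"
        using repr[OF _ A1 A2] by blast
      then obtain D where D: "\<And>j. j \<in> {1..m} \<Longrightarrow> D j \<in> sets ?PT"
         "\<And>j. j \<in> {1..m} \<Longrightarrow> A (j, True) \<inter> A (j, False) = X j -` D j \<inter> space M"
         "\<And>j. j \<in> {1..m} \<Longrightarrow> prob (A (j, True) \<inter> A (j, False)) = prob (A (j, True)) * prob (A (j, False))"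
        by metis
      have "(\<Inter>i\<in>{1..m} \<times> UNIV. A i) = (\<Inter>j\<in>{1..m}. A (j, True) \<inter> A (j, False))"
        by (auto simp: UNIV_bool)
      also have "\<dots> = (\<Inter>j\<in>{1..m}. X j -` D j \<inter> space M)" using D(2) by (intro INF_cong) auto
      also have "prob \<dots> = (\<Prod>j\<in>{1..m}. prob (X j -` D j \<inter> space M))"
        using False D(1) by (intro indep_varsD[OF X]) auto
      also have "\<dots> = (\<Prod>j\<in>{1..m}. prob (A (j, True)) * prob (A (j, False)))"
        using D(2,3) by (intro prod.cong) auto
      also have "\<dots> = (\<Prod>i\<in>{1..m} \<times> UNIV. prob (A i))"
        by (simp add: prod.cartesian_product' UNIV_bool mult.commute)
      finally show "prob (\<Inter>i\<in>{1..m} \<times> UNIV. A i) = (\<Prod>i\<in>{1..m} \<times> UNIV. prob (A i))" .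
    qed
  qed auto
  moreover have "(\<Union>c\<in>UNIV. {1..m} \<times> {c}) = {1..m} \<times> (UNIV :: bool set)" by auto
  ultimately have "indep_sets (\<lambda>c. sigma_sets (space M) (\<Union>i\<in>{1..m} \<times> {c}. G i)) (UNIV :: bool set)"
  proof (intro indep_sets_collect_sigma)
    fix i :: "nat \<times> bool" and c assume "i \<in> {1..m} \<times> {c}"
    obtain j c where i: "i = (j, c)" by (cases i)
    show "Int_stable (G i)"
    proof (cases c)
      case True
      show ?thesis unfolding Int_stable_def
      proof (intro ballI)
        fix E1 E2 assume "E1 \<in> G i" "E2 \<in> G i"
        then obtain S1 B1 S2 B2 where 1: "finite S1" "S1 \<subseteq> {0..a}" "\<forall>s\<in>S1. B1 s \<in> sets borel" "E1 = {w \<in> space M. \<forall>s\<in>S1. W j s w \<in> B1 s}"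
           "finite S2" "S2 \<subseteq> {0..a}" "\<forall>s\<in>S2. B2 s \<in> sets borel" "E2 = {w \<in> space M. \<forall>s\<in>S2. W j s w \<in> B2 s}"
          using True i by (auto simp: G_def)
        \<comment> \<open>The two time sets may differ; each is filled up with \<open>UNIV\<close>
          at the times where it imposes no condition.\<close>
        let ?B = "\<lambda>s. (if s \<in> S1 then B1 s else UNIV) \<inter> (if s \<in> S2 then B2 s else UNIV)"
        have "E1 \<inter> E2 = {w \<in> space M. \<forall>s\<in>S1 \<union> S2. W j s w \<in> ?B s}" using 1 by auto
        moreover have "\<forall>s\<in>S1 \<union> S2. ?B s \<in> sets borel" using 1 by auto
        ultimately have "E1 \<inter> E2 \<in> ?past j" using 1(1,2,5,6)
          by (intro CollectI exI[of _ "S1 \<union> S2"] exI[of _ ?B]) auto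
        then show "E1 \<inter> E2 \<in> G i" using True i by (simp add: G_def)
      qed
    next
      case False
      show ?thesis unfolding Int_stable_def
      proof (intro ballI)
        fix E1 E2 assume "E1 \<in> G i" "E2 \<in> G i"
        then obtain C1 C2 where "C1 \<in> sets borel" "E1 = {w \<in> space M. W j b w - W j a w \<in> C1}"
          "C2 \<in> sets borel" "E2 = {w \<in> space M. W j b w - W j a w \<in> C2}"
          using False i by (auto simp: G_def)
        then have "E1 \<inter> E2 \<in> ?incr j"
          by (intro CollectI exI[of _ "C1 \<inter> C2"]) auto
        then show "E1 \<inter> E2 \<in> G i" using False i by (simp add: G_def)
      qed
    qed
  qed (auto simp: disjoint_family_on_def)
  then have "indep_set (sigma_sets (space M) (\<Union>j\<in>{1..m}. ?past j)) (sigma_sets (space M) (\<Union>j\<in>{1..m}. ?incr j))"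
    unfolding indep_set_def
  proof (rule indep_sets_mono_sets)
    fix c :: bool
    have "(\<Union>i\<in>{1..m} \<times> {c}. G i) = (\<Union>j\<in>{1..m}. G (j, c))" by auto
    then show "case_bool (sigma_sets (space M) (\<Union>j\<in>{1..m}. ?past j)) (sigma_sets (space M) (\<Union>j\<in>{1..m}. ?incr j)) c
       \<subseteq> sigma_sets (space M) (\<Union>i\<in>{1..m} \<times> {c}. G i)" by (cases c) (simp_all add: G_def)
  qed
  moreover have "sets (F a) \<subseteq> sigma_sets (space M) (\<Union>j\<in>{1..m}. ?past j)"
    unfolding sets_F
  proof (rule sigma_sets_mono', safe)
    fix j s and B :: "real set" assume "j \<in> {1..m}" "s \<in> {0..a}" "B \<in> sets borel"
    then show "W j s -` B \<inter> space M \<in> (\<Union>j\<in>{1..m}. ?past j)"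
      by (intro UN_I[of j] CollectI exI[of _ "{s}"] exI[of _ "\<lambda>_. B"]) auto
  qed
  ultimately show ?thesis unfolding indep_sets2_eq by blast
qed

text \<open>All \<open>m\<close> increments as one random vector, so that nonlinear functions of
  them jointly can be tested against the past.\<close>

definition incr :: "real \<Rightarrow> real \<Rightarrow> 'w \<Rightarrow> nat \<Rightarrow> real" where
  "incr a b w = (\<lambda>j\<in>{1..m}. W j b w - W j a w)"

lemma incr_measurable_F:
  assumes "0 \<le> a" "a \<le> b" shows "incr a b \<in> measurable (F b) (PiM {1..m} (\<lambda>_. borel))"
  unfolding incr_def using assms by (intro measurable_restrict borel_measurable_diff W_adapted) auto

lemma past_indep_incr:
  assumes ab: "0 \<le> a" "a \<le> b" "b \<le> T" and \<Phi>: "\<Phi> \<in> borel_measurable (F a)"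
    and g: "g \<in> borel_measurable (PiM {1..m} (\<lambda>_. borel))"
  shows "indep_var borel \<Phi> borel (\<lambda>w. g (incr a b w))"
  unfolding indep_var_eq
proof (intro conjI)
  have "incr a b \<in> measurable M (PiM {1..m} (\<lambda>_. borel))"
    using F_measurable[OF ab(3) incr_measurable_F] ab by auto
  then show "(\<lambda>w. g (incr a b w)) \<in> borel_measurable M" using g by (rule measurable_compose)
  show "\<Phi> \<in> borel_measurable M" using \<Phi> ab by (intro F_measurable[of a]) auto
  let ?G = "\<Union>j\<in>{1..m}. {{w \<in> space M. W j b w - W j a w \<in> C} | C. C \<in> sets borel}"
  have Gs: "sets (sigma (space M) ?G) = sigma_sets (space M) ?G" by (rule sets_measure_of) auto
  have 1: "{\<Phi> -` A \<inter> space M |A. A \<in> sets borel} \<subseteq> sets (F a)"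
    using measurable_sets[OF \<Phi>] by auto
  have "sigma_sets (space M) {\<Phi> -` A \<inter> space M |A. A \<in> sets borel} \<subseteq> sets (F a)"
    using sets.sigma_sets_subset[OF 1] by simp
  moreover have "sigma_sets (space M) {(\<lambda>w. g (incr a b w)) -` A \<inter> space M |A. A \<in> sets borel} \<subseteq> sigma_sets (space M) ?G"
  proof -
    have "incr a b \<in> measurable (sigma (space M) ?G) (PiM {1..m} (\<lambda>_. borel))"
      unfolding incr_def
    proof (rule measurable_restrict)
      fix j assume j: "j \<in> {1..m}"
      show "(\<lambda>w. W j b w - W j a w) \<in> borel_measurable (sigma (space M) ?G)"
        unfolding measurable_def Gs using j by (auto simp: space_measure_of_conv vimage_def Int_def conj_commute intro!: sigma_sets.Basic)
    qed
    then have "(\<lambda>w. g (incr a b w)) \<in> borel_measurable (sigma (space M) ?G)" using g by (rule measurable_compose)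
    from measurable_sets[OF this] have "{(\<lambda>w. g (incr a b w)) -` A \<inter> space M |A. A \<in> sets borel} \<subseteq> sets (sigma (space M) ?G)"
      by (auto simp: space_measure_of_conv)
    from sets.sigma_sets_subset[OF this] show ?thesis unfolding Gs by (simp add: space_measure_of_conv)
  qed
  ultimately show "indep_set (sigma_sets (space M) {\<Phi> -` A \<inter> space M |A. A \<in> sets borel})
     (sigma_sets (space M) {(\<lambda>w. g (incr a b w)) -` A \<inter> space M |A. A \<in> sets borel})"
    using past_and_increments_indep[OF ab] unfolding indep_sets2_eq by blast
qed

end

section \<open>The Ito isometry\<close>

text \<open>Exponential tilting: completing the square moves the mean to
  \<open>c * s\<^sup>2\<close> and keeps the variance. Moments of \<open>exp (c * X)\<close> and
  \<open>X * exp (c * X)\<close> thus become the mass and the mean of a shifted Gaussian.\<close>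

lemma normal_density_exp:
  assumes "0 < s"
  shows "normal_density 0 s x * exp (c * x) = exp (c\<^sup>2 * s\<^sup>2 / 2) * normal_density (c * s\<^sup>2) s x"
proof -
  have "- (x - 0)\<^sup>2 / (2 * s\<^sup>2) + c * x = c\<^sup>2 * s\<^sup>2 / 2 + - (x - c * s\<^sup>2)\<^sup>2 / (2 * s\<^sup>2)"
    using assms by (simp add: field_simps power2_eq_square)
  then have e: "exp (- (x - 0)\<^sup>2 / (2 * s\<^sup>2)) * exp (c * x) = exp (c\<^sup>2 * s\<^sup>2 / 2) * exp (- (x - c * s\<^sup>2)\<^sup>2 / (2 * s\<^sup>2))"
    by (simp only: exp_add[symmetric])
  show ?thesis unfolding normal_density_def mult.assoc e by (simp only: mult.left_commute)
qed

lemma (in prob_space) normal_exp_moments: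
  assumes s: "0 < s" and X: "distributed M lborel X (normal_density 0 s)"
  shows "integrable M (\<lambda>w. exp (c * X w))" "expectation (\<lambda>w. exp (c * X w)) = exp (c\<^sup>2 * s\<^sup>2 / 2)"
    "integrable M (\<lambda>w. X w * exp (c * X w))"
    "expectation (\<lambda>w. X w * exp (c * X w)) = c * s\<^sup>2 * exp (c\<^sup>2 * s\<^sup>2 / 2)"
proof -
  have 1: "has_bochner_integral lborel (\<lambda>x. normal_density 0 s x * exp (c * x)) (exp (c\<^sup>2 * s\<^sup>2 / 2) * 1)"
    unfolding normal_density_exp[OF s] using s
    by (intro has_bochner_integral_mult_right) (simp add: has_bochner_integral_iff)
  have 2: "has_bochner_integral lborel (\<lambda>x. normal_density 0 s x * (x * exp (c * x))) (exp (c\<^sup>2 * s\<^sup>2 / 2) * (c * s\<^sup>2))"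
  proof -
    have "normal_density 0 s x * (x * exp (c * x)) = exp (c\<^sup>2 * s\<^sup>2 / 2) * (normal_density (c * s\<^sup>2) s x * x)" for x
      using normal_density_exp[OF s, of x c] by (simp add: algebra_simps)
    then show ?thesis using normal_moment_nz_1[OF s, of "c * s\<^sup>2"]
      by (simp only:) (intro has_bochner_integral_mult_right)
  qed
  show "integrable M (\<lambda>w. exp (c * X w))"
    using distributed_integrable[OF X, of "\<lambda>x. exp (c * x)"] 1 by (simp add: has_bochner_integral_iff)
  show "expectation (\<lambda>w. exp (c * X w)) = exp (c\<^sup>2 * s\<^sup>2 / 2)"
    using distributed_integral[OF X, of "\<lambda>x. exp (c * x)"] 1 by (simp add: has_bochner_integral_iff)
  show "integrable M (\<lambda>w. X w * exp (c * X w))"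
    using distributed_integrable[OF X, of "\<lambda>x. x * exp (c * x)"] 2 by (simp add: has_bochner_integral_iff)
  show "expectation (\<lambda>w. X w * exp (c * X w)) = c * s\<^sup>2 * exp (c\<^sup>2 * s\<^sup>2 / 2)"
    using distributed_integral[OF X, of "\<lambda>x. x * exp (c * x)"] 2 by (simp add: has_bochner_integral_iff mult_ac)
qed

lemma (in prob_space) normal_centred_moments:
  assumes s: "0 < s" and X: "distributed M lborel X (normal_density 0 s)"
  shows "integrable M X" "expectation X = 0" "integrable M (\<lambda>w. (X w)\<^sup>2)" "expectation (\<lambda>w. (X w)\<^sup>2) = s\<^sup>2"
proof -
  show "expectation X = 0" by (rule normal_distributed_expectation[OF s X])
  show "integrable M X"
    using distributed_integrable[OF X, of "\<lambda>x. x"] integrable_normal_moment_nz_1[OF s, of 0] by simp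
  show "integrable M (\<lambda>w. (X w)\<^sup>2)"
    using distributed_integrable[OF X, of "\<lambda>x. x\<^sup>2"] integrable_normal_moment[OF s, of 0 2] by simp
  show "expectation (\<lambda>w. (X w)\<^sup>2) = s\<^sup>2"
    using normal_distributed_variance[OF s X] \<open>expectation X = 0\<close> by simp
qed

context brownian_family
begin

text \<open>Stationarity moves the increment so that it starts at \<open>0\<close>, where it is
  \<open>W j (b - a)\<close> up to a null set.\<close>

lemma increment_distributed:
  assumes j: "j \<in> {1..m}" and ab: "0 \<le> a" "a < b" "b \<le> T"
  shows "distributed M lborel (\<lambda>w. W j b w - W j a w) (normal_density 0 (sqrt (b - a)))"
proof -
  have meas: "W j t \<in> borel_measurable M" if "t \<in> {0..T}" for t using that j by (rule W_measurable[rotated])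
  note bm = brownian[OF j, unfolded standard_brownian_motion_def]
  have "distr M borel (\<lambda>w. W j (a + (b - a)) w - W j a w) = distr M borel (\<lambda>w. W j (b - a) w - W j 0 w)"
  proof -
    have "\<forall>s h. 0 \<le> s \<and> 0 \<le> h \<and> s + h \<le> T \<longrightarrow>
        distr M borel (\<lambda>w. W j (s + h) w - W j s w) = distr M borel (\<lambda>w. W j h w - W j 0 w)"
      using bm by blast
    from this[rule_format, of a "b - a"] ab show ?thesis by simp
  qed
  also have "\<dots> = distr M borel (W j (b - a))"
  proof (rule distr_cong_AE)
    have "AE w in M. W j 0 w = 0" using bm by blast
    then show "AE w in M. W j (b - a) w - W j 0 w = W j (b - a) w" by eventually_elim simp
  qed (use ab in \<open>auto intro!: borel_measurable_diff meas\<close>)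
  finally have eq: "distr M borel (\<lambda>w. W j b w - W j a w) = distr M borel (W j (b - a))" by simp
  have "distributed M lborel (W j (b - a)) (normal_density 0 (sqrt (b - a)))" using bm ab by auto
  moreover have "distr M lborel X = distr M borel X" for X :: "'w \<Rightarrow> real" by (intro distr_cong) auto
  ultimately show ?thesis using eq ab by (auto simp: distributed_def intro!: borel_measurable_diff meas)
qed

lemma increments_indep:
  assumes "a \<in> {0..T}" "b \<in> {0..T}"
  shows "indep_vars (\<lambda>_. borel) (\<lambda>j w. W j b w - W j a w) {1..m}"
proof -
  have "indep_vars (\<lambda>_. borel) (\<lambda>j w. (\<lambda>t\<in>{0..T}. W j t w) b - (\<lambda>t\<in>{0..T}. W j t w) a) {1..m}"
    using indep_W[unfolded independent_processes_def]
    by (rule indep_vars_compose2[where Y="\<lambda>_ x. x b - x a"])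
      (use assms in \<open>intro borel_measurable_diff measurable_component_singleton; simp\<close>)
  then show ?thesis using assms by simp
qed

definition lincomb :: "(nat \<Rightarrow> real) \<Rightarrow> (nat \<Rightarrow> real) \<Rightarrow> real" where
  "lincomb c x = (\<Sum>j=1..m. c j * x j)"

lemma lincomb_measurable[measurable]: "lincomb c \<in> borel_measurable (PiM {1..m} (\<lambda>_. borel))"
  unfolding lincomb_def[abs_def] by (intro borel_measurable_sum borel_measurable_times borel_measurable_const measurable_component_singleton)

lemma lincomb_incr: "lincomb c (incr a b w) = (\<Sum>j=1..m. c j * W j b w) - (\<Sum>j=1..m. c j * W j a w)"
  by (simp add: lincomb_def incr_def sum_subtractf right_diff_distrib)

text \<open>A sum of independent Gaussians. Indices with \<open>c j = 0\<close> are dropped first,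
  because their summands are constant and have no Gaussian density.\<close>

lemma lincomb_distributed:
  assumes c: "0 < (\<Sum>j=1..m. (c j)\<^sup>2)" and ab: "0 \<le> a" "a < b" "b \<le> T"
  shows "distributed M lborel (\<lambda>w. lincomb c (incr a b w)) (normal_density 0 (sqrt ((\<Sum>j=1..m. (c j)\<^sup>2) * (b - a))))"
proof -
  let ?J = "{j\<in>{1..m}. c j \<noteq> 0}"
  let ?X = "\<lambda>j w. 0 + c j * (W j b w - W j a w)"
  have J: "?J \<noteq> {}"
  proof
    assume "?J = {}"
    then have "c j = 0" if "j \<in> {1..m}" for j using that by blast
    then show False using c by simp
  qed
  have "indep_vars (\<lambda>_. borel) (\<lambda>j w. W j b w - W j a w) ?J"
    by (rule indep_vars_subset[OF increments_indep]) (use ab in auto)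
  then have ind: "indep_vars (\<lambda>_. borel) ?X ?J" by (rule indep_vars_compose2) simp
  have nd: "distributed M lborel (?X j) (normal_density (0 + c j * 0) (\<bar>c j\<bar> * sqrt (b - a)))" if "j \<in> ?J" for j
    using that ab by (intro normal_density_affine increment_distributed) auto
  have "distributed M lborel (\<lambda>w. \<Sum>j\<in>?J. ?X j w) (normal_density (\<Sum>j\<in>?J. 0 + c j * 0) (sqrt (\<Sum>j\<in>?J. (\<bar>c j\<bar> * sqrt (b - a))\<^sup>2)))"
    by (rule sum_indep_normal[OF _ J ind _ nd]) (use ab in auto)
  moreover have "(\<Sum>j\<in>?J. ?X j w) = lincomb c (incr a b w)" for w
    unfolding lincomb_def incr_def by (intro sum.mono_neutral_cong_left) auto
  moreover have "(\<Sum>j\<in>?J. (\<bar>c j\<bar> * sqrt (b - a))\<^sup>2) = (\<Sum>j=1..m. (c j)\<^sup>2) * (b - a)"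
    unfolding sum_distrib_right using ab by (intro sum.mono_neutral_cong_left) (auto simp: power_mult_distrib)
  ultimately show ?thesis by simp
qed

lemma incr_moments:
  assumes ab: "0 \<le> a" "a \<le> b" "b \<le> T" and j: "j \<in> {1..m}"
  shows "integrable M (\<lambda>w. incr a b w j)" "integrable M (\<lambda>w. (incr a b w j)\<^sup>2)" "expectation (\<lambda>w. incr a b w j) = 0"
    and "k \<in> {1..m} \<Longrightarrow> expectation (\<lambda>w. incr a b w j * incr a b w k) = (if j = k then b - a else 0)"
proof -
  have *: "integrable M (\<lambda>w. incr a b w i) \<and> integrable M (\<lambda>w. (incr a b w i)\<^sup>2) \<and> expectation (\<lambda>w. incr a b w i) = 0
      \<and> expectation (\<lambda>w. (incr a b w i)\<^sup>2) = b - a" if i: "i \<in> {1..m}" for i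
  \<comment> \<open>An increment over a degenerate interval is \<open>0\<close> and has no density,
    so it is treated apart; cells truncated at \<open>t\<close> do produce such intervals.\<close>
  proof (cases "a = b")
    case False
    then have "0 < sqrt (b - a)" using ab by simp
    from normal_centred_moments[OF this increment_distributed[OF i ab(1) _ ab(3)]] False ab i show ?thesis
      by (simp add: incr_def)
  qed (use i in \<open>simp add: incr_def\<close>)
  show "integrable M (\<lambda>w. incr a b w j)" "integrable M (\<lambda>w. (incr a b w j)\<^sup>2)" "expectation (\<lambda>w. incr a b w j) = 0"
    using *[OF j] by auto
  assume k: "k \<in> {1..m}"
  show "expectation (\<lambda>w. incr a b w j * incr a b w k) = (if j = k then b - a else 0)"
  proof (cases "j = k")
    case True
    then show ?thesis using *[OF j] by (simp add: power2_eq_square)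
  next
    case False
    have "indep_vars (\<lambda>_. borel) (\<lambda>j w. W j b w - W j a w) {j, k}"
      by (rule indep_vars_subset[OF increments_indep]) (use ab j k in auto)
    then have "indep_vars (\<lambda>_. borel) (\<lambda>j w. incr a b w j) {j, k}"
      by (rule indep_vars_cong[THEN iffD1, rotated 3]) (use j k in \<open>auto simp: incr_def fun_eq_iff\<close>)
    then have "expectation (\<lambda>w. \<Prod>i\<in>{j, k}. incr a b w i) = (\<Prod>i\<in>{j, k}. expectation (\<lambda>w. incr a b w i))"
      using * j k by (intro indep_vars_lebesgue_integral) auto
    then show ?thesis using False *[OF j] *[OF k] by simp
  qed
qed

text \<open>With \<open>h k j x = x j\<close> this is the Ito isometry. Nonlinear \<open>h\<close> are needed for the residuals in the
  existence proof.\<close>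

lemma step_isometry:
  fixes \<Phi> :: "nat \<Rightarrow> 'i \<Rightarrow> 'w \<Rightarrow> real" and h :: "nat \<Rightarrow> 'i \<Rightarrow> (nat \<Rightarrow> real) \<Rightarrow> real"
  assumes \<tau>: "\<And>k. k < n \<Longrightarrow> 0 \<le> \<tau> k \<and> \<tau> k \<le> \<tau> (Suc k) \<and> \<tau> (Suc k) \<le> T"
    and J: "finite J"
    and \<Phi>: "\<And>k j. k < n \<Longrightarrow> j \<in> J \<Longrightarrow> \<Phi> k j \<in> borel_measurable (F (\<tau> k))"
      "\<And>k j. k < n \<Longrightarrow> j \<in> J \<Longrightarrow> integrable M (\<lambda>w. (\<Phi> k j w)\<^sup>2)"
    and h: "\<And>k j. k < n \<Longrightarrow> j \<in> J \<Longrightarrow> h k j \<in> borel_measurable (PiM {1..m} (\<lambda>_. borel))"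
      "\<And>k j. k < n \<Longrightarrow> j \<in> J \<Longrightarrow> integrable M (\<lambda>w. (h k j (incr (\<tau> k) (\<tau> (Suc k)) w))\<^sup>2)"
      "\<And>k j. k < n \<Longrightarrow> j \<in> J \<Longrightarrow> expectation (\<lambda>w. h k j (incr (\<tau> k) (\<tau> (Suc k)) w)) = 0"
      "\<And>k i j. k < n \<Longrightarrow> i \<in> J \<Longrightarrow> j \<in> J \<Longrightarrow> expectation (\<lambda>w. h k i (incr (\<tau> k) (\<tau> (Suc k)) w) * h k j (incr (\<tau> k) (\<tau> (Suc k)) w))
        = (if i = j then v k else 0)"
  defines "Z \<equiv> \<lambda>k w. \<Sum>j\<in>J. \<Phi> k j w * h k j (incr (\<tau> k) (\<tau> (Suc k)) w)"
  shows "integrable M (\<lambda>w. (\<Sum>k<n. Z k w)\<^sup>2)"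
    and "expectation (\<lambda>w. (\<Sum>k<n. Z k w)\<^sup>2) = (\<Sum>k<n. (\<Sum>j\<in>J. expectation (\<lambda>w. (\<Phi> k j w)\<^sup>2)) * v k)"
proof -
  define \<eta> where "\<eta> k j w = h k j (incr (\<tau> k) (\<tau> (Suc k)) w)" for k j w
  have Z: "Z k w = (\<Sum>j\<in>J. \<Phi> k j w * \<eta> k j w)" for k w by (simp add: Z_def \<eta>_def)
  have \<tau>_mono: "\<tau> k \<le> \<tau> l" if "k \<le> l" "l \<le> n" for k l
    using that by (induction l rule: dec_induct) (use \<tau> in \<open>auto intro: order_trans\<close>)
  have \<eta>F: "\<eta> k j \<in> borel_measurable (F (\<tau> (Suc k)))" if "k < n" "j \<in> J" for k j
    unfolding \<eta>_def using \<tau>[OF that(1)] h(1)[OF that] by (auto intro!: measurable_compose[OF incr_measurable_F])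
  have \<eta>M: "\<eta> k j \<in> borel_measurable M" if "k < n" "j \<in> J" for k j
    using \<eta>F[OF that] \<tau>[OF that(1)] by (auto intro: F_measurable)
  have \<Phi>M: "\<Phi> k j \<in> borel_measurable M" if "k < n" "j \<in> J" for k j
    using \<Phi>(1)[OF that] \<tau>[OF that(1)] by (auto intro: F_measurable[of "\<tau> k"])
  have \<eta>_int: "integrable M (\<eta> k j)" if "k < n" "j \<in> J" for k j
    using integrable_mult_of_squares[OF \<eta>M[OF that], of "\<lambda>_. 1"] h(2)[OF that] by (simp add: \<eta>_def[abs_def])
  have ind: "indep_var borel X borel (\<lambda>w. g (incr (\<tau> k) (\<tau> (Suc k)) w))"
    if "k < n" "X \<in> borel_measurable (F (\<tau> k))" "g \<in> borel_measurable (PiM {1..m} (\<lambda>_. borel))" for X g k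
    using \<tau>[OF that(1)] that by (intro past_indep_incr) auto
  \<comment> \<open>\<open>\<Phi> k j\<close> and \<open>\<eta> k j\<close> are independent, which
    makes the square of their product integrable from second moments of the factors alone.\<close>
  have sq: "integrable M (\<lambda>w. (\<Phi> k j w * \<eta> k j w)\<^sup>2)" if "k < n" "j \<in> J" for k j
  proof -
    have "integrable M (\<lambda>w. (\<Phi> k j w)\<^sup>2 * (\<lambda>x. (h k j x)\<^sup>2) (incr (\<tau> k) (\<tau> (Suc k)) w))"
      using that h(1,2)[OF that] \<Phi>(1,2)[OF that] by (intro indep_var_integrable ind) auto
    then show ?thesis by (simp add: \<eta>_def power_mult_distrib)
  qed
  have prodm: "(\<lambda>w. \<Phi> k j w * \<eta> k j w) \<in> borel_measurable M" if "k < n" "j \<in> J" for k j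
    using that \<eta>M \<Phi>M by (intro borel_measurable_times) auto
  have Zm: "Z k \<in> borel_measurable M" if "k < n" for k
    unfolding Z using prodm[OF that] by (intro borel_measurable_sum)
  have ZF: "Z k \<in> borel_measurable (F (\<tau> (Suc k)))" if "k < n" for k
    unfolding Z using \<eta>F[OF that] \<Phi>(1)[OF that] \<tau>[OF that]
    by (intro borel_measurable_sum borel_measurable_times) (auto intro: F_measurable_mono)
  have expand: "(Z k w)\<^sup>2 = (\<Sum>i\<in>J. \<Sum>j\<in>J. (\<Phi> k i w * \<eta> k i w) * (\<Phi> k j w * \<eta> k j w))" for k w
    unfolding Z power2_eq_square by (rule sum_product)
  have cross: "integrable M (\<lambda>w. (\<Phi> k i w * \<eta> k i w) * (\<Phi> k j w * \<eta> k j w))" if "k < n" "i \<in> J" "j \<in> J" for k i j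
    using that by (intro integrable_mult_of_squares prodm sq)
  have Z_sq: "integrable M (\<lambda>w. (Z k w)\<^sup>2)" if "k < n" for k
    unfolding expand using cross that by (intro Bochner_Integration.integrable_sum)
  have Z_val: "expectation (\<lambda>w. (Z k w)\<^sup>2) = (\<Sum>j\<in>J. expectation (\<lambda>w. (\<Phi> k j w)\<^sup>2)) * v k" if k: "k < n" for k
  proof -
    \<comment> \<open>\<open>\<Phi> k i * \<Phi> k j\<close> belongs to the past of the cell and
      \<open>h k i * h k j\<close> to its increment, so the expectation factorises.\<close>
    have one: "expectation (\<lambda>w. (\<Phi> k i w * \<eta> k i w) * (\<Phi> k j w * \<eta> k j w)) = (if i = j then expectation (\<lambda>w. (\<Phi> k j w)\<^sup>2) * v k else 0)"
      if ij: "i \<in> J" "j \<in> J" for i j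
    proof -
      have "expectation (\<lambda>w. (\<Phi> k i w * \<Phi> k j w) * (\<lambda>x. h k i x * h k j x) (incr (\<tau> k) (\<tau> (Suc k)) w))
         = expectation (\<lambda>w. \<Phi> k i w * \<Phi> k j w) * expectation (\<lambda>w. (\<lambda>x. h k i x * h k j x) (incr (\<tau> k) (\<tau> (Suc k)) w))"
      proof (rule indep_var_lebesgue_integral[OF ind[OF k]])
        show "integrable M (\<lambda>w. \<Phi> k i w * \<Phi> k j w)"
          using k ij by (intro integrable_mult_of_squares \<Phi>M \<Phi>(2))
        show "integrable M (\<lambda>w. h k i (incr (\<tau> k) (\<tau> (Suc k)) w) * h k j (incr (\<tau> k) (\<tau> (Suc k)) w))"
          using k ij \<eta>M[unfolded \<eta>_def] by (intro integrable_mult_of_squares h(2))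
      qed (use \<Phi>(1) h(1) k ij in auto)
      then show ?thesis using h(4)[OF k ij] by (simp add: \<eta>_def mult_ac power2_eq_square)
    qed
    have "expectation (\<lambda>w. (Z k w)\<^sup>2) = (\<Sum>i\<in>J. \<Sum>j\<in>J. expectation (\<lambda>w. (\<Phi> k i w * \<eta> k i w) * (\<Phi> k j w * \<eta> k j w)))"
      unfolding expand using cross[OF k] by (simp add: Bochner_Integration.integral_sum Bochner_Integration.integrable_sum)
    also have "\<dots> = (\<Sum>i\<in>J. \<Sum>j\<in>J. if i = j then expectation (\<lambda>w. (\<Phi> k j w)\<^sup>2) * v k else 0)"
      using one by (intro sum.cong) auto
    also have "\<dots> = (\<Sum>j\<in>J. expectation (\<lambda>w. (\<Phi> k j w)\<^sup>2)) * v k"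
      using J by (simp add: sum_distrib_right)
    finally show ?thesis .
  qed
  \<comment> \<open>The earlier cells together with the coefficient \<open>\<Phi> l j\<close> are
    known at \<open>\<tau> l\<close>; the factor \<open>\<eta> l j\<close> is independent of them
    and has mean \<open>0\<close>.\<close>
  have orth: "expectation (\<lambda>w. (\<Sum>k<l. Z k w) * Z l w) = 0"
    if l: "l < n" and S2: "integrable M (\<lambda>w. (\<Sum>k<l. Z k w)\<^sup>2)" for l
  proof -
    let ?S = "\<lambda>w. \<Sum>k<l. Z k w"
    have SF: "?S \<in> borel_measurable (F (\<tau> l))"
    proof (intro borel_measurable_sum)
      fix k assume "k \<in> {..<l}"
      then show "Z k \<in> borel_measurable (F (\<tau> l))" using l ZF[of k] \<tau>_mono[of "Suc k" l]
        by (intro F_measurable_mono[of "\<tau> (Suc k)" "\<tau> l"]) auto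
    qed
    then have SM: "?S \<in> borel_measurable M" using \<tau>[OF l] by (intro F_measurable[of "\<tau> l"]) auto
    have ip: "integrable M (\<lambda>w. ?S w * \<Phi> l j w)" if "j \<in> J" for j
      using that l by (intro integrable_mult_of_squares SM \<Phi>M S2 \<Phi>(2))
    have ind': "indep_var borel (\<lambda>w. ?S w * \<Phi> l j w) borel (\<eta> l j)" if "j \<in> J" for j
      unfolding \<eta>_def using that l h(1) SF \<Phi>(1) by (intro ind borel_measurable_times) auto
    have "?S w * Z l w = (\<Sum>j\<in>J. (?S w * \<Phi> l j w) * \<eta> l j w)" for w
      by (simp add: Z sum_distrib_left mult.assoc)
    then have "expectation (\<lambda>w. ?S w * Z l w) = (\<Sum>j\<in>J. expectation (\<lambda>w. (?S w * \<Phi> l j w) * \<eta> l j w))"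
      using indep_var_integrable[OF ind' ip \<eta>_int[OF l]] by (simp add: Bochner_Integration.integral_sum)
    also have "\<dots> = (\<Sum>j\<in>J. expectation (\<lambda>w. ?S w * \<Phi> l j w) * expectation (\<eta> l j))"
      using indep_var_lebesgue_integral[OF ind' ip \<eta>_int[OF l]] by (intro sum.cong) auto
    also have "\<dots> = 0" using h(3)[OF l] by (simp add: \<eta>_def[abs_def])
    finally show ?thesis .
  qed
  have "integrable M (\<lambda>w. (\<Sum>k<n. Z k w)\<^sup>2) \<and> expectation (\<lambda>w. (\<Sum>k<n. Z k w)\<^sup>2) = (\<Sum>k<n. expectation (\<lambda>w. (Z k w)\<^sup>2))"
    using Zm Z_sq orth by (rule integral_square_sum_orthogonal)
  then show "integrable M (\<lambda>w. (\<Sum>k<n. Z k w)\<^sup>2)"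
    and "expectation (\<lambda>w. (\<Sum>k<n. Z k w)\<^sup>2) = (\<Sum>k<n. (\<Sum>j\<in>J. expectation (\<lambda>w. (\<Phi> k j w)\<^sup>2)) * v k)"
    using Z_val by auto
qed

end

section \<open>Geometric Brownian motion\<close>

lemma small_o_of_derivative_zero:
  fixes f :: "real \<Rightarrow> real"
  assumes "(f has_real_derivative 0) (at 0)" "f 0 = 0" "0 < \<epsilon>"
  obtains \<delta> where "0 < \<delta>" "\<And>x. 0 \<le> x \<Longrightarrow> x \<le> \<delta> \<Longrightarrow> \<bar>f x\<bar> \<le> \<epsilon> * x"
proof -
  have "(\<lambda>x. f x / x) \<midarrow>0\<rightarrow> 0" using assms by (simp add: DERIV_def)
  then obtain d where d: "0 < d" "\<And>x. x \<noteq> 0 \<Longrightarrow> \<bar>x\<bar> < d \<Longrightarrow> \<bar>f x / x\<bar> < \<epsilon>"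
    using \<open>0 < \<epsilon>\<close> unfolding LIM_def by (auto simp: dist_real_def)
  show thesis
  proof (rule that[of "d / 2"])
    fix x :: real assume x: "0 \<le> x" "x \<le> d / 2"
    show "\<bar>f x\<bar> \<le> \<epsilon> * x"
    proof (cases "x = 0")
      case False
      then have "\<bar>f x / x\<bar> < \<epsilon>" using x d by (intro d(2)) auto
      then show ?thesis using False x by (simp add: abs_divide divide_less_eq)
    qed (use assms in simp)
  qed (use d in simp)
qed

lemma is_partition_min:
  assumes "is_partition T n s" "t \<in> {0..T}" "k < n"
  shows "0 \<le> min t (s k)" "min t (s k) \<le> min t (s (Suc k))" "min t (s (Suc k)) \<le> T"
    "min t (s (Suc k)) - min t (s k) \<le> s (Suc k) - s k"
proof -
  have "0 \<le> s k" "s k \<le> s (Suc k)"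
    using assms is_partition_bounds[OF assms(1), of k] is_partition_mono[OF assms(1), of k "Suc k"] by auto
  then show "0 \<le> min t (s k)" "min t (s k) \<le> min t (s (Suc k))" "min t (s (Suc k)) \<le> T"
    "min t (s (Suc k)) - min t (s k) \<le> s (Suc k) - s k" using assms(2) by auto
qed

context brownian_family
begin

lemma incr_self: "j \<in> {1..m} \<Longrightarrow> incr a a w j = 0" "lincomb c (incr a a w) = 0"
  by (simp_all add: incr_def lincomb_def)

definition gbm :: "real \<Rightarrow> real \<Rightarrow> (nat \<Rightarrow> real) \<Rightarrow> real \<Rightarrow> 'w \<Rightarrow> real" where
  "gbm v0 \<mu> c t w = v0 * exp ((\<mu> - 1/2 * (\<Sum>j=1..m. (c j)\<^sup>2)) * t + (\<Sum>j=1..m. c j * W j t w))"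

lemma gbm_adapted: "0 \<le> t \<Longrightarrow> gbm v0 \<mu> c t \<in> borel_measurable (F t)"
  unfolding gbm_def[abs_def]
  by (intro borel_measurable_times borel_measurable_const borel_measurable_exp[THEN measurable_compose[rotated]] borel_measurable_add borel_measurable_sum W_adapted) auto

lemma gbm_measurable: "t \<in> {0..T} \<Longrightarrow> gbm v0 \<mu> c t \<in> borel_measurable M"
  using gbm_adapted[of t] by (auto intro: F_measurable)

lemma AE_W_continuous: "AE w in M. \<forall>j\<in>{1..m}. continuous_on {0..T} (\<lambda>t. W j t w)"
  using brownian by (intro AE_finite_allI) (auto simp: standard_brownian_motion_def continuous_process_def)

lemma AE_W_0: "AE w in M. \<forall>j\<in>{1..m}. W j 0 w = 0"
  using brownian by (intro AE_finite_allI) (auto simp: standard_brownian_motion_def)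

lemma AE_gbm_continuous: "AE w in M. continuous_on {0..T} (\<lambda>t. gbm v0 \<mu> c t w)"
  using AE_W_continuous unfolding gbm_def by eventually_elim (intro continuous_intros; simp)

lemma AE_gbm_0: "AE w in M. gbm v0 \<mu> c 0 w = v0"
  using AE_W_0 unfolding gbm_def by eventually_elim simp

lemma gbm_step:
  "gbm v0 \<mu> c b w = gbm v0 \<mu> c a w * exp ((\<mu> - 1/2 * (\<Sum>j=1..m. (c j)\<^sup>2)) * (b - a) + lincomb c (incr a b w))"
  unfolding gbm_def lincomb_incr mult.assoc exp_add[symmetric]
  by (intro arg_cong[where f="\<lambda>x. v0 * exp x"]) (simp add: field_simps)

text \<open>\<open>p\<close> is a deterministic factor times \<open>exp L\<close> with
  \<open>L\<close> centred Gaussian of variance \<open>S * (b - a)\<close>. The correction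
  \<open>- 1/2 * S\<close> in the exponent cancels the mean of \<open>exp L\<close> and leaves
  \<open>exp (\<mu> * (b - a))\<close>.\<close>

lemma exp_lincomb_moments:
  fixes \<mu> :: real
  assumes c: "0 < (\<Sum>j=1..m. (c j)\<^sup>2)" and ab: "0 \<le> a" "a \<le> b" "b \<le> T"
  defines "S \<equiv> \<Sum>j=1..m. (c j)\<^sup>2" and "L \<equiv> \<lambda>w. lincomb c (incr a b w)"
  defines "p \<equiv> \<lambda>w. exp ((\<mu> - 1/2 * S) * (b - a) + L w)"
  shows "integrable M L" "expectation L = 0" "integrable M (\<lambda>w. (L w)\<^sup>2)" "expectation (\<lambda>w. (L w)\<^sup>2) = S * (b - a)"
    "integrable M p" "expectation p = exp (\<mu> * (b - a))"
    "integrable M (\<lambda>w. (p w)\<^sup>2)" "expectation (\<lambda>w. (p w)\<^sup>2) = exp ((2 * \<mu> + S) * (b - a))"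
    "integrable M (\<lambda>w. L w * p w)" "expectation (\<lambda>w. L w * p w) = S * (b - a) * exp (\<mu> * (b - a))"
proof -
  let ?g = "(\<mu> - 1/2 * S) * (b - a)"
  have p1: "p = (\<lambda>w. exp ?g * exp (1 * L w))"
    by (simp add: p_def exp_add fun_eq_iff)
  have p2: "(p w)\<^sup>2 = exp (2 * ?g) * exp (2 * L w)"
    and p3: "L w * p w = exp ?g * (L w * exp (1 * L w))" for w
    by (simp_all add: p_def exp_add power2_eq_square exp_double mult_ac flip: exp_add)
  have *: "(integrable M L \<and> expectation L = 0 \<and> integrable M (\<lambda>w. (L w)\<^sup>2) \<and> expectation (\<lambda>w. (L w)\<^sup>2) = S * (b - a)) \<and>
    (integrable M p \<and> expectation p = exp (\<mu> * (b - a))) \<and>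
    (integrable M (\<lambda>w. (p w)\<^sup>2) \<and> expectation (\<lambda>w. (p w)\<^sup>2) = exp ((2 * \<mu> + S) * (b - a))) \<and>
    (integrable M (\<lambda>w. L w * p w) \<and> expectation (\<lambda>w. L w * p w) = S * (b - a) * exp (\<mu> * (b - a)))"
  proof (cases "a = b")
    case True
    then show ?thesis by (simp add: L_def p_def incr_self prob_space)
  next
    case False
    let ?s = "sqrt (S * (b - a))"
    have s: "0 < ?s" and s2: "?s\<^sup>2 = S * (b - a)" using False ab c by (auto simp: S_def)
    have D: "distributed M lborel L (normal_density 0 ?s)"
      unfolding L_def S_def using False ab by (intro lincomb_distributed c) auto
    note nm = normal_exp_moments[OF s D, unfolded s2] normal_centred_moments[OF s D, unfolded s2]
    have e1: "exp ?g * exp (1\<^sup>2 * (S * (b - a)) / 2) = exp (\<mu> * (b - a))"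
      by (simp add: exp_add[symmetric] field_simps)
    have e2: "exp (2 * ?g) * exp (2\<^sup>2 * (S * (b - a)) / 2) = exp ((2 * \<mu> + S) * (b - a))"
      by (simp add: exp_add[symmetric] field_simps)
    have "exp ?g * (1 * (S * (b - a)) * exp (1\<^sup>2 * (S * (b - a)) / 2)) = S * (b - a) * exp (\<mu> * (b - a))"
      unfolding e1[symmetric] by simp
    then have "integrable M (\<lambda>w. (p w)\<^sup>2)" "expectation (\<lambda>w. (p w)\<^sup>2) = exp ((2 * \<mu> + S) * (b - a))"
      "integrable M (\<lambda>w. L w * p w)" "expectation (\<lambda>w. L w * p w) = S * (b - a) * exp (\<mu> * (b - a))"
      by (simp_all only: p2 p3 nm e1 e2 integrable_mult_right integral_mult_right_zero)
    moreover have "integrable M p" "expectation p = exp (\<mu> * (b - a))"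
      unfolding p1 by (simp_all only: nm e1 integrable_mult_right integral_mult_right_zero)
    ultimately show ?thesis using nm(5-8) by blast
  qed
  then show "integrable M L" "expectation L = 0" "integrable M (\<lambda>w. (L w)\<^sup>2)" "expectation (\<lambda>w. (L w)\<^sup>2) = S * (b - a)"
    "integrable M p" "expectation p = exp (\<mu> * (b - a))"
    "integrable M (\<lambda>w. (p w)\<^sup>2)" "expectation (\<lambda>w. (p w)\<^sup>2) = exp ((2 * \<mu> + S) * (b - a))"
    "integrable M (\<lambda>w. L w * p w)" "expectation (\<lambda>w. L w * p w) = S * (b - a) * exp (\<mu> * (b - a))"
    by blast+
qed

text \<open>Reduces the law at time \<open>t\<close> to that of an increment from \<open>0\<close>;
  the equality is only almost sure because \<open>W j 0 = 0\<close> is.\<close>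

lemma AE_gbm_eq:
  assumes "0 \<le> t"
  shows "AE w in M. gbm v0 \<mu> c t w = v0 * exp ((\<mu> - 1/2 * (\<Sum>j=1..m. (c j)\<^sup>2)) * (t - 0) + lincomb c (incr 0 t w))"
  using AE_gbm_0[of v0 \<mu> c] by eventually_elim (simp add: gbm_step[of _ _ _ t _ 0])

lemma gbm_moments:
  fixes \<mu> v0 :: real
  assumes c: "0 < (\<Sum>j=1..m. (c j)\<^sup>2)" and t: "t \<in> {0..T}"
  shows "integrable M (gbm v0 \<mu> c t)" "expectation (gbm v0 \<mu> c t) = v0 * exp (\<mu> * t)"
    "integrable M (\<lambda>w. (gbm v0 \<mu> c t w)\<^sup>2)"
    "expectation (\<lambda>w. (gbm v0 \<mu> c t w)\<^sup>2) = v0\<^sup>2 * exp ((2 * \<mu> + (\<Sum>j=1..m. (c j)\<^sup>2)) * t)"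
proof -
  let ?p = "\<lambda>w. exp ((\<mu> - 1/2 * (\<Sum>j=1..m. (c j)\<^sup>2)) * (t - 0) + lincomb c (incr 0 t w))"
  have eq: "AE w in M. gbm v0 \<mu> c t w = v0 * ?p w" using t by (intro AE_gbm_eq) auto
  then have eq2: "AE w in M. (gbm v0 \<mu> c t w)\<^sup>2 = v0\<^sup>2 * (?p w)\<^sup>2"
    by eventually_elim (simp add: power_mult_distrib)
  have 0: "0 \<le> (0::real)" "0 \<le> t" "t \<le> T" using t by auto
  note mo = exp_lincomb_moments(5-8)[OF c 0, of \<mu>]
  note [measurable] = gbm_measurable[OF t]
  have [measurable]: "?p \<in> borel_measurable M" using mo(1) by (rule borel_measurable_integrable)
  show "integrable M (gbm v0 \<mu> c t)"
    using mo(1) by (subst integrable_cong_AE[OF _ _ eq]) auto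
  show "expectation (gbm v0 \<mu> c t) = v0 * exp (\<mu> * t)"
    using mo(1,2) by (subst integral_cong_AE[OF _ _ eq]) auto
  show "integrable M (\<lambda>w. (gbm v0 \<mu> c t w)\<^sup>2)"
    using mo(3) by (subst integrable_cong_AE[OF _ _ eq2]) auto
  show "expectation (\<lambda>w. (gbm v0 \<mu> c t w)\<^sup>2) = v0\<^sup>2 * exp ((2 * \<mu> + (\<Sum>j=1..m. (c j)\<^sup>2)) * t)"
    using mo(3,4) by (subst integral_cong_AE[OF _ _ eq2]) auto
qed

lemma gbm_log_normal:
  assumes c: "0 < (\<Sum>j=1..m. (c j)\<^sup>2)" and t: "t \<in> {0<..T}" and v0: "0 < v0"
  shows "log_normal M (gbm v0 \<mu> c t)"
  unfolding log_normal_def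
proof (intro conjI ballI exI)
  let ?S = "\<Sum>j=1..m. (c j)\<^sup>2"
  let ?d = "ln v0 + (\<mu> - 1/2 * ?S) * t"
  show m: "gbm v0 \<mu> c t \<in> borel_measurable M" using t by (intro gbm_measurable) auto
  show "0 < gbm v0 \<mu> c t w" for w using v0 by (simp add: gbm_def)
  show s: "0 < sqrt (?S * (t - 0))" using c t by auto
  \<comment> \<open>The logarithm is an affine function of a Gaussian; the factors \<open>1\<close>
    match the shape of \<open>normal_density_affine\<close>.\<close>
  have D: "distributed M lborel (\<lambda>w. ?d + 1 * lincomb c (incr 0 t w)) (normal_density (?d + 1 * 0) (\<bar>1\<bar> * sqrt (?S * (t - 0))))"
    using t s by (intro normal_density_affine lincomb_distributed c) auto
  have "AE w in M. ln (gbm v0 \<mu> c t w) = ?d + 1 * lincomb c (incr 0 t w)"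
  proof -
    have "AE w in M. gbm v0 \<mu> c t w = v0 * exp ((\<mu> - 1/2 * ?S) * (t - 0) + lincomb c (incr 0 t w))"
      using t by (intro AE_gbm_eq) auto
    then show ?thesis by eventually_elim (use v0 in \<open>simp add: ln_mult\<close>)
  qed
  moreover have lm: "(\<lambda>w. ln (gbm v0 \<mu> c t w)) \<in> borel_measurable M" using m by measurable
  moreover have "(\<lambda>w. ?d + 1 * lincomb c (incr 0 t w)) \<in> borel_measurable M"
    using distributed_measurable[OF D] by simp
  ultimately have "distr M lborel (\<lambda>w. ln (gbm v0 \<mu> c t w)) = distr M lborel (\<lambda>w. ?d + 1 * lincomb c (incr 0 t w))"
    by (intro distr_cong_AE) auto
  then show "distributed M lborel (\<lambda>w. ln (gbm v0 \<mu> c t w)) (normal_density ?d (sqrt (?S * (t - 0))))"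
    using D lm by (simp add: distributed_def)
qed

text \<open>Expanding the square leaves the second moments of the exponential and of the linear part
  and their mixed moment. Subtracting the mean \<open>exp (\<mu> * (b - a))\<close> besides the
  linear part is what centres \<open>R\<close>, so that residuals of different cells are
  orthogonal.\<close>

lemma ito_residual_moments:
  fixes \<mu> :: real
  assumes c: "0 < (\<Sum>j=1..m. (c j)\<^sup>2)" and ab: "0 \<le> a" "a \<le> b" "b \<le> T"
  defines "S \<equiv> \<Sum>j=1..m. (c j)\<^sup>2"
  defines "R \<equiv> \<lambda>w. exp ((\<mu> - 1/2 * S) * (b - a) + lincomb c (incr a b w)) - exp (\<mu> * (b - a)) - lincomb c (incr a b w)"
  shows "integrable M (\<lambda>w. (R w)\<^sup>2)" "expectation R = 0"
    "expectation (\<lambda>w. (R w)\<^sup>2) = exp ((2 * \<mu> + S) * (b - a)) - exp (2 * \<mu> * (b - a)) + S * (b - a) - 2 * S * (b - a) * exp (\<mu> * (b - a))"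
proof -
  let ?L = "\<lambda>w. lincomb c (incr a b w)" and ?p = "\<lambda>w. exp ((\<mu> - 1/2 * S) * (b - a) + lincomb c (incr a b w))"
  let ?e = "exp (\<mu> * (b - a))"
  note mo = exp_lincomb_moments(1-4)[OF c ab, folded S_def] exp_lincomb_moments(5-10)[OF c ab, of \<mu>, folded S_def]
  have sq: "(R w)\<^sup>2 = (?p w)\<^sup>2 + ?e\<^sup>2 + (?L w)\<^sup>2 - 2 * ?e * ?p w - 2 * (?L w * ?p w) + 2 * ?e * ?L w" for w
    by (simp add: R_def power2_eq_square algebra_simps)
  show "integrable M (\<lambda>w. (R w)\<^sup>2)" unfolding sq using mo
    by (intro Bochner_Integration.integrable_add Bochner_Integration.integrable_diff integrable_mult_right) auto
  show "expectation R = 0" unfolding R_def using mo by (simp add: prob_space)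
  have "expectation (\<lambda>w. (R w)\<^sup>2) = exp ((2 * \<mu> + S) * (b - a)) + ?e\<^sup>2 + S * (b - a) - 2 * ?e * ?e - 2 * (S * (b - a) * ?e)"
    unfolding sq using mo by (simp add: prob_space Bochner_Integration.integral_add Bochner_Integration.integral_diff)
  moreover have "?e\<^sup>2 = exp (2 * \<mu> * (b - a))" by (simp add: power2_eq_square exp_add[symmetric] algebra_simps)
  ultimately show "expectation (\<lambda>w. (R w)\<^sup>2) = exp ((2 * \<mu> + S) * (b - a)) - exp (2 * \<mu> * (b - a)) + S * (b - a) - 2 * S * (b - a) * exp (\<mu> * (b - a))"
    by (simp add: power2_eq_square algebra_simps)
qed

end

section \<open>Convergence of the Ito sums of geometric Brownian motion\<close>

lemma fine_partitionsD: "fine_partitions T n s \<Longrightarrow> is_partition T (n r) (s r)"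
  by (simp add: fine_partitions_def)

text \<open>A function that is \<open>o(x)\<close> at \<open>0\<close> sums to \<open>o(1)\<close>
  over cells of total length \<open>t\<close> with vanishing mesh. It is applied to the residual
  variance and to the Taylor remainder of the drift factor.\<close>

lemma fine_partitions_small_o:
  fixes f :: "real \<Rightarrow> real"
  assumes fp: "fine_partitions T n s" and t: "t \<in> {0..T}"
    and f: "(f has_real_derivative 0) (at 0)" "f 0 = 0" and g: "\<And>r k. k < n r \<Longrightarrow> \<bar>g r k\<bar> \<le> K"
  shows "(\<lambda>r. \<Sum>k<n r. g r k * f (min t (s r (Suc k)) - min t (s r k))) \<longlonglongrightarrow> 0"
proof (rule LIMSEQ_I)
  fix e :: real assume e: "0 < e"
  define K' where "K' = \<bar>K\<bar> + 1"
  \<comment> \<open>The total becomes \<open>K' * \<epsilon> * t = e * t / (2 * (t + 1))\<close>,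
    which is below \<open>e\<close>; using \<open>t + 1\<close> keeps the denominator positive at
    \<open>t = 0\<close>.\<close>
  define \<epsilon> where "\<epsilon> = e / (2 * K' * (t + 1))"
  have K': "0 < K'" "\<And>r k. k < n r \<Longrightarrow> \<bar>g r k\<bar> \<le> K'" using g by (force simp: K'_def)+
  have "0 < \<epsilon>" using e K' t by (simp add: \<epsilon>_def)
  then obtain \<delta> where \<delta>: "0 < \<delta>" "\<And>x. 0 \<le> x \<Longrightarrow> x \<le> \<delta> \<Longrightarrow> \<bar>f x\<bar> \<le> \<epsilon> * x"
    using small_o_of_derivative_zero[OF f] by metis
  have "\<forall>\<^sub>F r in sequentially. \<forall>k<n r. s r (Suc k) - s r k \<le> \<delta>"
    using fp \<delta>(1) by (simp add: fine_partitions_def)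
  then obtain N where N: "\<And>r k. N \<le> r \<Longrightarrow> k < n r \<Longrightarrow> s r (Suc k) - s r k \<le> \<delta>"
    unfolding eventually_sequentially by auto
  show "\<exists>N. \<forall>r\<ge>N. norm ((\<Sum>k<n r. g r k * f (min t (s r (Suc k)) - min t (s r k))) - 0) < e"
  proof (intro exI[of _ N] allI impI)
    fix r assume r: "N \<le> r"
    note ip = fine_partitionsD[OF fp, of r]
    let ?d = "\<lambda>k. min t (s r (Suc k)) - min t (s r k)"
    have "\<bar>g r k * f (?d k)\<bar> \<le> K' * (\<epsilon> * ?d k)" if k: "k < n r" for k
    proof -
      have "0 \<le> ?d k" "?d k \<le> \<delta>" using is_partition_min[OF ip t k] N[OF r k] by auto
      then have "\<bar>f (?d k)\<bar> \<le> \<epsilon> * ?d k" by (rule \<delta>(2))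
      then show ?thesis unfolding abs_mult using K'(2)[OF k] by (intro mult_mono) auto
    qed
    then have "\<bar>\<Sum>k<n r. g r k * f (?d k)\<bar> \<le> (\<Sum>k<n r. K' * (\<epsilon> * ?d k))"
      by (intro order_trans[OF sum_abs] sum_mono) auto
    also have "\<dots> = K' * \<epsilon> * t"
      using sum_cell_length[OF ip t] by (simp add: sum_distrib_left[symmetric] mult.assoc)
    also have "K' * \<epsilon> = e / (2 * (t + 1))" using K'(1) by (simp add: \<epsilon>_def)
    also have "e / (2 * (t + 1)) * t = e * (t / (2 * (t + 1)))" by simp
    also have "\<dots> < e * 1" using e t by (intro mult_strict_left_mono) (auto simp: field_simps)
    finally show "norm ((\<Sum>k<n r. g r k * f (?d k)) - 0) < e" by simp
  qed
qed

context brownian_family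
begin

lemma elementary_integral_lincomb:
  "elementary_integral m W n s (\<lambda>k j w. U (s k) w * c j) t w
    = (\<Sum>k<n. U (s k) w * lincomb c (incr (min t (s k)) (min t (s (Suc k))) w))"
  unfolding elementary_integral_def
  by (subst sum.swap) (simp add: lincomb_def incr_def sum_distrib_left mult.assoc)

lemma elementary_integral_measurable:
  assumes ip: "is_partition T n s" and t: "t \<in> {0..T}"
    and \<Phi>: "\<And>k j. k < n \<Longrightarrow> j \<in> {1..m} \<Longrightarrow> \<Phi> k j \<in> borel_measurable M"
  shows "elementary_integral m W n s \<Phi> t \<in> borel_measurable M"
  unfolding elementary_integral_def[abs_def]
proof (intro borel_measurable_sum borel_measurable_times borel_measurable_diff W_measurable \<Phi>)
  fix k assume "k \<in> {..<n}"
  then show "min t (s k) \<in> {0..T}" "min t (s (Suc k)) \<in> {0..T}"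
    using is_partition_min(1-3)[OF ip t, of k] by auto
qed auto

lemma incr_measurable:
  assumes "0 \<le> a" "a \<le> b" "b \<le> T" shows "incr a b \<in> measurable M (PiM {1..m} (\<lambda>_. borel))"
  by (rule F_measurable[OF assms(3) incr_measurable_F[OF assms(1,2)]])

text \<open>The increment of \<open>?V\<close> over a cell splits into the Ito term, the drift term
  summed in \<open>?B\<close> and the residual summed in \<open>?A\<close>. \<open>X\<close> is a
  version, measurable for \<open>M\<close>, of the expected limit, since the time integral itself is
  only known to be measurable for the completion.\<close>

lemma ito_sum_gbm:
  assumes c: "0 < (\<Sum>j=1..m. (c j)\<^sup>2)" and fp: "fine_partitions T n s" and t: "t \<in> {0..T}"
    and X: "X \<in> borel_measurable M" "AE w in M. X w = gbm v0 \<mu> c t w - v0 - (LBINT u:{0..t}. gbm v0 \<mu> c u w * \<mu>)"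
  shows "tendsto_in_prob M (\<lambda>r. elementary_integral m W (n r) (s r) (\<lambda>k j w. gbm v0 \<mu> c (s r k) w * c j) t) X"
proof -
  define S where "S = (\<Sum>j=1..m. (c j)\<^sup>2)"
  let ?V = "gbm v0 \<mu> c"
  define \<tau> where "\<tau> r k = min t (s r k)" for r k
  define d where "d r k = \<tau> r (Suc k) - \<tau> r k" for r k
  define L where "L r k w = lincomb c (incr (\<tau> r k) (\<tau> r (Suc k)) w)" for r k w
  define \<xi> where "\<xi> r k w = exp ((\<mu> - 1/2 * S) * d r k + L r k w) - exp (\<mu> * d r k) - L r k w" for r k w
  let ?A = "\<lambda>r w. \<Sum>k<n r. ?V (\<tau> r k) w * \<xi> r k w"
  let ?B = "\<lambda>r w. \<Sum>k<n r. ?V (s r k) w * (exp (\<mu> * d r k) - 1)"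
  note ip = fine_partitionsD[OF fp]
  have \<tau>: "0 \<le> \<tau> r k" "\<tau> r k \<le> \<tau> r (Suc k)" "\<tau> r (Suc k) \<le> T" if "k < n r" for r k
    using is_partition_min(1-3)[OF ip t that] by (auto simp: \<tau>_def)
  have Vs: "?V (s r k) \<in> borel_measurable M" if "k < n r" for r k
    using is_partition_bounds[OF ip, of k r] that by (intro gbm_measurable) auto
  have Em: "elementary_integral m W (n r) (s r) (\<lambda>k j w. ?V (s r k) w * c j) t \<in> borel_measurable M" for r
    by (intro elementary_integral_measurable[OF ip t] borel_measurable_times Vs) auto
  have decomp: "elementary_integral m W (n r) (s r) (\<lambda>k j w. ?V (s r k) w * c j) t w = (?V t w - ?V 0 w - ?B r w) - ?A r w" for r w
  proof -
    \<comment> \<open>The Ito sum samples at \<open>s r k\<close>, the telescoping sum at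
      \<open>\<tau> r k\<close>. They differ only when \<open>s r k\<close> exceeds
      \<open>t\<close>, and then the truncated cell is degenerate.\<close>
    have frozen: "\<tau> r k = s r k \<or> (d r k = 0 \<and> L r k w = 0)" if "k < n r" for k
    proof (cases "s r k \<le> t")
      case False
      then have "\<tau> r k = t" "\<tau> r (Suc k) = t"
        using is_partition_mono[OF ip, of k "Suc k" r] that by (auto simp: \<tau>_def)
      then show ?thesis by (simp add: d_def L_def incr_self)
    qed (simp add: \<tau>_def)
    have "?V t w - ?V 0 w = (\<Sum>k<n r. ?V (\<tau> r (Suc k)) w - ?V (\<tau> r k) w)"
      using t ip[of r] by (subst sum_lessThan_telescope[of "\<lambda>k. ?V (\<tau> r k) w"]) (auto simp: \<tau>_def is_partition_def)
    also have "\<dots> = (\<Sum>k<n r. ?V (s r k) w * L r k w + ?V (s r k) w * (exp (\<mu> * d r k) - 1) + ?V (\<tau> r k) w * \<xi> r k w)"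
    proof (intro sum.cong refl)
      fix k assume "k \<in> {..<n r}"
      then have "\<tau> r k = s r k \<or> (d r k = 0 \<and> L r k w = 0)" using frozen by auto
      moreover have "?V (\<tau> r (Suc k)) w - ?V (\<tau> r k) w = ?V (\<tau> r k) w * (L r k w + (exp (\<mu> * d r k) - 1) + \<xi> r k w)"
        unfolding gbm_step[of v0 \<mu> c "\<tau> r (Suc k)" w "\<tau> r k"] by (simp add: \<xi>_def d_def L_def S_def algebra_simps)
      ultimately show "?V (\<tau> r (Suc k)) w - ?V (\<tau> r k) w = ?V (s r k) w * L r k w + ?V (s r k) w * (exp (\<mu> * d r k) - 1) + ?V (\<tau> r k) w * \<xi> r k w"
        by (auto simp: algebra_simps)
    qed
    finally show ?thesis unfolding elementary_integral_lincomb by (simp add: sum.distrib L_def \<tau>_def)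
  qed
  \<comment> \<open>The residual variance over a cell of length \<open>x\<close>. Its derivative at
    \<open>0\<close> is \<open>(2 * \<mu> + S) - 2 * \<mu> + S - 2 * S = 0\<close>.\<close>
  define v where "v x = exp ((2 * \<mu> + S) * x) - exp (2 * \<mu> * x) + S * x - 2 * S * x * exp (\<mu> * x)" for x :: real
  have v: "(v has_real_derivative 0) (at 0)" "v 0 = 0"
    unfolding v_def by (auto intro!: derivative_eq_intros)
  have A: "integrable M (\<lambda>w. (?A r w)\<^sup>2) \<and> expectation (\<lambda>w. (?A r w)\<^sup>2) = (\<Sum>k<n r. expectation (\<lambda>w. (?V (\<tau> r k) w)\<^sup>2) * v (d r k))" for r
  proof -
    \<comment> \<open>The index set is a singleton: one coefficient per cell and one nonlinear
      function of the whole increment vector.\<close>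
    let ?h = "\<lambda>k (j::unit) x. exp ((\<mu> - 1/2 * S) * d r k + lincomb c x) - exp (\<mu> * d r k) - lincomb c x"
    have hm: "?h k j \<in> borel_measurable (PiM {1..m} (\<lambda>_. borel))" for k j by measurable
    note rm = ito_residual_moments[OF c \<tau>, of _ r \<mu>, folded S_def d_def]
    have p1: "0 \<le> \<tau> r k \<and> \<tau> r k \<le> \<tau> r (Suc k) \<and> \<tau> r (Suc k) \<le> T" if "k < n r" for k using \<tau>[OF that] by simp
    have p2: "?V (\<tau> r k) \<in> borel_measurable (F (\<tau> r k))" "integrable M (\<lambda>w. (?V (\<tau> r k) w)\<^sup>2)" if "k < n r" for k
      using \<tau>[OF that] by (auto intro!: gbm_adapted gbm_moments(3)[OF c])
    have p3: "expectation (\<lambda>w. ?h k i (incr (\<tau> r k) (\<tau> r (Suc k)) w) * ?h k j (incr (\<tau> r k) (\<tau> r (Suc k)) w))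
        = (if i = j then v (d r k) else 0)" if "k < n r" for k i j
      using rm(3)[OF that that that] by (simp add: v_def power2_eq_square)
    have rm1: "integrable M (\<lambda>w. (?h k j (incr (\<tau> r k) (\<tau> r (Suc k)) w))\<^sup>2)" if "k < n r" for k j
      by (rule rm(1)[OF that that that])
    have rm2: "expectation (\<lambda>w. ?h k j (incr (\<tau> r k) (\<tau> r (Suc k)) w)) = 0" if "k < n r" for k j
      by (rule rm(2)[OF that that that])
    note iso = step_isometry[where \<Phi>="\<lambda>k _. ?V (\<tau> r k)" and h="?h" and J="{()}" and \<tau>="\<tau> r" and v="\<lambda>k. v (d r k)" and n="n r",
        OF p1 _ p2 hm rm1 rm2 p3]
    have "integrable M (\<lambda>w. (\<Sum>k<n r. \<Sum>j\<in>{()}. ?V (\<tau> r k) w * ?h k j (incr (\<tau> r k) (\<tau> r (Suc k)) w))\<^sup>2)"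
      by (rule iso(1)) auto
    moreover have "expectation (\<lambda>w. (\<Sum>k<n r. \<Sum>j\<in>{()}. ?V (\<tau> r k) w * ?h k j (incr (\<tau> r k) (\<tau> r (Suc k)) w))\<^sup>2)
       = (\<Sum>k<n r. (\<Sum>j\<in>{()}. expectation (\<lambda>w. (?V (\<tau> r k) w)\<^sup>2)) * v (d r k))"
      by (rule iso(2)) auto
    ultimately show ?thesis by (simp add: \<xi>_def L_def)
  qed
  have \<tau>T: "\<tau> r k \<in> {0..T}" if "k < n r" for r k using \<tau>(1-3)[OF that] by auto
  have "(\<lambda>r. expectation (\<lambda>w. (?A r w)\<^sup>2)) \<longlonglongrightarrow> 0"
    unfolding A[THEN conjunct2]
    unfolding d_def \<tau>_def
  proof (rule fine_partitions_small_o[OF fp t v])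
    fix r k assume "k < n r"
    then have "min t (s r k) \<in> {0..T}" using \<tau>T by (auto simp: \<tau>_def)
    moreover from this have "(2 * \<mu> + S) * min t (s r k) \<le> (2 * \<bar>\<mu>\<bar> + \<bar>S\<bar>) * T" by (intro mult_mono) auto
    ultimately show "\<bar>expectation (\<lambda>w. (?V (min t (s r k)) w)\<^sup>2)\<bar> \<le> v0\<^sup>2 * exp ((2 * \<bar>\<mu>\<bar> + \<bar>S\<bar>) * T)"
      by (subst gbm_moments(4)[OF c, folded S_def]) (auto intro!: mult_left_mono)
  qed
  moreover have Am: "?A r \<in> borel_measurable M" for r
    unfolding \<xi>_def L_def
  proof (intro borel_measurable_sum borel_measurable_times)
    fix k assume k: "k \<in> {..<n r}"
    then have "incr (\<tau> r k) (\<tau> r (Suc k)) \<in> measurable M (PiM {1..m} (\<lambda>_. borel))"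
      using \<tau>[of k r] by (intro incr_measurable) auto
    then have [measurable]: "(\<lambda>w. lincomb c (incr (\<tau> r k) (\<tau> r (Suc k)) w)) \<in> borel_measurable M"
      by (rule measurable_compose) measurable
    show "(\<lambda>w. exp ((\<mu> - 1/2 * S) * d r k + lincomb c (incr (\<tau> r k) (\<tau> r (Suc k)) w)) - exp (\<mu> * d r k) - lincomb c (incr (\<tau> r k) (\<tau> r (Suc k)) w)) \<in> borel_measurable M"
      by measurable
    show "?V (\<tau> r k) \<in> borel_measurable M" using k \<tau>T by (intro gbm_measurable) auto
  qed
  ultimately have limA: "tendsto_in_prob M ?A (\<lambda>_. 0)" using A by (intro tendsto_in_prob_L2) auto
  have limB: "tendsto_in_prob M (\<lambda>r w. ?V t w - ?V 0 w - ?B r w) X"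
  proof (rule AE_imp_tendsto_in_prob)
    show "(\<lambda>w. ?V t w - ?V 0 w - ?B r w) \<in> borel_measurable M" for r
      using t T_pos by (intro borel_measurable_diff borel_measurable_sum borel_measurable_times Vs gbm_measurable) auto
    show "AE w in M. (\<lambda>r. ?V t w - ?V 0 w - ?B r w) \<longlonglongrightarrow> X w"
      using X(2) AE_gbm_continuous[of v0 \<mu> c] AE_gbm_0[of v0 \<mu> c]
    proof eventually_elim
      case (elim w)
      obtain K where K: "\<And>u. u \<in> {0..T} \<Longrightarrow> \<bar>?V u w\<bar> \<le> K" using continuous_on_bound[OF elim(2)] by metis
      \<comment> \<open>Replacing \<open>exp (\<mu> * x) - 1\<close> by \<open>\<mu> * x\<close>
        costs this second-order remainder and turns \<open>?B\<close> into a Riemann sum of the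
        drift.\<close>
      define e where "e x = exp (\<mu> * x) - 1 - \<mu> * x" for x :: real
      have e: "(e has_real_derivative 0) (at 0)" "e 0 = 0" unfolding e_def by (auto intro!: derivative_eq_intros)
      have 1: "(\<lambda>r. \<Sum>k<n r. ?V (s r k) w * e (min t (s r (Suc k)) - min t (s r k))) \<longlonglongrightarrow> 0"
      proof (rule fine_partitions_small_o[OF fp t e])
        show "\<bar>?V (s r k) w\<bar> \<le> K" if "k < n r" for r k using is_partition_bounds[OF ip, of k r] that by (intro K) auto
      qed
      have 2: "(\<lambda>r. \<Sum>k<n r. (?V (s r k) w * \<mu>) * (min t (s r (Suc k)) - min t (s r k))) \<longlonglongrightarrow> (LBINT u:{0..t}. ?V u w * \<mu>)"
        using elim(2) by (intro riemann_sum_continuous[OF fp t] continuous_intros)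
      have "?B r w = (\<Sum>k<n r. ?V (s r k) w * e (min t (s r (Suc k)) - min t (s r k)))
         + (\<Sum>k<n r. (?V (s r k) w * \<mu>) * (min t (s r (Suc k)) - min t (s r k)))" for r
        unfolding sum.distrib[symmetric] by (intro sum.cong refl) (simp add: e_def d_def \<tau>_def algebra_simps)
      then have "(\<lambda>r. ?B r w) \<longlonglongrightarrow> 0 + (LBINT u:{0..t}. ?V u w * \<mu>)" using tendsto_add[OF 1 2] by simp
      from tendsto_diff[OF tendsto_const this, of "?V t w - ?V 0 w"] show ?case using elim(1,3) by simp
    qed
  qed (rule X)
  show ?thesis using tendsto_in_prob_diff[OF limB limA] unfolding decomp by simp
qed

end

text \<open>The paths for which left Riemann sums converge. Continuity would be too narrow, since
  squared step errors may jump at the nodes.\<close>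

definition left_regular :: "real \<Rightarrow> (real \<Rightarrow> real) \<Rightarrow> bool" where
  "left_regular T h \<longleftrightarrow> (\<forall>u\<in>{0<..T}. (h \<longlongrightarrow> h u) (at_left u)) \<and> (\<exists>K. \<forall>u\<in>{0..T}. \<bar>h u\<bar> \<le> K)"

text \<open>The time integral is almost surely a limit of Riemann sums, each a finite combination of
  the variables \<open>Y u\<close>. This takes the place of joint measurability and Fubini's
  theorem.\<close>

lemma set_integral_measurable_version:
  fixes Y :: "real \<Rightarrow> 'w \<Rightarrow> real"
  assumes T: "0 < T" and t: "t \<in> {0..T}" and Y: "\<And>u. u \<in> {0..T} \<Longrightarrow> Y u \<in> borel_measurable M"
    and ae: "AE w in M. left_regular T (\<lambda>u. Y u w)"
  shows "(\<lambda>w. LBINT u:{0..t}. Y u w) \<in> borel_measurable (completion M)"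
    and "\<exists>I\<in>borel_measurable M. AE w in M. (LBINT u:{0..t}. Y u w) = I w"
proof -
  let ?s = "\<lambda>r k. T * real k / real (Suc r)"
  note fp = fine_partitions_uniform[OF T]
  let ?f = "\<lambda>r w. \<Sum>k<Suc r. Y (?s r k) w * (min t (?s r (Suc k)) - min t (?s r k))"
  have m: "?f r \<in> borel_measurable M" for r
  proof (intro borel_measurable_sum borel_measurable_times Y borel_measurable_const)
    fix k assume "k \<in> {..<Suc r}"
    then show "?s r k \<in> {0..T}" using is_partition_bounds[OF fine_partitionsD[OF fp], of k r] by auto
  qed
  have lim: "AE w in M. (\<lambda>r. ?f r w) \<longlonglongrightarrow> (LBINT u:{0..t}. Y u w)"
    using ae
  proof eventually_elim
    case (elim w)
    then obtain K where K: "\<And>u. u \<in> {0..T} \<Longrightarrow> \<bar>Y u w\<bar> \<le> K" unfolding left_regular_def by blast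
    show ?case using elim unfolding left_regular_def by (intro riemann_sum_tendsto[OF fp t _ K]) auto
  qed
  show "(\<lambda>w. LBINT u:{0..t}. Y u w) \<in> borel_measurable (completion M)"
    "\<exists>I\<in>borel_measurable M. AE w in M. (LBINT u:{0..t}. Y u w) = I w"
    using completion_measurable_AE_limit[OF m lim] by auto
qed

lemma left_regular_continuous:
  fixes h :: "real \<Rightarrow> real"
  assumes "continuous_on {0..T} h"
  shows "left_regular T h"
proof -
  obtain K where "\<And>u. u \<in> {0..T} \<Longrightarrow> \<bar>h u\<bar> \<le> K" using continuous_on_bound[OF assms] by metis
  then show ?thesis unfolding left_regular_def by (intro conjI ballI exI[of _ K] left_limit_of_continuous_on[OF assms])
qed

lemma continuous_on_set_integral:
  fixes h :: "real \<Rightarrow> real"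
  assumes h: "continuous_on {0..T} h"
  shows "continuous_on {0..T} (\<lambda>t. LBINT u:{0..t}. h u)"
proof -
  have "(LBINT u:{0..t}. h u) = integral {0..t} h" if "t \<in> {0..T}" for t
    using that by (intro set_borel_integral_eq_integral borel_integrable_atLeastAtMost' continuous_on_subset[OF h]) auto
  moreover have "continuous_on {0..T} (\<lambda>t. integral {0..t} h)"
    by (intro indefinite_integral_continuous_1 integrable_continuous_interval h)
  ultimately show ?thesis by (subst continuous_on_cong[OF refl]) auto
qed

lemma (in prob_space) tendsto_in_prob_zero_squeeze:
  assumes A: "tendsto_in_prob M A (\<lambda>_. 0)" and Q: "\<And>n. Q n \<in> borel_measurable M"
    and le: "\<And>n. AE w in M. \<bar>Q n w\<bar> \<le> a * A n w" and a: "0 < a"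
  shows "tendsto_in_prob M Q (\<lambda>_. 0)"
  unfolding tendsto_in_prob_def
proof (intro conjI allI impI)
  note [measurable] = tendsto_in_probD(1)[OF A] Q
  fix \<epsilon> :: real assume "0 < \<epsilon>"
  then have e: "0 < \<epsilon> / a" using a by simp
  show "(\<lambda>n. prob {w \<in> space M. \<epsilon> < \<bar>Q n w - 0\<bar>}) \<longlonglongrightarrow> 0"
  proof (rule tendsto_sandwich[OF always_eventually always_eventually tendsto_const tendsto_in_probD(3)[OF A e]])
    show "\<forall>n. prob {w \<in> space M. \<epsilon> < \<bar>Q n w - 0\<bar>} \<le> prob {w \<in> space M. \<epsilon> / a < \<bar>A n w - 0\<bar>}"
    proof
      fix n
      have "AE w in M. w \<in> {w \<in> space M. \<epsilon> < \<bar>Q n w - 0\<bar>} \<longrightarrow> w \<in> {w \<in> space M. \<epsilon> / a < \<bar>A n w - 0\<bar>}"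
        using le[of n]
      proof eventually_elim
        case (elim w)
        have "a * A n w \<le> a * \<bar>A n w\<bar>" using a by (intro mult_left_mono) auto
        then have "\<bar>Q n w\<bar> \<le> a * \<bar>A n w\<bar>" using elim by linarith
        then show ?case using a by (auto simp: pos_divide_less_eq mult.commute)
      qed
      then show "prob {w \<in> space M. \<epsilon> < \<bar>Q n w - 0\<bar>} \<le> prob {w \<in> space M. \<epsilon> / a < \<bar>A n w - 0\<bar>}"
        by (rule finite_measure_mono_AE) measurable
    qed
  qed simp
qed (use Q in auto)

lemma (in prob_space) tendsto_in_prob_zero_mult:
  assumes A: "tendsto_in_prob M A (\<lambda>_. 0)"
  shows "tendsto_in_prob M (\<lambda>n w. A n w * b) (\<lambda>_. 0)"
proof -
  have "tendsto_in_prob M (\<lambda>n w. \<bar>A n w\<bar>) (\<lambda>_. 0)"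
    using A by (auto simp: tendsto_in_prob_def intro!: borel_measurable_abs)
  then show ?thesis
    \<comment> \<open>The added \<open>1\<close> keeps the factor positive when
      \<open>b = 0\<close>.\<close>
    by (rule tendsto_in_prob_zero_squeeze[where a="\<bar>b\<bar> + 1"])
      (use tendsto_in_probD(1)[OF A] in \<open>auto simp: abs_mult algebra_simps\<close>)
qed

text \<open>Convergence is pathwise, by \<open>step_approximation_L2\<close>; the work lies in the
  measurability of the integral, for which the squared error is shown to be left-regular.\<close>

lemma (in prob_space) step_error_tendsto_in_prob:
  fixes Y :: "real \<Rightarrow> 'a \<Rightarrow> real"
  assumes T: "0 < T" and fp: "fine_partitions T n s" and Y: "\<And>u. u \<in> {0..T} \<Longrightarrow> Y u \<in> borel_measurable M"
    and cont: "AE w in M. continuous_on {0..T} (\<lambda>u. Y u w)"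
  shows "tendsto_in_prob (completion M)
    (\<lambda>r w. LBINT u:{0..T}. ((\<Sum>k<n r. Y (s r k) w * indicator {s r k<..s r (Suc k)} u) - Y u w)\<^sup>2) (\<lambda>_. 0)"
proof -
  interpret C: prob_space "completion M" by (rule prob_space_completion)
  note ip = fine_partitionsD[OF fp]
  let ?D = "\<lambda>r u w. (\<Sum>k<n r. Y (s r k) w * indicator {s r k<..s r (Suc k)} u) - Y u w"
  have Dm: "(\<lambda>w. LBINT u:{0..T}. (?D r u w)\<^sup>2) \<in> borel_measurable (completion M)" for r
  proof (rule set_integral_measurable_version(1)[OF T])
    show "(\<lambda>w. (?D r u w)\<^sup>2) \<in> borel_measurable M" if "u \<in> {0..T}" for u
    proof (intro borel_measurable_power borel_measurable_diff borel_measurable_sum borel_measurable_times Y that)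
      fix k assume "k \<in> {..<n r}"
      then show "s r k \<in> {0..T}" using is_partition_bounds[OF ip, of k r] by auto
    qed simp
    show "AE w in M. left_regular T (\<lambda>u. (?D r u w)\<^sup>2)"
      using cont
    proof eventually_elim
      case (elim w)
      obtain K where K: "0 \<le> K" "\<And>u. u \<in> {0..T} \<Longrightarrow> \<bar>Y u w\<bar> \<le> K" using continuous_on_bound[OF elim] by metis
      have "\<bar>(?D r u w)\<^sup>2\<bar> \<le> (2 * K)\<^sup>2" if "u \<in> {0..T}" for u
      proof -
        have "\<bar>\<Sum>k<n r. Y (s r k) w * indicator {s r k<..s r (Suc k)} u\<bar> \<le> K"
          using fine_step_bounded[OF ip, of "\<lambda>u. Y u w" K r u] K by blast
        then have "\<bar>?D r u w\<bar> \<le> 2 * K" using K(2)[OF that] by linarith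
        from square_le_of_abs_le[OF this] show ?thesis by simp
      qed
      moreover have "((\<lambda>u. (?D r u w)\<^sup>2) \<longlongrightarrow> (?D r u w)\<^sup>2) (at_left u)" if "u \<in> {0<..T}" for u
        using that by (intro tendsto_power tendsto_diff step_left_continuous[OF ip, where g="\<lambda>k. Y (s r k) w"] left_limit_of_continuous_on[OF elim])
      ultimately show ?case unfolding left_regular_def by blast
    qed
  qed (use T in simp)
  show ?thesis
  proof (rule C.AE_imp_tendsto_in_prob[OF Dm])
    have "AE w in M. (\<lambda>r. LBINT u:{0..T}. (?D r u w)\<^sup>2) \<longlonglongrightarrow> 0"
      using cont by eventually_elim (rule step_approximation_L2(1)[OF fp])
    then show "AE w in completion M. (\<lambda>r. LBINT u:{0..T}. (?D r u w)\<^sup>2) \<longlonglongrightarrow> 0"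
      by (rule AE_completion)
  qed simp
qed

lemma elementary_value_indicator:
  "elementary_value n s (\<lambda>k j w. U (s k) w * c j) j u w = (\<Sum>k<n. U (s k) w * indicator {s k<..s (Suc k)} u) * c j"
  unfolding elementary_value_def sum_distrib_right by (intro sum.cong refl) (simp add: mult_ac)

context brownian_family
begin

text \<open>The integrand is approximated by its samples on the uniform partitions. The candidate
  integral is the remainder of the equation, so the task is to show that the elementary integrals
  converge to it.\<close>

lemma ito_integral_gbm:
  assumes c: "0 < (\<Sum>j=1..m. (c j)\<^sup>2)"
  shows "ito_integral M F T m W (\<lambda>j t w. gbm v0 \<mu> c t w * c j)
    (\<lambda>t w. gbm v0 \<mu> c t w - v0 - (LBINT u:{0..t}. gbm v0 \<mu> c u w * \<mu>))"
  unfolding ito_integral_def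
proof (intro conjI ballI)
  let ?V = "gbm v0 \<mu> c"
  let ?X = "\<lambda>t w. ?V t w - v0 - (LBINT u:{0..t}. ?V u w * \<mu>)"
  interpret C: prob_space "completion M" by (rule prob_space_completion)
  {
    fix j assume "j \<in> {1..m}"
    show "adapted_process F T (\<lambda>t w. ?V t w * c j)"
      unfolding adapted_process_def by (auto intro!: borel_measurable_times gbm_adapted)
    show "AE w in M. set_borel_measurable lborel {0..T} (\<lambda>s. ?V s w * c j) \<and> set_integrable lborel {0..T} (\<lambda>s. (?V s w * c j)\<^sup>2)"
      using AE_gbm_continuous[of v0 \<mu> c]
    proof eventually_elim
      case (elim w)
      have "set_borel_measurable lborel {0..T} (\<lambda>s. ?V s w * c j)"
        unfolding set_borel_measurable_def using elim
        using borel_measurable_continuous_on_indicator[of "{0..T}" "\<lambda>s. ?V s w * c j"]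
        by (simp add: continuous_on_mult_right)
      moreover have "set_integrable lborel {0..T} (\<lambda>s. (?V s w * c j)\<^sup>2)"
        using elim by (intro borel_integrable_atLeastAtMost' continuous_intros)
      ultimately show ?case ..
    qed
  }
  show "continuous_process M T ?X"
    unfolding continuous_process_def using AE_gbm_continuous[of v0 \<mu> c]
    by eventually_elim (intro continuous_intros continuous_on_set_integral)
  let ?s = "\<lambda>r k. T * real k / real (Suc r)"
  let ?\<Phi> = "\<lambda>r k j w. ?V (?s r k) w * c j"
  note fp = fine_partitions_uniform[OF T_pos]
  note ip = fine_partitionsD[OF fp]
  have ep: "elementary_process F T m (Suc r) (?s r) (?\<Phi> r)" for r
    using ip[of r] unfolding elementary_process_def is_partition_def
    using T_pos by (auto intro!: borel_measurable_times gbm_adapted)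
  let ?D = "\<lambda>r u w. (\<Sum>k<Suc r. ?V (?s r k) w * indicator {?s r k<..?s r (Suc k)} u) - ?V u w"
  \<comment> \<open>All components share the factor \<open>?V\<close>, so the
    \<open>m\<close>-dimensional error is a one-dimensional one times the sum of the squares of
    \<open>c\<close>.\<close>
  have int_eq: "(LBINT u:{0..T}. (\<Sum>j=1..m. (elementary_value (Suc r) (?s r) (?\<Phi> r) j u w - ?V u w * c j)\<^sup>2))
      = (LBINT u:{0..T}. (?D r u w)\<^sup>2) * (\<Sum>j=1..m. (c j)\<^sup>2)" for r w
  proof -
    have "(\<Sum>j=1..m. (elementary_value (Suc r) (?s r) (?\<Phi> r) j u w - ?V u w * c j)\<^sup>2) = (?D r u w)\<^sup>2 * (\<Sum>j=1..m. (c j)\<^sup>2)" for u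
      unfolding elementary_value_indicator[of "Suc r" "?s r" ?V c]
      by (simp only: left_diff_distrib[symmetric] power_mult_distrib sum_distrib_left)
    then show ?thesis by simp
  qed
  have "tendsto_in_prob (completion M) (\<lambda>r w. LBINT u:{0..T}. (?D r u w)\<^sup>2) (\<lambda>_. 0)"
    by (rule step_error_tendsto_in_prob[OF T_pos fp gbm_measurable AE_gbm_continuous])
  then have "tendsto_in_prob (completion M) (\<lambda>r w. (LBINT u:{0..T}. (?D r u w)\<^sup>2) * (\<Sum>j=1..m. (c j)\<^sup>2)) (\<lambda>_. 0)"
    by (rule C.tendsto_in_prob_zero_mult)
  then have L2: "tendsto_in_prob (completion M)
      (\<lambda>r w. LBINT u:{0..T}. (\<Sum>j=1..m. (elementary_value (Suc r) (?s r) (?\<Phi> r) j u w - ?V u w * c j)\<^sup>2)) (\<lambda>_. 0)"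
    unfolding int_eq .
  have conv: "tendsto_in_prob (completion M) (\<lambda>r. elementary_integral m W (Suc r) (?s r) (?\<Phi> r) t) (?X t)" if t: "t \<in> {0..T}" for t
  proof -
    have ae: "AE w in M. left_regular T (\<lambda>u. ?V u w * \<mu>)"
      using AE_gbm_continuous[of v0 \<mu> c] by eventually_elim (intro left_regular_continuous continuous_intros)
    have Vm: "(\<lambda>w. ?V u w * \<mu>) \<in> borel_measurable M" if "u \<in> {0..T}" for u
      using that by (intro borel_measurable_times gbm_measurable) auto
    note ver = set_integral_measurable_version[OF T_pos t Vm ae]
    from ver(2) obtain I where I: "I \<in> borel_measurable M" "AE w in M. (LBINT u:{0..t}. ?V u w * \<mu>) = I w" by auto
    let ?X' = "\<lambda>w. ?V t w - v0 - I w"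
    have X': "?X' \<in> borel_measurable M" "AE w in M. ?X' w = ?X t w"
      using I t by (auto intro!: borel_measurable_diff gbm_measurable)
    have tp: "tendsto_in_prob M (\<lambda>r. elementary_integral m W (Suc r) (?s r) (?\<Phi> r) t) ?X'"
      by (rule ito_sum_gbm[OF c fp t X'])
    have em: "elementary_integral m W (Suc r) (?s r) (?\<Phi> r) t \<in> borel_measurable M" for r
      using tendsto_in_probD(1)[OF tp] .
    have "tendsto_in_prob (completion M) (\<lambda>r. elementary_integral m W (Suc r) (?s r) (?\<Phi> r) t) ?X'"
      using tp tendsto_in_prob_completion_iff[OF em X'(1)] by simp
    then show ?thesis
    proof (rule tendsto_in_prob_AE_cong)
      show "?X t \<in> borel_measurable (completion M)"
        by (rule completion_measurable_AE_cong[OF X'])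
      show "AE w in completion M. ?X' w = ?X t w" using X'(2) by (rule AE_completion)
    qed (use em in \<open>auto intro: measurable_completion\<close>)
  qed
  show "\<exists>n s \<Phi>. (\<forall>r. elementary_process F T m (n r) (s r) (\<Phi> r)) \<and>
        tendsto_in_prob (completion M)
          (\<lambda>r w. LBINT u:{0..T}. (\<Sum>j=1..m. (elementary_value (n r) (s r) (\<Phi> r) j u w - ?V u w * c j)\<^sup>2))
          (\<lambda>_. 0) \<and>
        (\<forall>t\<in>{0..T}. tendsto_in_prob (completion M)
          (\<lambda>r. elementary_integral m W (n r) (s r) (\<Phi> r) t) (?X t))"
    using ep L2 conv by (intro exI[of _ Suc] exI[of _ ?s] exI[of _ ?\<Phi>] conjI allI ballI)
qed

end

section \<open>Uniqueness\<close>

lemma tendsto_in_prob_completion: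
  assumes "tendsto_in_prob M Y Z" shows "tendsto_in_prob (completion M) Y Z"
  using tendsto_in_prob_completion_iff[of Y M Z] tendsto_in_probD(1,2)[OF assms] assms by simp

lemma integral_square_le_shifted:
  fixes f g :: "'a \<Rightarrow> real"
  assumes m: "f \<in> borel_measurable M" "g \<in> borel_measurable M"
    and i: "integrable M (\<lambda>x. (f x)\<^sup>2)" "integrable M (\<lambda>x. (g x)\<^sup>2)"
  shows "(\<integral>x. (f x)\<^sup>2 \<partial>M) \<le> 2 * (\<integral>x. (f x + g x)\<^sup>2 \<partial>M) + 2 * (\<integral>x. (g x)\<^sup>2 \<partial>M)"
proof -
  have "(f x)\<^sup>2 \<le> 2 * (f x + g x)\<^sup>2 + 2 * (g x)\<^sup>2" for x
    using zero_le_power2[of "f x + 2 * g x"] by (simp add: power2_eq_square algebra_simps)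
  then have "(\<integral>x. (f x)\<^sup>2 \<partial>M) \<le> (\<integral>x. 2 * (f x + g x)\<^sup>2 + 2 * (g x)\<^sup>2 \<partial>M)"
    using i integrable_square_add(1)[OF m i] by (intro integral_mono) auto
  then show ?thesis using i integrable_square_add(1)[OF m i] by simp
qed

text \<open>Once the running sum exceeds \<open>\<delta>\<close> it stays above, so the kept terms
  form an initial segment with sum at most \<open>\<delta>\<close>. This is the discrete counterpart
  of stopping when the accumulated error becomes too large.\<close>

lemma sum_truncated_le:
  fixes x :: "nat \<Rightarrow> real"
  assumes "0 \<le> \<delta>" "\<And>k. k < n \<Longrightarrow> 0 \<le> x k"
  shows "(\<Sum>k<n. if (\<Sum>l\<le>k. x l) \<le> \<delta> then x k else 0) \<le> \<delta>"
  using assms(2)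
proof (induction n)
  case (Suc n)
  show ?case
  proof (cases "(\<Sum>l\<le>n. x l) \<le> \<delta>")
    case True
    have "(\<Sum>k<Suc n. if (\<Sum>l\<le>k. x l) \<le> \<delta> then x k else 0) \<le> (\<Sum>k<Suc n. x k)"
      using Suc.prems by (intro sum_mono) auto
    then show ?thesis using True by (simp add: lessThan_Suc_atMost)
  qed (use Suc in simp)
qed (use assms in simp)

lemma power_increment_le:
  fixes a b :: real
  assumes "0 \<le> a" "a \<le> b"
  shows "real (Suc p) * (a ^ p * (b - a)) \<le> b ^ Suc p - a ^ Suc p"
proof (induction p)
  case (Suc p)
  have "0 \<le> real (Suc p) * (a ^ p * (b - a))" using assms by simp
  then have "a * (real (Suc p) * (a ^ p * (b - a))) \<le> b * (b ^ Suc p - a ^ Suc p)"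
    using assms Suc by (intro mult_mono) auto
  moreover have "b * (b ^ Suc p - a ^ Suc p) + a ^ Suc p * (b - a) = b ^ Suc (Suc p) - a ^ Suc (Suc p)"
    by (simp add: algebra_simps)
  moreover have "a * (real (Suc p) * (a ^ p * (b - a))) + a ^ Suc p * (b - a) = real (Suc (Suc p)) * (a ^ Suc p * (b - a))"
    by (simp add: algebra_simps)
  ultimately show ?case by linarith
qed simp

text \<open>The left Riemann sum of an increasing function lies below its integral. Iterated, the
  factor \<open>1 / Suc p\<close> builds up the factorial.\<close>

lemma left_riemann_sum_power_le:
  assumes ip: "is_partition T n s" and t: "t \<in> {0..T}"
  shows "(\<Sum>k<n. s k ^ p * (min t (s (Suc k)) - min t (s k))) \<le> t ^ Suc p / real (Suc p)"
proof -
  let ?\<tau> = "\<lambda>k. min t (s k)"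
  have "s k ^ p * (?\<tau> (Suc k) - ?\<tau> k) \<le> (?\<tau> (Suc k) ^ Suc p - ?\<tau> k ^ Suc p) / real (Suc p)" if k: "k < n" for k
  proof -
    note mi = is_partition_min[OF ip t k]
    have "s k ^ p * (?\<tau> (Suc k) - ?\<tau> k) = ?\<tau> k ^ p * (?\<tau> (Suc k) - ?\<tau> k)"
      using is_partition_mono[OF ip, of k "Suc k"] k by (cases "s k \<le> t") (auto simp: min_def)
    also have "\<dots> \<le> (?\<tau> (Suc k) ^ Suc p - ?\<tau> k ^ Suc p) / real (Suc p)"
      using power_increment_le[OF mi(1,2), of p] by (simp add: pos_le_divide_eq mult.commute del: power_Suc of_nat_Suc)
    finally show ?thesis .
  qed
  then have "(\<Sum>k<n. s k ^ p * (?\<tau> (Suc k) - ?\<tau> k)) \<le> (\<Sum>k<n. (?\<tau> (Suc k) ^ Suc p - ?\<tau> k ^ Suc p) / real (Suc p))"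
    by (intro sum_mono) auto
  also have "\<dots> = t ^ Suc p / real (Suc p)"
    unfolding sum_divide_distrib[symmetric]
    using ip t by (subst sum_lessThan_telescope[of "\<lambda>k. ?\<tau> k ^ Suc p"]) (auto simp: is_partition_def)
  finally show ?thesis .
qed

text \<open>The nodes of all uniform partitions, countable and, for positive \<open>T\<close>, dense
  in \<open>{0..T}\<close>. The index \<open>k\<close> is unbounded, so points past \<open>T\<close>
  occur and users intersect with an interval.\<close>

definition grid :: "real \<Rightarrow> real set" where
  "grid T = (\<lambda>(r, k). T * real k / real (Suc r)) ` UNIV"

lemma countable_grid: "countable (grid T)"
  unfolding grid_def by simp

lemma zero_in_grid: "0 \<in> grid T"
  unfolding grid_def by (force intro: image_eqI[of _ _ "(0, 0)"])

text \<open>For \<open>u > 0\<close> the value \<open>h u\<close> is the limit of samples at the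
  left nodes of the cells containing \<open>u\<close>; these nodes lie below \<open>t\<close>, so
  the bound covers them. The point \<open>0\<close> is itself in the grid.\<close>

lemma bounded_on_grid:
  fixes h :: "real \<Rightarrow> real"
  assumes T: "0 < T" and h: "continuous_on {0..T} h" and t: "t \<in> {0..T}"
    and R: "\<And>q. q \<in> grid T \<Longrightarrow> 0 \<le> q \<Longrightarrow> q \<le> t \<Longrightarrow> \<bar>h q\<bar> \<le> R" and u: "u \<in> {0..t}"
  shows "\<bar>h u\<bar> \<le> R"
proof (cases "u = 0")
  case True
  then show ?thesis using R zero_in_grid t by auto
next
  case False
  then have uT: "u \<in> {0<..T}" using u t by auto
  note fp = fine_partitions_uniform[OF T]
  let ?s = "\<lambda>r k. T * real k / real (Suc r)"
  have "(\<lambda>r. \<Sum>k<Suc r. h (?s r k) * indicator {?s r k<..?s r (Suc k)} u) \<longlonglongrightarrow> h u"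
    by (rule fine_step_tendsto[OF fp uT left_limit_of_continuous_on[OF h uT]])
  then have lim: "(\<lambda>r. \<bar>\<Sum>k<Suc r. h (?s r k) * indicator {?s r k<..?s r (Suc k)} u\<bar>) \<longlonglongrightarrow> \<bar>h u\<bar>"
    by (rule tendsto_rabs)
  show ?thesis
  proof (rule LIMSEQ_le_const2[OF lim], intro exI allI impI)
    fix r
    obtain k where k: "k < Suc r" "u \<in> {?s r k<..?s r (Suc k)}"
      using is_partition_cell[OF fine_partitionsD[OF fp] uT] by metis
    have "\<bar>h (?s r k)\<bar> \<le> R"
      using k u T by (intro R) (auto simp: grid_def intro!: image_eqI[of _ _ "(r, k)"])
    then show "\<bar>\<Sum>k<Suc r. h (?s r k) * indicator {?s r k<..?s r (Suc k)} u\<bar> \<le> R"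
      unfolding sum_cell[OF fine_partitionsD[OF fp] k] .
  qed
qed

text \<open>One component of an arbitrary solution, with an approximating sequence whose mesh
  already vanishes. Components can be treated singly because the coefficients of each equation
  depend on its own unknown only.\<close>

locale sde_solution_component = brownian_family M T m W
  for M :: "'w measure" and T :: real and m :: nat and W :: "nat \<Rightarrow> real \<Rightarrow> 'w \<Rightarrow> real" +
  fixes c :: "nat \<Rightarrow> real" and \<mu> v0 :: real and U X :: "real \<Rightarrow> 'w \<Rightarrow> real"
    and n :: "nat \<Rightarrow> nat" and s :: "nat \<Rightarrow> nat \<Rightarrow> real" and \<Phi> :: "nat \<Rightarrow> nat \<Rightarrow> nat \<Rightarrow> 'w \<Rightarrow> real"
  assumes c_pos: "0 < (\<Sum>j=1..m. (c j)\<^sup>2)"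
    and U_cont: "continuous_process M T U" and U_adapted: "adapted_process F T U"
    and fp: "fine_partitions T n s" and ep: "\<And>r. elementary_process F T m (n r) (s r) (\<Phi> r)"
    and L2: "tendsto_in_prob (completion M)
      (\<lambda>r w. LBINT u:{0..T}. (\<Sum>j=1..m. (elementary_value (n r) (s r) (\<Phi> r) j u w - U u w * c j)\<^sup>2)) (\<lambda>_. 0)"
    and conv: "\<And>t. t \<in> {0..T} \<Longrightarrow> tendsto_in_prob (completion M) (\<lambda>r. elementary_integral m W (n r) (s r) (\<Phi> r) t) (X t)"
    and eq: "AE w in M. \<forall>t\<in>{0..T}. U t w = v0 + (LBINT u:{0..t}. U u w * \<mu>) + X t w"
begin

abbreviation V where "V \<equiv> gbm v0 \<mu> c"

abbreviation dt where "dt r t k \<equiv> min t (s r (Suc k)) - min t (s r k)"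

definition D :: "real \<Rightarrow> 'w \<Rightarrow> real" where "D t w = U t w - V t w"

text \<open>The squared error of the coefficient against \<open>U\<close> sampled at the left end,
  not against \<open>U\<close> along the cell: this makes it known at time \<open>s r k\<close>, as
  the cut-off requires.\<close>

definition err :: "nat \<Rightarrow> nat \<Rightarrow> 'w \<Rightarrow> real" where
  "err r k w = (\<Sum>j=1..m. (\<Phi> r k j w - U (s r k) w * c j)\<^sup>2) * (s r (Suc k) - s r k)"

definition Q :: "nat \<Rightarrow> 'w \<Rightarrow> real" where "Q r w = (\<Sum>k<n r. err r k w)"

lemmas ip = fine_partitionsD[OF fp]

lemma s_bounds: "k \<le> n r \<Longrightarrow> s r k \<in> {0..T}"
  using is_partition_bounds[OF ip, of k r] by simp

lemma U_F: "t \<in> {0..T} \<Longrightarrow> U t \<in> borel_measurable (F t)"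
  using U_adapted by (simp add: adapted_process_def)

lemma U_M: "t \<in> {0..T} \<Longrightarrow> U t \<in> borel_measurable M"
  using U_F[of t] by (auto intro: F_measurable)

lemma D_F: "t \<in> {0..T} \<Longrightarrow> D t \<in> borel_measurable (F t)"
  unfolding D_def[abs_def] by (intro borel_measurable_diff U_F gbm_adapted) auto

lemma D_M: "t \<in> {0..T} \<Longrightarrow> D t \<in> borel_measurable M"
  using D_F[of t] by (auto intro: F_measurable)

lemma \<Phi>_F: "k < n r \<Longrightarrow> j \<in> {1..m} \<Longrightarrow> \<Phi> r k j \<in> borel_measurable (F (s r k))"
  using ep[of r] by (auto simp: elementary_process_def)

lemma err_F: "k < n r \<Longrightarrow> err r k \<in> borel_measurable (F (s r k))"
  unfolding err_def[abs_def]
  by (intro borel_measurable_times borel_measurable_sum borel_measurable_power borel_measurable_diff \<Phi>_F U_F s_bounds) auto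

lemma err_nonneg: "k < n r \<Longrightarrow> 0 \<le> err r k w"
  using is_partition_mono[OF ip, of k "Suc k" r] by (auto simp: err_def intro!: mult_nonneg_nonneg sum_nonneg)

lemma F_s_measurable: "k < n r \<Longrightarrow> f \<in> measurable (F (s r k)) N \<Longrightarrow> f \<in> measurable M N"
  using s_bounds[of k r] by (auto intro: F_measurable[of "s r k"])

lemma Q_M: "Q r \<in> borel_measurable M"
  unfolding Q_def[abs_def] by (intro borel_measurable_sum F_s_measurable[OF _ err_F]) auto

lemma AE_U_continuous: "AE w in M. continuous_on {0..T} (\<lambda>t. U t w)"
  using U_cont by (simp add: continuous_process_def)

lemma AE_D_continuous: "AE w in M. continuous_on {0..T} (\<lambda>t. D t w)"
  using AE_U_continuous AE_gbm_continuous[of v0 \<mu> c] unfolding D_def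
  by eventually_elim (intro continuous_intros)

text \<open>The sampled error is the approximation error of the integrand minus the error of
  sampling \<open>U\<close>, and the square of a difference costs the factor
  \<open>2\<close>.\<close>

lemma Q_le:
  assumes U: "continuous_on {0..T} (\<lambda>t. U t w)"
  shows "Q r w \<le> 2 * (LBINT u:{0..T}. (\<Sum>j=1..m. (elementary_value (n r) (s r) (\<Phi> r) j u w - U u w * c j)\<^sup>2))
    + 2 * (LBINT u:{0..T}. ((\<Sum>k<n r. U (s r k) w * indicator {s r k<..s r (Suc k)} u) - U u w)\<^sup>2) * (\<Sum>j=1..m. (c j)\<^sup>2)"
proof -
  let ?st = "\<lambda>u. \<Sum>k<n r. U (s r k) w * indicator {s r k<..s r (Suc k)} u"
  let ?a = "\<lambda>j k. \<Phi> r k j w - U (s r k) w * c j"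
  define f where "f j u = (\<Sum>k<n r. ?a j k * indicator {s r k<..s r (Suc k)} u)" for j and u :: real
  define g where "g j u = indicator {0..T} u * (?st u - U u w) * c j" for j and u :: real
  have f_ev: "f j u = elementary_value (n r) (s r) (\<Phi> r) j u w - ?st u * c j" for j u
    unfolding f_def elementary_value_def sum_distrib_right sum_subtractf[symmetric]
    by (intro sum.cong refl) (simp add: algebra_simps)
  have f_sq: "(f j u)\<^sup>2 = (\<Sum>k<n r. (?a j k)\<^sup>2 * indicator {s r k<..s r (Suc k)} u)" for j u
  proof (cases "u \<in> {0<..T}")
    case True
    then obtain k where k: "k < n r" "u \<in> {s r k<..s r (Suc k)}" using is_partition_cell[OF ip] by metis
    show ?thesis unfolding f_def sum_cell[OF ip k] ..
  next
    case False
    then show ?thesis unfolding f_def sum_cell_outside[OF ip False] by simp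
  qed
  have f_supp: "(f j u)\<^sup>2 = indicator {0..T} u *\<^sub>R (f j u)\<^sup>2" for j u
    using sum_cell_outside[where g="?a j", OF ip[of r], of u] by (cases "u \<in> {0..T}") (auto simp: f_def simp del: sum_mult_indicator)
  have TT: "T \<in> {0..T}" using T_pos by simp
  have f_int: "integrable lborel (\<lambda>u. (f j u)\<^sup>2)"
    "(\<integral>u. (f j u)\<^sup>2 \<partial>lborel) = (\<Sum>k<n r. (?a j k)\<^sup>2 * (s r (Suc k) - s r k))" for j
  proof -
    have eqs: "(\<lambda>u. indicator {0..T} u *\<^sub>R (\<Sum>k<n r. (?a j k)\<^sup>2 * indicator {s r k<..s r (Suc k)} u)) = (\<lambda>u. (f j u)\<^sup>2)"
      using f_supp f_sq by metis
    show "integrable lborel (\<lambda>u. (f j u)\<^sup>2)"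
      using set_integral_step(1)[OF ip[of r] TT, where g="\<lambda>k. (?a j k)\<^sup>2"] unfolding set_integrable_def eqs .
    have "(\<integral>u. (f j u)\<^sup>2 \<partial>lborel) = (\<Sum>k<n r. (?a j k)\<^sup>2 * (min T (s r (Suc k)) - min T (s r k)))"
      using set_integral_step(2)[OF ip[of r] TT, where g="\<lambda>k. (?a j k)\<^sup>2"] unfolding set_lebesgue_integral_def eqs .
    also have "\<dots> = (\<Sum>k<n r. (?a j k)\<^sup>2 * (s r (Suc k) - s r k))"
      using s_bounds[of _ r] by (intro sum.cong refl) (auto simp: min_absorb2)
    finally show "(\<integral>u. (f j u)\<^sup>2 \<partial>lborel) = (\<Sum>k<n r. (?a j k)\<^sup>2 * (s r (Suc k) - s r k))" .
  qed
  have g_sq: "(g j u)\<^sup>2 = indicator {0..T} u *\<^sub>R (?st u - U u w)\<^sup>2 * (c j)\<^sup>2" for j u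
    by (auto simp: g_def power_mult_distrib indicator_def)
  have g_int: "integrable lborel (\<lambda>u. (g j u)\<^sup>2)"
    "(\<integral>u. (g j u)\<^sup>2 \<partial>lborel) = (LBINT u:{0..T}. (?st u - U u w)\<^sup>2) * (c j)\<^sup>2" for j
    using step_approximation_L2(2)[OF fp U, of r] unfolding g_sq set_integrable_def set_lebesgue_integral_def
    by (auto simp del: sum_mult_indicator)
  have fm: "f j \<in> borel_measurable lborel" for j
    unfolding f_def[abs_def] by (simp del: sum_mult_indicator, measurable)
  have Um: "(\<lambda>u. indicator {0..T} u *\<^sub>R U u w) \<in> borel_measurable lborel"
    using borel_measurable_continuous_on_indicator[OF _ U] by auto
  have g_eq: "g j = (\<lambda>u. (indicator {0..T} u * ?st u - indicator {0..T} u *\<^sub>R U u w) * c j)" for j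
    by (simp add: g_def indicator_def fun_eq_iff)
  have gm: "g j \<in> borel_measurable lborel" for j
    unfolding g_eq
    by (intro borel_measurable_times borel_measurable_diff Um borel_measurable_sum borel_measurable_const) simp_all
  have fg: "(f j u + g j u)\<^sup>2 = indicator {0..T} u *\<^sub>R (elementary_value (n r) (s r) (\<Phi> r) j u w - U u w * c j)\<^sup>2" for j u
  proof (cases "u \<in> {0..T}")
    case True
    then show ?thesis by (simp add: f_ev g_def algebra_simps del: sum_mult_indicator)
  next
    case False
    then have "(f j u)\<^sup>2 = 0" using f_supp[of j u] by simp
    then show ?thesis using False by (simp add: g_def)
  qed
  note fg_int = integrable_square_add(1)[OF fm gm f_int(1) g_int(1)]
  have "Q r w = (\<Sum>j=1..m. \<integral>u. (f j u)\<^sup>2 \<partial>lborel)"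
    unfolding Q_def err_def f_int(2) sum_distrib_right by (rule sum.swap)
  also have "\<dots> \<le> (\<Sum>j=1..m. 2 * (\<integral>u. (f j u + g j u)\<^sup>2 \<partial>lborel) + 2 * (\<integral>u. (g j u)\<^sup>2 \<partial>lborel))"
    by (intro sum_mono integral_square_le_shifted fm gm f_int g_int)
  also have "\<dots> = 2 * (\<Sum>j=1..m. \<integral>u. (f j u + g j u)\<^sup>2 \<partial>lborel) + 2 * (LBINT u:{0..T}. (?st u - U u w)\<^sup>2) * (\<Sum>j=1..m. (c j)\<^sup>2)"
    unfolding g_int(2) sum.distrib sum_distrib_left[symmetric] by (simp only: mult.assoc)
  also have "(\<Sum>j=1..m. \<integral>u. (f j u + g j u)\<^sup>2 \<partial>lborel) = (\<integral>u. (\<Sum>j=1..m. (f j u + g j u)\<^sup>2) \<partial>lborel)"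
    using fg_int by (intro Bochner_Integration.integral_sum[symmetric])
  also have "\<dots> = (LBINT u:{0..T}. (\<Sum>j=1..m. (elementary_value (n r) (s r) (\<Phi> r) j u w - U u w * c j)\<^sup>2))"
    unfolding set_lebesgue_integral_def fg scaleR_sum_right ..
  finally show ?thesis .
qed

lemma Q_tendsto: "tendsto_in_prob M Q (\<lambda>_. 0)"
proof -
  interpret C: prob_space "completion M" by (rule prob_space_completion)
  let ?I2 = "\<lambda>r w. LBINT u:{0..T}. ((\<Sum>k<n r. U (s r k) w * indicator {s r k<..s r (Suc k)} u) - U u w)\<^sup>2"
  have "tendsto_in_prob (completion M) ?I2 (\<lambda>_. 0)"
    by (rule step_error_tendsto_in_prob[OF T_pos fp U_M AE_U_continuous])
  then have "tendsto_in_prob (completion M) (\<lambda>r w. ?I2 r w * (\<Sum>j=1..m. (c j)\<^sup>2)) (\<lambda>_. 0)"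
    by (rule C.tendsto_in_prob_zero_mult)
  from C.tendsto_in_prob_add[OF L2 this] have lim: "tendsto_in_prob (completion M)
     (\<lambda>r w. (LBINT u:{0..T}. (\<Sum>j=1..m. (elementary_value (n r) (s r) (\<Phi> r) j u w - U u w * c j)\<^sup>2)) + ?I2 r w * (\<Sum>j=1..m. (c j)\<^sup>2)) (\<lambda>_. 0)"
    by simp
  have "tendsto_in_prob (completion M) Q (\<lambda>_. 0)"
  proof (rule C.tendsto_in_prob_zero_squeeze[OF lim, where a=2])
    show "Q r \<in> borel_measurable (completion M)" for r by (rule measurable_completion[OF Q_M])
    show "AE w in completion M. \<bar>Q r w\<bar> \<le> 2 * ((LBINT u:{0..T}. (\<Sum>j=1..m. (elementary_value (n r) (s r) (\<Phi> r) j u w - U u w * c j)\<^sup>2)) + ?I2 r w * (\<Sum>j=1..m. (c j)\<^sup>2))" for r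
      using AE_completion[OF AE_U_continuous]
    proof eventually_elim
      case (elim w)
      have "0 \<le> Q r w" unfolding Q_def by (intro sum_nonneg err_nonneg) auto
      then show ?case using Q_le[OF elim, of r] by (simp only: distrib_left mult.assoc abs_of_nonneg)
    qed
  qed simp
  then show ?thesis using tendsto_in_prob_completion_iff[of Q M "\<lambda>_. 0"] Q_M by simp
qed

text \<open>The discretised equation for \<open>D\<close>: the initial values cancel, the drift is a
  left Riemann sum, and the stochastic part is the difference of the elementary integrals for
  \<open>U\<close> and for \<open>V\<close>.\<close>

definition H :: "nat \<Rightarrow> real \<Rightarrow> 'w \<Rightarrow> real" where
  "H r t w = (\<Sum>k<n r. D (s r k) w * \<mu> * dt r t k)
    + (\<Sum>k<n r. \<Sum>j=1..m. (\<Phi> r k j w - V (s r k) w * c j) * incr (min t (s r k)) (min t (s r (Suc k))) w j)"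

text \<open>The elementary integrals for \<open>U\<close> converge by assumption, those for
  \<open>V\<close> by \<open>ito_sum_gbm\<close> along the same partitions, and the drift sums
  pathwise. The last two are where the vanishing mesh is used.\<close>

lemma H_tendsto:
  assumes t: "t \<in> {0..T}"
  shows "tendsto_in_prob M (\<lambda>r. H r t) (D t)"
proof -
  interpret C: prob_space "completion M" by (rule prob_space_completion)
  let ?I = "\<lambda>r. elementary_integral m W (n r) (s r) (\<Phi> r) t"
  let ?J = "\<lambda>r. elementary_integral m W (n r) (s r) (\<lambda>k j w. V (s r k) w * c j) t"
  let ?R = "\<lambda>r w. \<Sum>k<n r. D (s r k) w * \<mu> * dt r t k"
  have VM: "(\<lambda>w. V u w * \<mu>) \<in> borel_measurable M" "(\<lambda>w. D u w * \<mu>) \<in> borel_measurable M" if "u \<in> {0..T}" for u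
    using that by (auto intro!: borel_measurable_times gbm_measurable D_M)
  have aeV: "AE w in M. left_regular T (\<lambda>u. V u w * \<mu>)"
    using AE_gbm_continuous[of v0 \<mu> c] by eventually_elim (intro left_regular_continuous continuous_intros)
  have aeD: "AE w in M. left_regular T (\<lambda>u. D u w * \<mu>)"
    using AE_D_continuous by eventually_elim (intro left_regular_continuous continuous_intros)
  from set_integral_measurable_version(2)[OF T_pos t VM(1) aeV] obtain I
    where I: "I \<in> borel_measurable M" "AE w in M. (LBINT u:{0..t}. V u w * \<mu>) = I w" by auto
  from set_integral_measurable_version(2)[OF T_pos t VM(2) aeD] obtain I'
    where I': "I' \<in> borel_measurable M" "AE w in M. (LBINT u:{0..t}. D u w * \<mu>) = I' w" by auto
  let ?X' = "\<lambda>w. V t w - v0 - I w"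
  have X': "?X' \<in> borel_measurable M" using I t by (auto intro!: borel_measurable_diff gbm_measurable)
  have J: "tendsto_in_prob M ?J ?X'"
    using I(2) by (intro ito_sum_gbm[OF c_pos fp t X'], eventually_elim) simp
  have R: "tendsto_in_prob M ?R I'"
  proof (rule AE_imp_tendsto_in_prob[OF _ I'(1)])
    show "?R r \<in> borel_measurable M" for r
      using s_bounds by (intro borel_measurable_sum borel_measurable_times D_M) auto
    show "AE w in M. (\<lambda>r. ?R r w) \<longlonglongrightarrow> I' w"
      using I'(2) AE_D_continuous
    proof eventually_elim
      case (elim w)
      show ?case unfolding elim(1)[symmetric]
        using elim(2) by (intro riemann_sum_continuous[OF fp t] continuous_intros)
    qed
  qed
  have "tendsto_in_prob (completion M) (\<lambda>r w. ?R r w - ?J r w) (\<lambda>w. I' w - ?X' w)"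
    by (rule tendsto_in_prob_completion[OF tendsto_in_prob_diff[OF R J]])
  from C.tendsto_in_prob_add[OF this conv[OF t]]
  have lim: "tendsto_in_prob (completion M) (\<lambda>r w. ?R r w - ?J r w + ?I r w) (\<lambda>w. I' w - ?X' w + X t w)" .
  have H_eq: "?R r w - ?J r w + ?I r w = H r t w" for r w
  proof -
    have "?I r w - ?J r w = (\<Sum>j=1..m. \<Sum>k<n r. (\<Phi> r k j w - V (s r k) w * c j) * incr (min t (s r k)) (min t (s r (Suc k))) w j)"
      unfolding elementary_integral_def sum_subtractf[symmetric] left_diff_distrib[symmetric]
      by (intro sum.cong refl) (simp add: incr_def)
    also have "\<dots> = (\<Sum>k<n r. \<Sum>j=1..m. (\<Phi> r k j w - V (s r k) w * c j) * incr (min t (s r k)) (min t (s r (Suc k))) w j)"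
      by (rule sum.swap)
    finally show ?thesis by (simp add: H_def)
  qed
  have HM: "H r t \<in> borel_measurable M" for r
    unfolding H_eq[symmetric]
    by (intro borel_measurable_add borel_measurable_diff tendsto_in_probD(1)[OF R] tendsto_in_probD(1)[OF J] elementary_integral_measurable[OF ip t] F_s_measurable[OF _ \<Phi>_F]) auto
  have "AE w in M. I' w - ?X' w + X t w = D t w"
    using I(2) I'(2) eq AE_U_continuous AE_gbm_continuous[of v0 \<mu> c]
  proof eventually_elim
    case (elim w)
    have si: "set_integrable lborel {0..t} (\<lambda>u. U u w * \<mu>)" "set_integrable lborel {0..t} (\<lambda>u. V u w * \<mu>)"
      using t by (auto intro!: borel_integrable_atLeastAtMost' continuous_intros continuous_on_subset[OF elim(4)] continuous_on_subset[OF elim(5)])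
    have "(LBINT u:{0..t}. D u w * \<mu>) = (LBINT u:{0..t}. U u w * \<mu>) - (LBINT u:{0..t}. V u w * \<mu>)"
      unfolding D_def left_diff_distrib using si by (rule set_integral_diff)
    moreover have "U t w = v0 + (LBINT u:{0..t}. U u w * \<mu>) + X t w" using elim(3) t by blast
    ultimately show ?case using elim(1,2) by (simp add: D_def)
  qed
  then have "tendsto_in_prob (completion M) (\<lambda>r. H r t) (D t)"
    by (intro tendsto_in_prob_AE_cong[OF lim] measurable_completion[OF HM] measurable_completion[OF D_M[OF t]] AE_completion)
      (simp_all only: H_eq AE_I2)
  then show ?thesis using tendsto_in_prob_completion_iff[of "\<lambda>r. H r t" M "D t"] HM D_M[OF t] by blast
qed

end

section \<open>Localized second moment estimates\<close>

lemma weighted_sum_square_le: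
  fixes x w :: "nat \<Rightarrow> real"
  assumes "\<And>k. k < n \<Longrightarrow> 0 \<le> w k"
  shows "(\<Sum>k<n. x k * w k)\<^sup>2 \<le> (\<Sum>k<n. w k) * (\<Sum>k<n. (x k)\<^sup>2 * w k)"
proof -
  have "(\<Sum>k<n. sqrt (w k) * (x k * sqrt (w k)))\<^sup>2 \<le> (\<Sum>k<n. (sqrt (w k))\<^sup>2) * (\<Sum>k<n. (x k * sqrt (w k))\<^sup>2)"
    by (rule Cauchy_Schwarz_ineq_sum)
  moreover have "(\<Sum>k<n. sqrt (w k) * (x k * sqrt (w k))) = (\<Sum>k<n. x k * w k)"
    using assms by (intro sum.cong) (auto simp: algebra_simps)
  moreover have "(\<Sum>k<n. (sqrt (w k))\<^sup>2) = (\<Sum>k<n. w k)" using assms by (intro sum.cong) auto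
  moreover have "(\<Sum>k<n. (x k * sqrt (w k))\<^sup>2) = (\<Sum>k<n. (x k)\<^sup>2 * w k)"
    using assms by (intro sum.cong) (auto simp: power_mult_distrib)
  ultimately show ?thesis by simp
qed

context sde_solution_component
begin

text \<open>Tested only at countably many times, so that the event belongs to \<open>F t\<close>
  itself; \<open>t\<close> is added because it need not be a grid point. For continuous paths the
  test amounts to \<open>\<bar>D\<bar> \<le> R\<close> on all of \<open>{0..t}\<close>.\<close>

definition G :: "real \<Rightarrow> real \<Rightarrow> 'w set" where
  "G R t = {w \<in> space M. \<forall>q\<in>insert t (grid T \<inter> {0..t}). \<bar>D q w\<bar> \<le> R}"

lemma G_F:
  assumes t: "t \<in> {0..T}" shows "G R t \<in> sets (F t)"
proof -
  have "{w \<in> space (F t). \<forall>q\<in>insert t (grid T \<inter> {0..t}). \<bar>D q w\<bar> \<le> R} \<in> sets (F t)"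
  proof (rule sets.sets_Collect_countable_All')
    show "countable (insert t (grid T \<inter> {0..t}))" using countable_grid by auto
    fix q assume "q \<in> insert t (grid T \<inter> {0..t})"
    then have "q \<in> {0..T}" "q \<le> t" using t by auto
    then have "D q \<in> borel_measurable (F t)" using D_F[of q] by (auto intro: F_measurable_mono)
    then show "{w \<in> space (F t). \<bar>D q w\<bar> \<le> R} \<in> sets (F t)" by measurable
  qed
  then show ?thesis by (simp add: G_def)
qed

lemma G_M: "t \<in> {0..T} \<Longrightarrow> G R t \<in> events"
  using G_F[of t] sets_F_le[of t] by auto

lemma G_bound: "w \<in> G R t \<Longrightarrow> \<bar>D t w\<bar> \<le> R"
  by (simp add: G_def)

text \<open>Continuity is used at \<open>u\<close> itself, which may lie off the grid and is then
  not among the times tested by \<open>G R t\<close>.\<close>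

lemma G_antimono:
  assumes D: "continuous_on {0..T} (\<lambda>t. D t w)" and w: "w \<in> G R t" and u: "0 \<le> u" "u \<le> t" "t \<le> T"
  shows "w \<in> G R u"
proof -
  have "\<bar>D u w\<bar> \<le> R"
    by (rule bounded_on_grid[OF T_pos D, of t]) (use u w in \<open>auto simp: G_def\<close>)
  then show ?thesis using w u by (auto simp: G_def)
qed

text \<open>The error is summed up to and including cell \<open>k\<close>: the integrand on that cell, hence the sum, is already
  known at its left end.\<close>

definition A :: "real \<Rightarrow> real \<Rightarrow> nat \<Rightarrow> nat \<Rightarrow> 'w set" where
  "A R \<delta> r k = G R (s r k) \<inter> {w \<in> space M. (\<Sum>l\<le>k. err r l w) \<le> \<delta>}"

lemma A_F:
  assumes k: "k < n r" shows "A R \<delta> r k \<in> sets (F (s r k))"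
proof -
  have "(\<lambda>w. \<Sum>l\<le>k. err r l w) \<in> borel_measurable (F (s r k))"
  proof (intro borel_measurable_sum)
    fix l assume "l \<in> {..k}"
    then show "err r l \<in> borel_measurable (F (s r k))"
      using k is_partition_mono[OF ip, of l k r] by (intro F_measurable_mono[OF _ err_F]) auto
  qed
  then have "{w \<in> space (F (s r k)). (\<Sum>l\<le>k. err r l w) \<le> \<delta>} \<in> sets (F (s r k))" by measurable
  moreover have "G R (s r k) \<in> sets (F (s r k))" using k by (intro G_F s_bounds) auto
  ultimately show ?thesis unfolding A_def by (simp add: sets.Int)
qed

definition \<phi> :: "real \<Rightarrow> real \<Rightarrow> real" where
  "\<phi> R t = expectation (\<lambda>w. indicator (G R t) w * (D t w)\<^sup>2)"

text \<open>\<open>drift\<close> and \<open>noise\<close> are the two parts of \<open>H\<close> with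
  every coefficient cut off on \<open>A\<close>, which gives them finite second moments.\<close>

definition drift :: "real \<Rightarrow> real \<Rightarrow> nat \<Rightarrow> real \<Rightarrow> 'w \<Rightarrow> real" where
  "drift R \<delta> r t w = (\<Sum>k<n r. (indicator (A R \<delta> r k) w * (D (s r k) w * \<mu>)) * dt r t k)"

text \<open>Beyond \<open>t\<close> the coefficient would be known only later than the truncated
  node \<open>min t (s r k)\<close>, at which the isometry requires it. Setting it to
  \<open>0\<close> loses nothing, because the increment vanishes there.\<close>

definition \<Theta> :: "real \<Rightarrow> real \<Rightarrow> nat \<Rightarrow> real \<Rightarrow> nat \<Rightarrow> nat \<Rightarrow> 'w \<Rightarrow> real" where
  "\<Theta> R \<delta> r t k j w = (if s r k < t then indicator (A R \<delta> r k) w * (\<Phi> r k j w - V (s r k) w * c j) else 0)"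

definition noise :: "real \<Rightarrow> real \<Rightarrow> nat \<Rightarrow> real \<Rightarrow> 'w \<Rightarrow> real" where
  "noise R \<delta> r t w = (\<Sum>k<n r. \<Sum>j=1..m. \<Theta> R \<delta> r t k j w * incr (min t (s r k)) (min t (s r (Suc k))) w j)"

abbreviation S where "S \<equiv> \<Sum>j=1..m. (c j)\<^sup>2"

abbreviation riemann_\<phi> :: "real \<Rightarrow> nat \<Rightarrow> real \<Rightarrow> real" where
  "riemann_\<phi> R r t \<equiv> \<Sum>k<n r. \<phi> R (s r k) * dt r t k"

lemma G_square_bound: "indicator (G R t) w * (D t w)\<^sup>2 \<le> R\<^sup>2"
  using square_le_of_abs_le[OF G_bound[of w R t]] by (auto simp: indicator_def)

lemma G_square_integrable: "t \<in> {0..T} \<Longrightarrow> integrable M (\<lambda>w. indicator (G R t) w * (D t w)\<^sup>2)"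
  using G_square_bound[of R t] G_M[of t R] D_M[of t]
  by (intro integrable_const_bound[where B="R\<^sup>2"]) auto

lemma drift_measurable: "drift R \<delta> r t \<in> borel_measurable M"
  unfolding drift_def[abs_def]
proof (intro borel_measurable_sum borel_measurable_times borel_measurable_const D_M s_bounds)
  fix k assume "k \<in> {..<n r}"
  then show "indicat_real (A R \<delta> r k) \<in> borel_measurable M"
    using A_F[of k r R \<delta>] by (intro F_s_measurable[of k r]) auto
qed auto

text \<open>Cauchy-Schwarz with the weights \<open>dt r t k\<close>, whose sum \<open>t\<close> is
  at most \<open>T\<close>. Then \<open>A\<close> is enlarged to \<open>G\<close>, so that taking
  expectations produces \<open>\<phi>\<close>.\<close>

lemma drift_square_le:
  assumes t: "t \<in> {0..T}"
  shows "(drift R \<delta> r t w)\<^sup>2 \<le> T * \<mu>\<^sup>2 * (\<Sum>k<n r. (indicator (G R (s r k)) w * (D (s r k) w)\<^sup>2) * dt r t k)"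
proof -
  let ?x = "\<lambda>k. indicator (A R \<delta> r k) w * (D (s r k) w * \<mu>)"
  have w: "0 \<le> dt r t k" if "k < n r" for k using is_partition_min(2)[OF ip t that] by simp
  have "(drift R \<delta> r t w)\<^sup>2 \<le> (\<Sum>k<n r. dt r t k) * (\<Sum>k<n r. (?x k)\<^sup>2 * dt r t k)"
    unfolding drift_def using w by (rule weighted_sum_square_le)
  also have "\<dots> = t * (\<Sum>k<n r. (?x k)\<^sup>2 * dt r t k)" using sum_cell_length[OF ip t] by simp
  also have "\<dots> \<le> T * (\<Sum>k<n r. (?x k)\<^sup>2 * dt r t k)"
    using t w by (intro mult_right_mono sum_nonneg mult_nonneg_nonneg) auto
  also have "\<dots> \<le> T * (\<Sum>k<n r. (\<mu>\<^sup>2 * (indicator (G R (s r k)) w * (D (s r k) w)\<^sup>2)) * dt r t k)"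
    using w T_pos by (intro mult_left_mono sum_mono mult_right_mono) (auto simp: indicator_def A_def power_mult_distrib)
  also have "\<dots> = T * \<mu>\<^sup>2 * (\<Sum>k<n r. (indicator (G R (s r k)) w * (D (s r k) w)\<^sup>2) * dt r t k)"
    by (simp only: sum_distrib_left mult.assoc)
  finally show ?thesis .
qed

lemma drift_second_moment:
  assumes t: "t \<in> {0..T}"
  shows "integrable M (\<lambda>w. (drift R \<delta> r t w)\<^sup>2)"
    "expectation (\<lambda>w. (drift R \<delta> r t w)\<^sup>2) \<le> T * \<mu>\<^sup>2 * riemann_\<phi> R r t"
proof -
  let ?b = "\<lambda>w. T * \<mu>\<^sup>2 * (\<Sum>k<n r. (indicator (G R (s r k)) w * (D (s r k) w)\<^sup>2) * dt r t k)"
  have gi: "integrable M (\<lambda>w. indicator (G R (s r k)) w * (D (s r k) w)\<^sup>2)" if "k < n r" for k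
    using that by (intro G_square_integrable s_bounds) auto
  have b: "integrable M ?b"
    using gi by (intro integrable_mult_right Bochner_Integration.integrable_sum integrable_mult_left) auto
  show i: "integrable M (\<lambda>w. (drift R \<delta> r t w)\<^sup>2)"
  proof (rule Bochner_Integration.integrable_bound[OF b])
    show "(\<lambda>w. (drift R \<delta> r t w)\<^sup>2) \<in> borel_measurable M" using drift_measurable by measurable
    show "AE w in M. norm ((drift R \<delta> r t w)\<^sup>2) \<le> norm (?b w)"
      unfolding real_norm_def abs_power2
      by (intro AE_I2 order_trans[OF drift_square_le[OF t] abs_ge_self])
  qed
  have "expectation (\<lambda>w. (drift R \<delta> r t w)\<^sup>2) \<le> expectation ?b"
    using i b drift_square_le[OF t] by (rule integral_mono)
  also have "\<dots> = T * \<mu>\<^sup>2 * riemann_\<phi> R r t"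
    using gi by (simp add: \<phi>_def Bochner_Integration.integral_sum)
  finally show "expectation (\<lambda>w. (drift R \<delta> r t w)\<^sup>2) \<le> T * \<mu>\<^sup>2 * riemann_\<phi> R r t" .
qed

text \<open>The coefficient minus \<open>V c\<close> is the approximation error against
  \<open>U c\<close> plus \<open>D c\<close>; the first part is controlled by
  \<open>\<delta>\<close>, the second leads back to \<open>\<phi>\<close>.\<close>

lemma \<Theta>_square_le:
  assumes k: "k < n r"
  shows "(\<Theta> R \<delta> r t k j w)\<^sup>2 \<le> indicator (A R \<delta> r k) w * (2 * (\<Phi> r k j w - U (s r k) w * c j)\<^sup>2 + 2 * ((D (s r k) w)\<^sup>2 * (c j)\<^sup>2))"
proof -
  have "(x + y)\<^sup>2 \<le> 2 * x\<^sup>2 + 2 * y\<^sup>2" for x y :: real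
    using zero_le_power2[of "x - y"] by (simp add: power2_eq_square algebra_simps)
  from this[of "\<Phi> r k j w - U (s r k) w * c j" "D (s r k) w * c j"]
  have "(\<Phi> r k j w - V (s r k) w * c j)\<^sup>2 \<le> 2 * (\<Phi> r k j w - U (s r k) w * c j)\<^sup>2 + 2 * ((D (s r k) w)\<^sup>2 * (c j)\<^sup>2)"
    by (simp add: D_def algebra_simps power_mult_distrib[symmetric])
  then show ?thesis by (auto simp: \<Theta>_def indicator_def)
qed

lemma err_le_on_A:
  assumes k: "k < n r" and w: "w \<in> A R \<delta> r k"
  shows "err r k w \<le> \<delta>"
proof -
  have "err r k w \<le> (\<Sum>l\<le>k. err r l w)"
    by (rule member_le_sum) (use k in \<open>auto intro: err_nonneg\<close>)
  then show ?thesis using w by (auto simp: A_def)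
qed

text \<open>A crude bound that depends on the cell and serves integrability only: on
  \<open>A\<close> the error of the cell is at most \<open>\<delta>\<close>, and dividing by its
  length bounds the coefficient.\<close>

lemma \<Theta>_bound:
  assumes k: "k < n r" and j: "j \<in> {1..m}" and \<delta>: "0 < \<delta>"
  shows "(\<Theta> R \<delta> r t k j w)\<^sup>2 \<le> 2 * (\<delta> / (s r (Suc k) - s r k)) + 2 * (R\<^sup>2 * (c j)\<^sup>2)"
proof (cases "w \<in> A R \<delta> r k")
  case True
  have pos: "0 < s r (Suc k) - s r k" using ip[of r] k by (simp add: is_partition_def)
  have "(\<Phi> r k j w - U (s r k) w * c j)\<^sup>2 * (s r (Suc k) - s r k) \<le> err r k w"
    unfolding err_def using j pos
    by (intro mult_right_mono member_le_sum[of j "{1..m}" "\<lambda>j. (\<Phi> r k j w - U (s r k) w * c j)\<^sup>2"]) auto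
  also have "\<dots> \<le> \<delta>" by (rule err_le_on_A[OF k True])
  finally have "(\<Phi> r k j w - U (s r k) w * c j)\<^sup>2 \<le> \<delta> / (s r (Suc k) - s r k)"
    using pos by (simp add: pos_le_divide_eq)
  moreover have "(D (s r k) w)\<^sup>2 * (c j)\<^sup>2 \<le> R\<^sup>2 * (c j)\<^sup>2"
    using True by (intro mult_right_mono square_le_of_abs_le G_bound) (auto simp: A_def)
  ultimately show ?thesis using \<Theta>_square_le[OF k, of R \<delta> t j w] True by simp
next
  case False
  have "0 < s r (Suc k) - s r k" using ip[of r] k by (simp add: is_partition_def)
  then show ?thesis using False \<delta> by (simp add: \<Theta>_def)
qed

lemma \<Theta>_F:
  assumes k: "k < n r" and j: "j \<in> {1..m}"
  shows "\<Theta> R \<delta> r t k j \<in> borel_measurable (F (min t (s r k)))"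
proof (cases "s r k < t")
  case True
  have V: "V (s r k) \<in> borel_measurable (F (s r k))" using s_bounds[of k r] k by (intro gbm_adapted) auto
  have "(\<lambda>w. indicator (A R \<delta> r k) w * (\<Phi> r k j w - V (s r k) w * c j)) \<in> borel_measurable (F (s r k))"
    using A_F[OF k, of R \<delta>] by (intro borel_measurable_times borel_measurable_diff \<Phi>_F[OF k j] V) auto
  then show ?thesis using True by (simp add: \<Theta>_def[abs_def] min_def)
qed (simp add: \<Theta>_def[abs_def])

lemma \<Theta>_square_integrable:
  assumes "k < n r" "j \<in> {1..m}" "0 < \<delta>" "t \<in> {0..T}"
  shows "integrable M (\<lambda>w. (\<Theta> R \<delta> r t k j w)\<^sup>2)"
proof (rule integrable_const_bound)
  show "AE w in M. norm ((\<Theta> R \<delta> r t k j w)\<^sup>2) \<le> 2 * (\<delta> / (s r (Suc k) - s r k)) + 2 * (R\<^sup>2 * (c j)\<^sup>2)"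
    using \<Theta>_bound[OF assms(1-3)] by (intro AE_I2) simp
  have "\<Theta> R \<delta> r t k j \<in> borel_measurable M"
    by (rule F_measurable[OF _ \<Theta>_F[OF assms(1,2)]]) (use assms(4) in auto)
  then show "(\<lambda>w. (\<Theta> R \<delta> r t k j w)\<^sup>2) \<in> borel_measurable M" by measurable
qed

text \<open>A pathwise estimate. The errors kept by the cut-off add up to at most
  \<open>\<delta>\<close> by \<open>sum_truncated_le\<close>, uniformly in \<open>r\<close>.\<close>

lemma \<Theta>_sum_le:
  assumes t: "t \<in> {0..T}" and \<delta>: "0 < \<delta>"
  shows "(\<Sum>k<n r. (\<Sum>j=1..m. (\<Theta> R \<delta> r t k j w)\<^sup>2) * dt r t k)
    \<le> 2 * \<delta> + 2 * S * (\<Sum>k<n r. (indicator (G R (s r k)) w * (D (s r k) w)\<^sup>2) * dt r t k)"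
proof -
  let ?g = "\<lambda>k. indicator (G R (s r k)) w * (D (s r k) w)\<^sup>2"
  have "(\<Sum>j=1..m. (\<Theta> R \<delta> r t k j w)\<^sup>2) * dt r t k \<le> 2 * (if (\<Sum>l\<le>k. err r l w) \<le> \<delta> then err r k w else 0) + 2 * S * (?g k * dt r t k)"
    if k: "k < n r" for k
  proof (cases "w \<in> A R \<delta> r k")
    case False
    then have "\<Theta> R \<delta> r t k j w = 0" for j by (simp add: \<Theta>_def)
    then show ?thesis using err_nonneg[OF k, of w] is_partition_min(2)[OF ip t k] by (simp add: sum_nonneg)
  next
    case True
    note mi = is_partition_min(2,4)[OF ip t k]
    have "(\<Sum>j=1..m. (\<Theta> R \<delta> r t k j w)\<^sup>2) \<le> (\<Sum>j=1..m. 2 * (\<Phi> r k j w - U (s r k) w * c j)\<^sup>2 + 2 * ((D (s r k) w)\<^sup>2 * (c j)\<^sup>2))"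
      using \<Theta>_square_le[OF k, of R \<delta> t _ w] True by (intro sum_mono) auto
    also have "\<dots> = 2 * (\<Sum>j=1..m. (\<Phi> r k j w - U (s r k) w * c j)\<^sup>2) + 2 * S * (D (s r k) w)\<^sup>2"
      by (simp add: sum.distrib sum_distrib_left sum_distrib_right mult_ac)
    finally have "(\<Sum>j=1..m. (\<Theta> R \<delta> r t k j w)\<^sup>2) * dt r t k \<le> (2 * (\<Sum>j=1..m. (\<Phi> r k j w - U (s r k) w * c j)\<^sup>2) + 2 * S * (D (s r k) w)\<^sup>2) * dt r t k"
      using mi by (intro mult_right_mono) auto
    also have "\<dots> = 2 * ((\<Sum>j=1..m. (\<Phi> r k j w - U (s r k) w * c j)\<^sup>2) * dt r t k) + 2 * S * ((D (s r k) w)\<^sup>2 * dt r t k)"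
      by (simp add: algebra_simps)
    \<comment> \<open>The truncated length \<open>dt r t k\<close> is at most the full cell length
      that enters \<open>err\<close>.\<close>
    also have "\<dots> \<le> 2 * err r k w + 2 * S * ((D (s r k) w)\<^sup>2 * dt r t k)"
      unfolding err_def using mi by (intro add_right_mono mult_left_mono) (auto intro: sum_nonneg)
    finally show ?thesis using True by (simp add: A_def)
  qed
  then have "(\<Sum>k<n r. (\<Sum>j=1..m. (\<Theta> R \<delta> r t k j w)\<^sup>2) * dt r t k)
     \<le> (\<Sum>k<n r. 2 * (if (\<Sum>l\<le>k. err r l w) \<le> \<delta> then err r k w else 0) + 2 * S * (?g k * dt r t k))"
    by (intro sum_mono) auto
  also have "\<dots> = 2 * (\<Sum>k<n r. if (\<Sum>l\<le>k. err r l w) \<le> \<delta> then err r k w else 0) + 2 * S * (\<Sum>k<n r. ?g k * dt r t k)"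
    by (simp only: sum.distrib sum_distrib_left)
  also have "\<dots> \<le> 2 * \<delta> + 2 * S * (\<Sum>k<n r. ?g k * dt r t k)"
    using \<delta> err_nonneg by (intro add_right_mono mult_left_mono sum_truncated_le) auto
  finally show ?thesis .
qed

lemma noise_second_moment:
  assumes t: "t \<in> {0..T}" and \<delta>: "0 < \<delta>"
  shows "integrable M (\<lambda>w. (noise R \<delta> r t w)\<^sup>2)"
    "expectation (\<lambda>w. (noise R \<delta> r t w)\<^sup>2) \<le> 2 * \<delta> + 2 * S * riemann_\<phi> R r t"
proof -
  let ?\<tau> = "\<lambda>k. min t (s r k)"
  have \<tau>: "0 \<le> ?\<tau> k \<and> ?\<tau> k \<le> ?\<tau> (Suc k) \<and> ?\<tau> (Suc k) \<le> T" if "k < n r" for k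
    using is_partition_min(1-3)[OF ip t that] by simp
  have hm: "(\<lambda>x. x j) \<in> borel_measurable (PiM {1..m} (\<lambda>_. borel :: real measure))" if "j \<in> {1..m}" for j
    using that by (rule measurable_component_singleton)
  have h1: "integrable M (\<lambda>w. (incr (?\<tau> k) (?\<tau> (Suc k)) w j)\<^sup>2)"
    "expectation (\<lambda>w. incr (?\<tau> k) (?\<tau> (Suc k)) w j) = 0" if "k < n r" "j \<in> {1..m}" for k j
    using incr_moments(2,3)[OF _ _ _ that(2)] \<tau>[OF that(1)] by auto
  have h2: "expectation (\<lambda>w. incr (?\<tau> k) (?\<tau> (Suc k)) w i * incr (?\<tau> k) (?\<tau> (Suc k)) w j) = (if i = j then dt r t k else 0)"
    if "k < n r" "i \<in> {1..m}" "j \<in> {1..m}" for k i j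
    using incr_moments(4)[OF _ _ _ that(2,3)] \<tau>[OF that(1)] by auto
  note iso = step_isometry[where \<Phi>="\<Theta> R \<delta> r t" and h="\<lambda>k j x. x j" and J="{1..m}" and \<tau>="?\<tau>" and v="dt r t" and n="n r",
      OF \<tau> finite_atLeastAtMost \<Theta>_F \<Theta>_square_integrable[OF _ _ \<delta> t] hm h1 h2]
  show "integrable M (\<lambda>w. (noise R \<delta> r t w)\<^sup>2)" unfolding noise_def by (rule iso(1))
  have gi: "integrable M (\<lambda>w. indicator (G R (s r k)) w * (D (s r k) w)\<^sup>2)" if "k < n r" for k
    using that by (intro G_square_integrable s_bounds) auto
  have si: "integrable M (\<lambda>w. (\<Sum>j=1..m. (\<Theta> R \<delta> r t k j w)\<^sup>2) * dt r t k)" if "k < n r" for k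
    using \<Theta>_square_integrable[OF that _ \<delta> t] by (intro integrable_mult_left Bochner_Integration.integrable_sum)
  have "expectation (\<lambda>w. (noise R \<delta> r t w)\<^sup>2) = (\<Sum>k<n r. (\<Sum>j=1..m. expectation (\<lambda>w. (\<Theta> R \<delta> r t k j w)\<^sup>2)) * dt r t k)"
    unfolding noise_def by (rule iso(2))
  also have "\<dots> = expectation (\<lambda>w. \<Sum>k<n r. (\<Sum>j=1..m. (\<Theta> R \<delta> r t k j w)\<^sup>2) * dt r t k)"
    using si \<Theta>_square_integrable[OF _ _ \<delta> t, of _ r _ R]
    by (subst Bochner_Integration.integral_sum) (auto intro!: sum.cong simp: Bochner_Integration.integral_sum)
  also have "\<dots> \<le> expectation (\<lambda>w. 2 * \<delta> + 2 * S * (\<Sum>k<n r. (indicator (G R (s r k)) w * (D (s r k) w)\<^sup>2) * dt r t k))"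
  proof (rule integral_mono[OF _ _ \<Theta>_sum_le[OF t \<delta>]])
    show "integrable M (\<lambda>w. \<Sum>k<n r. (\<Sum>j=1..m. (\<Theta> R \<delta> r t k j w)\<^sup>2) * dt r t k)"
      by (rule Bochner_Integration.integrable_sum, rule si, simp)
    show "integrable M (\<lambda>w. 2 * \<delta> + 2 * S * (\<Sum>k<n r. (indicator (G R (s r k)) w * (D (s r k) w)\<^sup>2) * dt r t k))"
      by (intro Bochner_Integration.integrable_add integrable_mult_right Bochner_Integration.integrable_sum integrable_mult_left gi) auto
  qed
  also have "\<dots> = 2 * \<delta> + 2 * S * riemann_\<phi> R r t"
  proof -
    let ?g = "\<lambda>w. \<Sum>k<n r. (indicator (G R (s r k)) w * (D (s r k) w)\<^sup>2) * dt r t k"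
    have "integrable M ?g"
      by (intro Bochner_Integration.integrable_sum integrable_mult_left gi) auto
    moreover have "expectation ?g = (\<Sum>k<n r. expectation (\<lambda>w. (indicator (G R (s r k)) w * (D (s r k) w)\<^sup>2) * dt r t k))"
      by (intro Bochner_Integration.integral_sum integrable_mult_left gi) auto
    then have "expectation ?g = riemann_\<phi> R r t"
      unfolding \<phi>_def integral_mult_left_zero .
    ultimately show ?thesis
      by (simp add: Bochner_Integration.integral_add prob_space del: sum_mult_indicator sum_indicator_mult)
  qed
  finally show "expectation (\<lambda>w. (noise R \<delta> r t w)\<^sup>2) \<le> 2 * \<delta> + 2 * S * riemann_\<phi> R r t" .
qed

text \<open>No cut-off is active here: a cell starting before \<open>t\<close> has accumulated error
  at most \<open>Q r w\<close>, and \<open>G\<close> decreases in time along a continuous path. The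
  remaining cells are degenerate and contribute \<open>0\<close>.\<close>

lemma H_eq_localized:
  assumes D: "continuous_on {0..T} (\<lambda>t. D t w)" and w: "w \<in> G R t" "Q r w \<le> \<delta>" and t: "t \<in> {0..T}"
  shows "H r t w = drift R \<delta> r t w + noise R \<delta> r t w"
proof -
  have inA: "w \<in> A R \<delta> r k" if k: "k < n r" "s r k < t" for k
  proof -
    have "(\<Sum>l\<le>k. err r l w) \<le> Q r w"
      unfolding Q_def by (rule sum_mono2) (use k in \<open>auto intro: err_nonneg\<close>)
    moreover have "w \<in> G R (s r k)"
      using s_bounds[of k r] k t by (intro G_antimono[OF D w(1)]) auto
    ultimately show ?thesis using w by (auto simp: A_def G_def)
  qed
  have frozen: "min t (s r k) = t" "min t (s r (Suc k)) = t" if "k < n r" "\<not> s r k < t" for k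
    using is_partition_mono[OF ip, of k "Suc k" r] that by auto
  have "D (s r k) w * \<mu> * dt r t k
      = (indicator (A R \<delta> r k) w * (D (s r k) w * \<mu>)) * dt r t k" if "k < n r" for k
    using inA[OF that] frozen[OF that] by (cases "s r k < t") auto
  moreover have "(\<Phi> r k j w - V (s r k) w * c j) * incr (min t (s r k)) (min t (s r (Suc k))) w j
      = \<Theta> R \<delta> r t k j w * incr (min t (s r k)) (min t (s r (Suc k))) w j" if "k < n r" "j \<in> {1..m}" for k j
    using inA[OF that(1)] frozen[OF that(1)] that(2) by (cases "s r k < t") (auto simp: \<Theta>_def incr_self)
  ultimately show ?thesis unfolding H_def drift_def noise_def by (intro arg_cong2[where f="(+)"] sum.cong refl) auto
qed

lemma noise_measurable: "t \<in> {0..T} \<Longrightarrow> noise R \<delta> r t \<in> borel_measurable M"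
  unfolding noise_def[abs_def]
proof (intro borel_measurable_sum borel_measurable_times)
  fix k j assume t: "t \<in> {0..T}" and k: "k \<in> {..<n r}" and j: "j \<in> {1..m}"
  show "\<Theta> R \<delta> r t k j \<in> borel_measurable M"
    using k j t by (intro F_measurable[OF _ \<Theta>_F]) auto
  have "incr (min t (s r k)) (min t (s r (Suc k))) \<in> measurable M (PiM {1..m} (\<lambda>_. borel))"
    using is_partition_min(1-3)[OF ip t, of k r] k by (intro incr_measurable) auto
  from measurable_compose[OF this measurable_component_singleton[OF j]]
  show "(\<lambda>w. incr (min t (s r k)) (min t (s r (Suc k))) w j) \<in> borel_measurable M" .
qed

text \<open>The constant is \<open>2\<close> (Fatou) times \<open>2\<close> (square of drift plus
  noise) times \<open>T * \<mu>\<^sup>2 + 2 * S\<close>. Bounding every Riemann sum by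
  \<open>B\<close> permits the limit in \<open>r\<close> without forming an integral of
  \<open>\<phi>\<close>.\<close>

lemma \<phi>_le:
  assumes t: "t \<in> {0..T}" and R: "0 \<le> R" and B: "\<And>r. riemann_\<phi> R r t \<le> B"
  shows "\<phi> R t \<le> (4 * (T * \<mu>\<^sup>2) + 8 * S) * B"
proof -
  \<comment> \<open>The \<open>8 * \<delta>\<close> is the \<open>2 * \<delta>\<close> of
    \<open>noise_second_moment\<close>, doubled by the square of a sum and doubled again by
    Fatou.\<close>
  have bound: "\<phi> R t \<le> (4 * (T * \<mu>\<^sup>2) + 8 * S) * B + 8 * \<delta>" if \<delta>: "0 < \<delta>" for \<delta>
  proof -
    let ?E = "\<lambda>r. G R t \<inter> {w \<in> space M. Q r w \<le> \<delta>}"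
    \<comment> \<open>The condition \<open>Q r w \<le> \<delta>\<close> fails with vanishing
      probability, so \<open>?Y\<close> still converges to \<open>D\<close> on \<open>G R t\<close>;
      where it holds, \<open>H\<close> may be replaced by the square integrable
      \<open>?Z\<close>.\<close>
    let ?Y = "\<lambda>r w. indicator (?E r) w * H r t w"
    let ?Z = "\<lambda>r w. drift R \<delta> r t w + noise R \<delta> r t w"
    note H = H_tendsto[OF t]
    have E[measurable]: "?E r \<in> events" for r
      using G_M[OF t] Q_M by measurable
    have GM[measurable]: "G R t \<in> events" by (rule G_M[OF t])
    have Ym: "?Y r \<in> borel_measurable M" for r
      using tendsto_in_probD(1)[OF H] E by measurable
    have Dm: "(\<lambda>w. indicator (G R t) w * D t w) \<in> borel_measurable M"
      using D_M[OF t] by measurable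
    note dn = drift_measurable[of R \<delta> _ t] noise_measurable[OF t, of R \<delta>]
      drift_second_moment(1)[OF t, of R \<delta>] noise_second_moment(1)[OF t \<delta>, of R]
    have Z_int: "integrable M (\<lambda>w. (?Z r w)\<^sup>2)" for r by (rule integrable_square_add(1)[OF dn])
    have Z_le: "expectation (\<lambda>w. (?Z r w)\<^sup>2) \<le> (2 * (T * \<mu>\<^sup>2) + 4 * S) * B + 4 * \<delta>" for r
    proof -
      have "expectation (\<lambda>w. (?Z r w)\<^sup>2) \<le> expectation (\<lambda>w. 2 * (drift R \<delta> r t w)\<^sup>2 + 2 * (noise R \<delta> r t w)\<^sup>2)"
      proof (rule integral_mono[OF Z_int])
        show "(?Z r w)\<^sup>2 \<le> 2 * (drift R \<delta> r t w)\<^sup>2 + 2 * (noise R \<delta> r t w)\<^sup>2" for w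
          using zero_le_power2[of "drift R \<delta> r t w - noise R \<delta> r t w"] by (simp add: power2_eq_square algebra_simps)
      qed (use dn in auto)
      also have "\<dots> = 2 * expectation (\<lambda>w. (drift R \<delta> r t w)\<^sup>2) + 2 * expectation (\<lambda>w. (noise R \<delta> r t w)\<^sup>2)"
        using dn by simp
      also have "\<dots> \<le> 2 * (T * \<mu>\<^sup>2 * riemann_\<phi> R r t) + 2 * (2 * \<delta> + 2 * S * riemann_\<phi> R r t)"
        by (intro add_mono mult_left_mono drift_second_moment(2)[OF t] noise_second_moment(2)[OF t \<delta>]) auto
      also have "\<dots> = (2 * (T * \<mu>\<^sup>2) + 4 * S) * riemann_\<phi> R r t + 4 * \<delta>"
        by (simp add: algebra_simps)
      also have "\<dots> \<le> (2 * (T * \<mu>\<^sup>2) + 4 * S) * B + 4 * \<delta>"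
        using T_pos c_pos by (intro add_right_mono mult_left_mono B) auto
      finally show ?thesis .
    qed
    have YZ: "AE w in M. (?Y r w)\<^sup>2 \<le> (?Z r w)\<^sup>2" for r
      using AE_D_continuous
    proof eventually_elim
      case (elim w)
      show ?case using H_eq_localized[OF elim _ _ t, of R r \<delta>] by (cases "w \<in> ?E r") auto
    qed
    have Y_int: "integrable M (\<lambda>w. (?Y r w)\<^sup>2)" for r
    proof (rule Bochner_Integration.integrable_bound[OF Z_int[of r]])
      show "(\<lambda>w. (?Y r w)\<^sup>2) \<in> borel_measurable M" using Ym by measurable
      show "AE w in M. norm ((?Y r w)\<^sup>2) \<le> norm ((?Z r w)\<^sup>2)"
        unfolding real_norm_def abs_power2 by (rule YZ)
    qed
    have "tendsto_in_prob M ?Y (\<lambda>w. indicator (G R t) w * D t w)"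
      unfolding tendsto_in_prob_def
    proof (intro conjI allI impI Ym Dm)
      fix \<epsilon> :: real assume \<epsilon>: "0 < \<epsilon>"
      let ?P = "\<lambda>r. {w \<in> space M. \<epsilon> < \<bar>H r t w - D t w\<bar>}" and ?N = "\<lambda>r. {w \<in> space M. \<delta> < \<bar>Q r w - 0\<bar>}"
      show "(\<lambda>r. prob {w \<in> space M. \<epsilon> < \<bar>?Y r w - indicator (G R t) w * D t w\<bar>}) \<longlonglongrightarrow> 0"
      proof (rule tendsto_sandwich[OF always_eventually always_eventually tendsto_const])
        show "(\<lambda>r. prob (?P r) + prob (?N r)) \<longlonglongrightarrow> 0"
          using tendsto_add[OF tendsto_in_probD(3)[OF H \<epsilon>] tendsto_in_probD(3)[OF Q_tendsto \<delta>]] by simp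
        have m: "?P r \<in> events" "?N r \<in> events" for r
          using tendsto_in_probD(1,2)[OF H] Q_M by measurable
        have "prob {w \<in> space M. \<epsilon> < \<bar>?Y r w - indicator (G R t) w * D t w\<bar>} \<le> prob (?P r \<union> ?N r)" for r
        proof (rule finite_measure_mono)
          show "{w \<in> space M. \<epsilon> < \<bar>?Y r w - indicator (G R t) w * D t w\<bar>} \<subseteq> ?P r \<union> ?N r"
          proof
            fix w assume w: "w \<in> {w \<in> space M. \<epsilon> < \<bar>?Y r w - indicator (G R t) w * D t w\<bar>}"
            then have "w \<in> G R t" using \<epsilon> by (cases "w \<in> G R t") auto
            then show "w \<in> ?P r \<union> ?N r" using w by (cases "Q r w \<le> \<delta>") auto
          qed
        qed (use m in auto)
        also have "\<dots> r \<le> prob (?P r) + prob (?N r)" for r by (rule measure_Un_le[OF m])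
        finally show "\<forall>r. prob {w \<in> space M. \<epsilon> < \<bar>?Y r w - indicator (G R t) w * D t w\<bar>} \<le> prob (?P r) + prob (?N r)" by blast
      qed simp
    qed
    then have "expectation (\<lambda>w. (indicator (G R t) w * D t w)\<^sup>2) \<le> 2 * ((2 * (T * \<mu>\<^sup>2) + 4 * S) * B + 4 * \<delta>)"
    proof (rule second_moment_le_of_tendsto_in_prob)
      show "\<bar>indicator (G R t) w * D t w\<bar> \<le> R" for w
        using G_bound[of w R t] R by (auto simp: indicator_def)
      have "expectation (\<lambda>w. (?Y r w)\<^sup>2) \<le> expectation (\<lambda>w. (?Z r w)\<^sup>2)" for r
        by (rule integral_mono_AE[OF Y_int Z_int YZ])
      then show "\<forall>\<^sub>F r in sequentially. expectation (\<lambda>w. (?Y r w)\<^sup>2) \<le> (2 * (T * \<mu>\<^sup>2) + 4 * S) * B + 4 * \<delta>"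
        using Z_le order_trans by (intro always_eventually allI) blast
    qed (rule Y_int)
    moreover have "(\<lambda>w. (indicator (G R t) w * D t w)\<^sup>2) = (\<lambda>w. indicator (G R t) w * (D t w)\<^sup>2)"
      by (simp add: indicator_def fun_eq_iff)
    ultimately have "\<phi> R t \<le> 2 * ((2 * (T * \<mu>\<^sup>2) + 4 * S) * B + 4 * \<delta>)" by (simp only: \<phi>_def)
    then show ?thesis by (simp add: algebra_simps)
  qed
  show ?thesis
  proof (rule field_le_epsilon)
    fix e :: real assume "0 < e"
    then show "\<phi> R t \<le> (4 * (T * \<mu>\<^sup>2) + 8 * S) * B + e" using bound[of "e / 8"] by simp
  qed
qed

section \<open>Iteration of the inequality and identification of the solution\<close>

lemma \<phi>_nonneg: "0 \<le> \<phi> R t"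
  unfolding \<phi>_def by (intro integral_nonneg_AE AE_I2) simp

text \<open>The bound \<open>R\<^sup>2\<close> built into \<open>G\<close> starts the iteration;
  each use of \<open>\<phi>_le\<close> gains the factor \<open>C * t / Suc p\<close> through the
  left Riemann sums of a monomial.\<close>

lemma \<phi>_power_bound:
  assumes R: "0 \<le> R"
  defines "C \<equiv> 4 * (T * \<mu>\<^sup>2) + 8 * S"
  shows "t \<in> {0..T} \<Longrightarrow> \<phi> R t \<le> R\<^sup>2 * ((C * t) ^ p / fact p)"
proof (induction p arbitrary: t)
  case 0
  have "\<phi> R t \<le> expectation (\<lambda>w. R\<^sup>2)"
    unfolding \<phi>_def using G_square_bound by (intro integral_mono G_square_integrable 0) auto
  then show ?case by (simp add: prob_space)
next
  case (Suc p)
  have C: "0 \<le> C" using T_pos c_pos by (simp add: C_def)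
  let ?K = "R\<^sup>2 * C ^ p / fact p"
  have K: "0 \<le> ?K" using C by simp
  have "\<phi> R t \<le> C * (?K * (t ^ Suc p / real (Suc p)))"
  proof (rule \<phi>_le[OF Suc.prems R, folded C_def])
    fix r
    have "riemann_\<phi> R r t \<le> (\<Sum>k<n r. (?K * s r k ^ p) * dt r t k)"
    proof (rule sum_mono)
      fix k assume k: "k \<in> {..<n r}"
      then have "\<phi> R (s r k) \<le> ?K * s r k ^ p"
        using Suc.IH[OF s_bounds[of k r]] by (simp add: power_mult_distrib)
      then show "\<phi> R (s r k) * dt r t k \<le> (?K * s r k ^ p) * dt r t k"
        using is_partition_min(2)[OF ip Suc.prems, of k r] k by (intro mult_right_mono) auto
    qed
    also have "\<dots> = ?K * (\<Sum>k<n r. s r k ^ p * dt r t k)"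
      by (simp only: sum_distrib_left mult.assoc)
    also have "\<dots> \<le> ?K * (t ^ Suc p / real (Suc p))"
      by (intro mult_left_mono left_riemann_sum_power_le[OF ip Suc.prems] K)
    finally show "riemann_\<phi> R r t \<le> ?K * (t ^ Suc p / real (Suc p))" .
  qed
  also have "\<dots> = R\<^sup>2 * ((C * t) ^ Suc p / fact (Suc p))"
    by (simp add: power_mult_distrib field_simps)
  finally show ?case .
qed

lemma \<phi>_zero:
  assumes "t \<in> {0..T}" "0 \<le> R" shows "\<phi> R t = 0"
proof -
  let ?C = "4 * (T * \<mu>\<^sup>2) + 8 * S"
  have "(\<lambda>p. R\<^sup>2 * ((?C * t) ^ p / fact p)) \<longlonglongrightarrow> R\<^sup>2 * 0"
    using summable_LIMSEQ_zero[OF summable_exp[of "?C * t"]]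
    by (intro tendsto_mult tendsto_const) (simp add: divide_inverse mult.commute)
  then have "\<phi> R t \<le> R\<^sup>2 * 0"
    by (rule LIMSEQ_le_const) (use \<phi>_power_bound[OF assms(2,1)] in auto)
  then show ?thesis using \<phi>_nonneg[of R t] by simp
qed

text \<open>A continuous path is bounded on \<open>{0..T}\<close> and hence lies in
  \<open>G (real R) t\<close> for some natural \<open>R\<close>, so countably many null sets
  suffice.\<close>

lemma AE_D_zero:
  assumes t: "t \<in> {0..T}" shows "AE w in M. D t w = 0"
proof -
  have "AE w in M. \<forall>R. indicator (G (real R) t) w * (D t w)\<^sup>2 = 0"
    unfolding AE_all_countable
  proof
    fix R :: nat
    show "AE w in M. indicator (G (real R) t) w * (D t w)\<^sup>2 = 0"
      using \<phi>_zero[OF t, of "real R"] integral_nonneg_eq_0_iff_AE[OF G_square_integrable[OF t, of "real R"]]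
      by (simp add: \<phi>_def)
  qed
  then show ?thesis using AE_D_continuous AE_space
  proof eventually_elim
    case (elim w)
    obtain K where K: "\<And>u. u \<in> {0..T} \<Longrightarrow> \<bar>D u w\<bar> \<le> K" using continuous_on_bound[OF elim(2)] by metis
    obtain R :: nat where "K \<le> real R" using real_arch_simple by blast
    then have "\<bar>D u w\<bar> \<le> real R" if "u \<in> {0..T}" for u using K[OF that] by linarith
    then have "w \<in> G (real R) t" using elim(3) t by (auto simp: G_def)
    then show ?case using elim(1)[rule_format, of R] by simp
  qed
qed

text \<open>The null set of \<open>AE_D_zero\<close> depends on \<open>t\<close>. It is united over
  the countable grid, and continuity, through \<open>bounded_on_grid\<close> with bound
  \<open>0\<close>, covers the other times.\<close>

theorem solution_eq_gbm: "AE w in M. \<forall>t\<in>{0..T}. U t w = gbm v0 \<mu> c t w"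
proof -
  have "AE w in M. \<forall>q\<in>grid T \<inter> {0..T}. D q w = 0"
    using AE_D_zero countable_grid by (subst AE_ball_countable) auto
  then show ?thesis using AE_D_continuous
  proof eventually_elim
    case (elim w)
    have "\<bar>D t w\<bar> \<le> 0" if "t \<in> {0..T}" for t
      by (rule bounded_on_grid[OF T_pos elim(2), of T]) (use elim(1) that T_pos in auto)
    then show ?case by (simp add: D_def)
  qed
qed

end

lemma (in brownian_family) sde_component_unique:
  assumes c: "0 < (\<Sum>j=1..m. (c j)\<^sup>2)"
    and U: "continuous_process M T U" "adapted_process F T U"
    and ito: "ito_integral M F T m W (\<lambda>j t w. U t w * c j) X"
    and eq: "AE w in M. \<forall>t\<in>{0..T}. U t w = v0 + (LBINT u:{0..t}. U u w * \<mu>) + X t w"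
  shows "AE w in M. \<forall>t\<in>{0..T}. U t w = gbm v0 \<mu> c t w"
proof -
  obtain n s \<Phi> where ep: "\<And>r. elementary_process F T m (n r) (s r) (\<Phi> r)"
    and L2: "tendsto_in_prob (completion M)
      (\<lambda>r w. LBINT u:{0..T}. (\<Sum>j=1..m. (elementary_value (n r) (s r) (\<Phi> r) j u w - U u w * c j)\<^sup>2)) (\<lambda>_. 0)"
    and conv: "\<And>t. t \<in> {0..T} \<Longrightarrow> tendsto_in_prob (completion M) (\<lambda>r. elementary_integral m W (n r) (s r) (\<Phi> r) t) (X t)"
    using ito unfolding ito_integral_def by blast
  note ip = elementary_process_partition[OF ep]
  have ei: "elementary_integral m W (n r * Suc r) (refine (Suc r) (s r)) (\<lambda>l. \<Phi> r (l div Suc r)) t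
      = elementary_integral m W (n r) (s r) (\<Phi> r) t" for r t
    by (rule ext, rule elementary_integral_refine) simp
  \<comment> \<open>Splitting every cell into \<open>Suc r\<close> pieces keeps integrands and
    integrals but makes the mesh vanish, as the locale demands.\<close>
  interpret sde_solution_component M T m W c \<mu> v0 U X "\<lambda>r. n r * Suc r" "\<lambda>r. refine (Suc r) (s r)" "\<lambda>r l. \<Phi> r (l div Suc r)"
  proof unfold_locales
    show "fine_partitions T (\<lambda>r. n r * Suc r) (\<lambda>r. refine (Suc r) (s r))"
      by (rule fine_partitions_refine[OF ip])
    show "elementary_process F T m (n r * Suc r) (refine (Suc r) (s r)) (\<lambda>l. \<Phi> r (l div Suc r))" for r
      by (rule elementary_process_refine[OF ep zero_less_Suc]) (rule F_measurable_mono)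
    show "tendsto_in_prob (completion M)
      (\<lambda>r w. LBINT u:{0..T}. (\<Sum>j=1..m. (elementary_value (n r * Suc r) (refine (Suc r) (s r)) (\<lambda>l. \<Phi> r (l div Suc r)) j u w - U u w * c j)\<^sup>2)) (\<lambda>_. 0)"
      unfolding elementary_value_refine[OF ip zero_less_Suc] by (rule L2)
    show "tendsto_in_prob (completion M)
        (\<lambda>r. elementary_integral m W (n r * Suc r) (refine (Suc r) (s r)) (\<lambda>l. \<Phi> r (l div Suc r)) t) (X t)" if "t \<in> {0..T}" for t
      unfolding ei by (rule conv[OF that])
  qed (use c U eq in auto)
  show ?thesis by (rule solution_eq_gbm)
qed

theorem proposition2p1:
  fixes M :: "'w measure"
    and N m :: nat
    and T :: real
    and W :: "nat \<Rightarrow> real \<Rightarrow> 'w \<Rightarrow> real"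
    and \<mu> V0 :: "nat \<Rightarrow> real"
    and \<sigma> :: "nat \<Rightarrow> nat \<Rightarrow> real"
    and V :: "nat \<Rightarrow> real \<Rightarrow> 'w \<Rightarrow> real"
  assumes "prob_space M"
    and "N \<ge> 1" and "m \<ge> 1" and "T > 0"
    and "\<forall>j\<in>{1..m}. standard_brownian_motion M T (W j)"
    and "independent_processes M T m W"
    and "\<forall>i\<in>{1..N}. V0 i > 0"
    and "\<forall>i\<in>{1..N}. (\<Sum>j=1..m. (\<sigma> i j)\<^sup>2) > 0"
    and V_def: "V = (\<lambda>i t \<omega>. V0 i * exp ((\<mu> i - 1/2 * (\<Sum>j=1..m. (\<sigma> i j)\<^sup>2)) * t
                                       + (\<Sum>j=1..m. \<sigma> i j * W j t \<omega>)))"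
  shows "sde_solution M T m W N (\<lambda>i v. v i * \<mu> i) (\<lambda>i j v. v i * \<sigma> i j) V0 V
    \<and> (\<forall>U. sde_solution M T m W N (\<lambda>i v. v i * \<mu> i) (\<lambda>i j v. v i * \<sigma> i j) V0 U
          \<longrightarrow> indistinguishable M T N U V)
    \<and> (\<forall>i\<in>{1..N}. \<forall>t\<in>{0<..T}.
          log_normal M (V i t)
        \<and> integrable M (V i t)
        \<and> prob_space.expectation M (V i t) = V0 i * exp (\<mu> i * t)
        \<and> integrable M (\<lambda>\<omega>. (V i t \<omega>)\<^sup>2)
        \<and> prob_space.variance M (V i t)
            = (V0 i)\<^sup>2 * exp (2 * \<mu> i * t) * (exp ((\<Sum>j=1..m. (\<sigma> i j)\<^sup>2) * t) - 1))"
proof -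
  interpret prob_space M by fact
  interpret brownian_family M T m W
    by unfold_locales (use assms in auto)
  have V: "V i = gbm (V0 i) (\<mu> i) (\<sigma> i)" for i
    unfolding V_def gbm_def[abs_def] ..
  have \<sigma>: "0 < (\<Sum>j=1..m. (\<sigma> i j)\<^sup>2)" if "i \<in> {1..N}" for i using assms(8) that by blast
  have "sde_solution M T m W N (\<lambda>i v. v i * \<mu> i) (\<lambda>i j v. v i * \<sigma> i j) V0 V"
    unfolding sde_solution_def
  proof (intro ballI conjI)
    fix i assume i: "i \<in> {1..N}"
    show "continuous_process M T (V i)"
      unfolding V continuous_process_def by (rule AE_gbm_continuous)
    show "adapted_process F T (V i)"
      unfolding V adapted_process_def by (auto intro: gbm_adapted)
    show "AE w in M. set_integrable lborel {0..T} (\<lambda>s. (\<lambda>k\<in>{1..N}. V k s w) i * \<mu> i)"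
      unfolding restrict_apply'[OF i] V using AE_gbm_continuous[of "V0 i" "\<mu> i" "\<sigma> i"]
      by eventually_elim (intro borel_integrable_atLeastAtMost' continuous_intros)
    show "\<exists>X. ito_integral M F T m W (\<lambda>j s w. (\<lambda>k\<in>{1..N}. V k s w) i * \<sigma> i j) X \<and>
        (AE w in M. \<forall>t\<in>{0..T}. V i t w = V0 i + (LBINT s:{0..t}. (\<lambda>k\<in>{1..N}. V k s w) i * \<mu> i) + X t w)"
      \<comment> \<open>The witness \<open>X\<close> is \<open>V\<close> minus its initial value and
        its time integral, so the equation holds identically; the content is in
        \<open>ito_integral_gbm\<close>.\<close>
      unfolding restrict_apply'[OF i] V by (intro exI conjI, rule ito_integral_gbm[OF \<sigma>[OF i]]) simp
  qed
  moreover have "indistinguishable M T N U V"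
    if U: "sde_solution M T m W N (\<lambda>i v. v i * \<mu> i) (\<lambda>i j v. v i * \<sigma> i j) V0 U" for U
  proof -
    have "AE w in M. \<forall>t\<in>{0..T}. U i t w = V i t w" if i: "i \<in> {1..N}" for i
    proof -
      obtain X where "continuous_process M T (U i)" "adapted_process F T (U i)"
        "ito_integral M F T m W (\<lambda>j s w. U i s w * \<sigma> i j) X"
        "AE w in M. \<forall>t\<in>{0..T}. U i t w = V0 i + (LBINT s:{0..t}. U i s w * \<mu> i) + X t w"
        using bspec[OF U[unfolded sde_solution_def] i] unfolding restrict_apply'[OF i] by blast
      then show ?thesis unfolding V by (rule sde_component_unique[OF \<sigma>[OF i]])
    qed
    \<comment> \<open>The null set may depend on \<open>i\<close>, but there are finitely many
      components.\<close>
    then show ?thesis unfolding indistinguishable_def by (rule AE_finite_allI[OF finite_atLeastAtMost])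
  qed
  moreover have "log_normal M (V i t) \<and> integrable M (V i t) \<and> expectation (V i t) = V0 i * exp (\<mu> i * t)
      \<and> integrable M (\<lambda>w. (V i t w)\<^sup>2)
      \<and> variance (V i t) = (V0 i)\<^sup>2 * exp (2 * \<mu> i * t) * (exp ((\<Sum>j=1..m. (\<sigma> i j)\<^sup>2) * t) - 1)"
    if i: "i \<in> {1..N}" and t: "t \<in> {0<..T}" for i t
  proof -
    have t': "t \<in> {0..T}" using t by auto
    note mo = gbm_moments[OF \<sigma>[OF i] t', of "V0 i" "\<mu> i", folded V]
    have "variance (V i t) = (V0 i)\<^sup>2 * exp ((2 * \<mu> i + (\<Sum>j=1..m. (\<sigma> i j)\<^sup>2)) * t) - (V0 i * exp (\<mu> i * t))\<^sup>2"
      using variance_eq[OF mo(1,3)] mo(2,4) by simp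
    also have "\<dots> = (V0 i)\<^sup>2 * exp (2 * \<mu> i * t) * (exp ((\<Sum>j=1..m. (\<sigma> i j)\<^sup>2) * t) - 1)"
      by (simp add: power_mult_distrib distrib_right exp_add right_diff_distrib exp_double[symmetric] mult.assoc)
    finally show ?thesis
      using mo(1-3) gbm_log_normal[OF \<sigma>[OF i] t, of "V0 i" "\<mu> i"] assms(7) i by (simp add: V)
  qed
  ultimately show ?thesis by blast
qed

end
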